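(* Let $n\geq 4$ be an even integer, let $m\geq 1$ be an integer, let $U\in M_n$ be a skew-symmetric unitary matrix ($U^T=-U$), and let $\Phi_B : M_n\to M_n$ be the Breuer--Hall map $\Phi_B(X)=\mathrm{Tr}(X)I - X - UX^TU^*$. Then \[ \nu_m(\Phi_B)\leq \frac{m}{2}(n+2)-1 \quad\text{and}\quad \nu(\Phi_B)\leq \frac{n}{2}+1. \]
   Context: $M_n$ is the set of $n\times n$ complex matrices. A density matrix is a positive semidefinite matrix with trace $1$. $A\succeq O$ means that $A$ is positive semidefinite. The support of a Hermitian matrix is its range. $I_m\otimes\Phi$ acts as the identity map on $M_m$ tensored with $\Phi$. For a Hermiticity-preserving linear map $\Phi$ on $M_n$ (one sending Hermitian matrices to Hermitian matrices), $\nu_m(\Phi)$ is the maximum of $\dim(\mathcal{S})$ over all subspaces $\mathcal{S}\subseteq\mathbb{C}^m\otimes\mathbb{C}^n$ such that $(I_m\otimes\Phi)(\rho)\not\succeq O$ for every density matrix $\rho\in M_m\otimes M_n$ with support contained in $\mathcal{S}$; and $\nu(\Phi)=\lim_{m\to\infty}\nu_m(\Phi)/m$ (this limit always exists). *)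

theory Defs
  imports
    "Jordan_Normal_Form.VS_Connect"
    "Jordan_Normal_Form.Schur_Decomposition"
begin

definition mat_trace :: "complex mat \<Rightarrow> complex" where
  "mat_trace A = (\<Sum>i<dim_row A. A $$ (i, i))"

definition hermitian :: "nat \<Rightarrow> complex mat \<Rightarrow> bool" where
  "hermitian n A \<longleftrightarrow> A \<in> carrier_mat n n \<and> mat_adjoint A = A"

definition psd :: "nat \<Rightarrow> complex mat \<Rightarrow> bool" where
  "psd n A \<longleftrightarrow> hermitian n A \<and> (\<forall>v \<in> carrier_vec n. 0 \<le> Re ((A *\<^sub>v v) \<bullet>c v))"

definition density_matrix :: "nat \<Rightarrow> complex mat \<Rightarrow> bool" where
  "density_matrix n \<rho> \<longleftrightarrow> psd n \<rho> \<and> mat_trace \<rho> = 1"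

definition mat_support :: "complex mat \<Rightarrow> complex vec set" where
  "mat_support A = (\<lambda>v. A *\<^sub>v v) ` carrier_vec (dim_col A)"

definition unitary_mat :: "nat \<Rightarrow> complex mat \<Rightarrow> bool" where
  "unitary_mat n U \<longleftrightarrow>
     U \<in> carrier_mat n n \<and> U * mat_adjoint U = 1\<^sub>m n \<and> mat_adjoint U * U = 1\<^sub>m n"

text \<open>
  The space \<open>C\<^sup>m \<otimes> C\<^sup>n\<close> is identified with \<open>C\<^sup>m\<^sup>n\<close> so that \<open>e\<^sub>i \<otimes> e\<^sub>k\<close> is the unit vector with
  index \<open>i * n + k\<close> (the Kronecker convention).  A matrix in \<open>M\<^sub>m \<otimes> M\<^sub>n\<close> is then an \<open>m \<times> m\<close> array
  of \<open>n \<times> n\<close> blocks, and \<open>I\<^sub>m \<otimes> \<Phi>\<close> applies the linear map \<open>\<Phi>\<close> to every block; see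
  \<open>id_tensor_kron\<close> below.
\<close>

definition mat_block :: "nat \<Rightarrow> complex mat \<Rightarrow> nat \<Rightarrow> nat \<Rightarrow> complex mat" where
  "mat_block n X i j = mat n n (\<lambda>(k, l). X $$ (i * n + k, j * n + l))"

definition id_tensor :: "nat \<Rightarrow> nat \<Rightarrow> (complex mat \<Rightarrow> complex mat) \<Rightarrow> complex mat \<Rightarrow> complex mat" where
  "id_tensor m n \<Phi> X =
     mat (m * n) (m * n) (\<lambda>(a, b). \<Phi> (mat_block n X (a div n) (b div n)) $$ (a mod n, b mod n))"

definition kron :: "nat \<Rightarrow> nat \<Rightarrow> complex mat \<Rightarrow> complex mat \<Rightarrow> complex mat" where
  "kron m n A B = mat (m * n) (m * n) (\<lambda>(a, b). A $$ (a div n, b div n) * B $$ (a mod n, b mod n))"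

lemma id_tensor_kron:
  assumes B: "B \<in> carrier_mat n n"
    and maps: "\<Phi> B \<in> carrier_mat n n"
    and homog: "\<And>c. \<Phi> (c \<cdot>\<^sub>m B) = c \<cdot>\<^sub>m \<Phi> B"
  shows "id_tensor m n \<Phi> (kron m n A B) = kron m n A (\<Phi> B)"
proof (rule eq_matI)
  fix a b
  assume "a < dim_row (kron m n A (\<Phi> B))" "b < dim_col (kron m n A (\<Phi> B))"
  then have ab: "a < m * n" "b < m * n"
    by (simp_all add: kron_def)
  then have n: "0 < n"
    by (cases n) auto
  have d: "a div n < m" "b div n < m"
    using ab by (simp_all add: less_mult_imp_div_less)
  have idx: "i * n + k < m * n" if "i < m" "k < n" for i k
  proof -
    have "i * n + k < Suc i * n" using that by simp
    also have "\<dots> \<le> m * n" using that by (intro mult_le_mono1) simp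
    finally show ?thesis .
  qed
  have "mat_block n (kron m n A B) (a div n) (b div n) = A $$ (a div n, b div n) \<cdot>\<^sub>m B"
    using B d n by (intro eq_matI) (auto simp: mat_block_def kron_def idx)
  then show "id_tensor m n \<Phi> (kron m n A B) $$ (a, b) = kron m n A (\<Phi> B) $$ (a, b)"
    using ab maps n by (simp add: id_tensor_def kron_def homog)
qed (simp_all add: id_tensor_def kron_def)

abbreviation tensor_space :: "nat \<Rightarrow> nat \<Rightarrow> (complex, complex vec) module" where
  "tensor_space m n \<equiv> module_vec TYPE(complex) (m * n)"

definition nu_admissible :: "nat \<Rightarrow> nat \<Rightarrow> (complex mat \<Rightarrow> complex mat) \<Rightarrow> complex vec set \<Rightarrow> bool" where
  "nu_admissible m n \<Phi> S \<longleftrightarrow>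
     VectorSpace.subspace class_ring S (tensor_space m n) \<and>
     (\<forall>\<rho>. density_matrix (m * n) \<rho> \<and> mat_support \<rho> \<subseteq> S \<longrightarrow> \<not> psd (m * n) (id_tensor m n \<Phi> \<rho>))"

text \<open>
  The set below is nonempty, as the zero subspace is admissible (it supports no density matrix),
  and it is bounded by \<open>m * n\<close>, so \<open>Max\<close> is a genuine maximum.
\<close>

definition nu_m :: "nat \<Rightarrow> nat \<Rightarrow> (complex mat \<Rightarrow> complex mat) \<Rightarrow> nat" where
  "nu_m m n \<Phi> =
     Max {vectorspace.dim class_ring ((tensor_space m n)\<lparr>carrier := S\<rparr>) | S. nu_admissible m n \<Phi> S}"

definition nu :: "nat \<Rightarrow> (complex mat \<Rightarrow> complex mat) \<Rightarrow> real" where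
  "nu n \<Phi> = lim (\<lambda>m. real (nu_m m n \<Phi>) / real m)"

definition breuer_hall :: "nat \<Rightarrow> complex mat \<Rightarrow> complex mat \<Rightarrow> complex mat" where
  "breuer_hall n U X =
     mat_trace X \<cdot>\<^sub>m 1\<^sub>m n - X - U * transpose_mat X * mat_adjoint U"

end

theory Submission
  imports Defs
    "HOL-Analysis.Function_Topology"
begin

text \<open>
  Write \<open>n = 2k\<close>.  As \<open>U\<close> is skew, there is an orthonormal system \<open>f\<^sub>1, \<dots>, f\<^sub>k\<close> such that
  the vectors \<open>f\<^sub>a\<close> and \<open>g\<^sub>a = U (cnj f\<^sub>a)\<close> together form an orthonormal basis of \<open>C\<^sup>n\<close>; let
  \<open>W\<close> be the span of the \<open>f\<^sub>a\<close>.  A subspace of dimension at least \<open>m (k + 1)\<close> meets \<open>C\<^sup>m \<otimes> W\<close>,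
  which has codimension \<open>m k\<close>, in dimension at least \<open>m\<close>.  On states supported in \<open>C\<^sup>m \<otimes> W\<close> the
  Breuer--Hall map splits into the reduction map on \<open>W\<close> and, on the complement of \<open>W\<close>, a copy of
  \<open>X \<mapsto> Tr(X) I - X\<^sup>T\<close>, which is completely positive.  It remains to find, in an \<open>m\<close>-dimensional
  subspace \<open>T\<close> of \<open>C\<^sup>m \<otimes> C\<^sup>k\<close>, a state \<open>\<tau>\<close> with \<open>\<tau> \<le> Tr\<^sub>B \<tau> \<otimes> I\<close>.  If there were none, convex
  separation would give \<open>Y > 0\<close> with \<open>Y > Tr\<^sub>B Y \<otimes> I\<close> on \<open>T\<close>; after a congruence by
  \<open>(Tr\<^sub>B Y)\<^sup>-\<^sup>1\<^sup>/\<^sup>2 \<otimes> I\<close> one may take \<open>Tr\<^sub>B Y = I\<close>, so that \<open>Y\<close> has trace \<open>m\<close>, although its form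
  exceeds \<open>1\<close> on \<open>m\<close> orthonormal vectors.  The limit exists by superadditivity and Fekete's lemma.
\<close>

section \<open>Sesquilinear forms on finite index sets\<close>

text \<open>Pure states do not suffice. For a unit vector \<open>v\<close> with reduced state
  \<open>R\<close>, the form of \<open>R \<otimes> I\<close> minus the projection onto
  \<open>v\<close>, evaluated at \<open>v\<close>, is the trace of \<open>R\<close> squared minus 1.
  This is negative unless \<open>v\<close> is a product vector, and an m-dimensional subspace of the
  tensor product need not contain one. So the state is mixed in general and is obtained by duality
  rather than written down. The space \<open>W\<close> is chosen orthogonal to its image under the
  antilinear map given by \<open>U\<close> and conjugation. The operator that maps
  \<open>f\<^sub>b\<close> to \<open>f\<^sub>a\<close> and kills the other basis vectors is carried
  by transposition and conjugation with \<open>U\<close> to the one that maps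
  \<open>g\<^sub>a\<close> to \<open>g\<^sub>b\<close>. Hence the two subtracted terms act on
  orthogonal blocks, while the trace term is present on both. The threshold \<open>m (k + 1)\<close>
  is \<open>m k + m\<close>: \<open>m k\<close> equations remove the components along the
  \<open>g\<^sub>a\<close>, and \<open>m\<close> vectors have to remain because the normalised
  \<open>Y\<close> has trace exactly \<open>m\<close>. Integrality of the dimension gives the final
  \<open>- 1\<close>.\<close>

lemma homogeneous_system_nontrivial:
  fixes a :: "'e \<Rightarrow> 'j \<Rightarrow> 'f :: field"
  assumes "finite E" and "finite J" and "card E < card J"
  obtains x where "\<exists>j\<in>J. x j \<noteq> 0" and "\<forall>e\<in>E. (\<Sum>j\<in>J. a e j * x j) = 0"
proof -
  have "\<exists>x. (\<exists>j\<in>J. x j \<noteq> 0) \<and> (\<forall>e\<in>E. (\<Sum>j\<in>J. a e j * x j) = 0)"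
    using assms
  proof (induction E arbitrary: a J rule: finite_induct)
    case empty
    then have "J \<noteq> {}" by auto
    then show ?case by (intro exI[of _ "\<lambda>_. 1"]) auto
  next
    case (insert e E)
    show ?case
    proof (cases "\<forall>j\<in>J. a e j = 0")
      case True
      have "card E < card J" using insert by simp
      from insert.IH[OF insert.prems(1) this] obtain x where
        "\<exists>j\<in>J. x j \<noteq> 0" "\<forall>e\<in>E. (\<Sum>j\<in>J. a e j * x j) = 0" by blast
      with True show ?thesis by (intro exI[of _ x]) auto
    next
      case False
      then obtain j0 where j0: "j0 \<in> J" "a e j0 \<noteq> 0" by blast
      define J' where "J' = J - {j0}"
      have J': "finite J'" "card E < card J'"
        using insert j0 by (auto simp: J'_def)
      \<comment> \<open>Gaussian elimination: equation \<open>e\<close> is solved for the unknown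
        \<open>j0\<close> and substituted into the others. One equation and one unknown disappear,
        so there are still more unknowns than equations.\<close>
      from insert.IH[OF J', where a = "\<lambda>e' j. a e' j - a e' j0 * a e j / a e j0"] obtain x where
        x: "\<exists>j\<in>J'. x j \<noteq> 0"
          "\<forall>e'\<in>E. (\<Sum>j\<in>J'. (a e' j - a e' j0 * a e j / a e j0) * x j) = 0" by blast
      define t where "t = (\<Sum>j\<in>J'. a e j * x j)"
      define y where "y = x(j0 := - t / a e j0)"
      have split: "(\<Sum>j\<in>J. a e' j * y j) = (\<Sum>j\<in>J'. a e' j * x j) - a e' j0 * t / a e j0" for e'
      proof -
        have "(\<Sum>j\<in>J. a e' j * y j) = a e' j0 * y j0 + (\<Sum>j\<in>J'. a e' j * y j)"
          unfolding J'_def using insert.prems j0 by (simp add: sum.remove)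
        also have "(\<Sum>j\<in>J'. a e' j * y j) = (\<Sum>j\<in>J'. a e' j * x j)"
          by (intro sum.cong) (auto simp: y_def J'_def)
        finally show ?thesis by (simp add: y_def)
      qed
      have "(\<Sum>j\<in>J. a e j * y j) = 0"
        unfolding split using j0 by (simp add: t_def)
      moreover have "(\<Sum>j\<in>J. a e' j * y j) = 0" if "e' \<in> E" for e'
      proof -
        have "(\<Sum>j\<in>J'. (a e' j - a e' j0 * a e j / a e j0) * x j)
          = (\<Sum>j\<in>J'. a e' j * x j) - a e' j0 * t / a e j0"
          by (simp add: t_def algebra_simps sum_subtractf sum_distrib_left sum_divide_distrib)
        then show ?thesis using x(2) that unfolding split by simp
      qed
      moreover have "\<exists>j\<in>J. y j \<noteq> 0" using x(1) by (auto simp: y_def J'_def)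
      ultimately show ?thesis by (intro exI[of _ y]) auto
    qed
  qed
  with that show ?thesis by blast
qed

lemma left_inverse_imp_right_inverse:
  fixes A B :: "'i \<Rightarrow> 'i \<Rightarrow> 'f :: field"
  assumes I: "finite I"
    and AB: "\<And>s t. s \<in> I \<Longrightarrow> t \<in> I \<Longrightarrow> (\<Sum>i\<in>I. A s i * B i t) = of_bool (s = t)"
    and "i \<in> I" "j \<in> I"
  shows "(\<Sum>s\<in>I. B i s * A s j) = of_bool (i = j)"
proof -
  \<comment> \<open>In dimension \<open>card I\<close> the columns of \<open>B\<close> together with \<open>e\<^sub>j\<close> satisfy a nontrivial relation,
    in which \<open>e\<^sub>j\<close> must occur; applying \<open>A\<close> to it reads off its coefficients.\<close>
  define c where "c i z = (case z of None \<Rightarrow> of_bool (i = j) | Some s \<Rightarrow> B i s)" for i z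
  have split: "(\<Sum>z\<in>insert None (Some ` I). f z) = f None + (\<Sum>s\<in>I. f (Some s))" for f :: "'i option \<Rightarrow> 'f"
    using I by (simp add: sum.reindex)
  have "card (insert None (Some ` I)) = Suc (card I)" using I by (simp add: card_image)
  then obtain x where x: "\<exists>z\<in>insert None (Some ` I). x z \<noteq> 0"
    "\<forall>i\<in>I. (\<Sum>z\<in>insert None (Some ` I). c i z * x z) = 0"
    using homogeneous_system_nontrivial[of I "insert None (Some ` I)" c] I by auto
  have rel: "(\<Sum>s\<in>I. B i s * x (Some s)) = - of_bool (i = j) * x None" if "i \<in> I" for i
    using x(2) that unfolding split by (simp add: c_def eq_neg_iff_add_eq_0 add.commute)
  have xs: "x (Some s) = - A s j * x None" if s: "s \<in> I" for s
  proof -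
    have "(\<Sum>i\<in>I. A s i * (\<Sum>t\<in>I. B i t * x (Some t))) = (\<Sum>t\<in>I. (\<Sum>i\<in>I. A s i * B i t) * x (Some t))"
      unfolding sum_distrib_left sum_distrib_right mult.assoc by (rule sum.swap)
    also have "\<dots> = (\<Sum>t\<in>I. of_bool (s = t) * x (Some t))"
      using AB s by (intro sum.cong) auto
    also have "\<dots> = x (Some s)" using s I
      by (simp add: of_bool_def if_distrib[where f="\<lambda>c. c * _"] cong: if_cong)
    also have "(\<Sum>i\<in>I. A s i * (\<Sum>t\<in>I. B i t * x (Some t))) = (\<Sum>i\<in>I. A s i * (- of_bool (i = j) * x None))"
      using rel by (intro sum.cong) auto
    also have "\<dots> = (\<Sum>i\<in>I. if i = j then - A s j * x None else 0)" by (intro sum.cong) auto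
    also have "\<dots> = - A s j * x None" using \<open>j \<in> I\<close> I by (simp only: sum.delta) simp
    finally show ?thesis by simp
  qed
  have "x None \<noteq> 0" using x(1) xs by auto
  have "(\<Sum>s\<in>I. B i s * A s j) * x None = - (\<Sum>s\<in>I. B i s * x (Some s))"
    by (simp add: xs sum_distrib_right sum_negf mult.assoc)
  also have "\<dots> = of_bool (i = j) * x None" using rel[OF \<open>i \<in> I\<close>] by simp
  finally show ?thesis using \<open>x None \<noteq> 0\<close> by simp
qed

text \<open>Forms live on arbitrary index sets instead of being matrices, so that the same facts
  serve for single indices, for pairs of indices (tensor products) and for Gram matrices of
  families. The first argument is the conjugate-linear one.\<close>

definition sesq :: "'a set \<Rightarrow> ('a \<Rightarrow> 'a \<Rightarrow> complex) \<Rightarrow> ('a \<Rightarrow> complex) \<Rightarrow> ('a \<Rightarrow> complex) \<Rightarrow> complex" where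
  "sesq I Q u v = (\<Sum>p\<in>I. \<Sum>q\<in>I. cnj (u p) * Q p q * v q)"

definition herm_on :: "'a set \<Rightarrow> ('a \<Rightarrow> 'a \<Rightarrow> complex) \<Rightarrow> bool" where
  "herm_on I Q \<longleftrightarrow> (\<forall>p\<in>I. \<forall>q\<in>I. Q q p = cnj (Q p q))"

definition psd_on :: "'a set \<Rightarrow> ('a \<Rightarrow> 'a \<Rightarrow> complex) \<Rightarrow> bool" where
  "psd_on I Q \<longleftrightarrow> herm_on I Q \<and> (\<forall>v. 0 \<le> Re (sesq I Q v v))"

definition pd_on :: "'a set \<Rightarrow> ('a \<Rightarrow> 'a \<Rightarrow> complex) \<Rightarrow> bool" where
  "pd_on I Q \<longleftrightarrow> herm_on I Q \<and> (\<forall>v. (\<exists>p\<in>I. v p \<noteq> 0) \<longrightarrow> 0 < Re (sesq I Q v v))"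

text \<open>It plays three roles: as a form it is the standard inner product, \<open>delta p\<close>
  is the unit vector at \<open>p\<close>, and it is the Gram matrix of an orthonormal
  family.\<close>

definition delta :: "'a \<Rightarrow> 'a \<Rightarrow> complex" where
  "delta p q = of_bool (p = q)"

lemma cnj_delta [simp]: "cnj (delta p q) = delta p q"
  by (simp add: delta_def)

lemma sum_delta [simp]:
  assumes "finite I"
  shows "(\<Sum>q\<in>I. delta p q * f q) = (if p \<in> I then f p else 0)"
    and "(\<Sum>q\<in>I. f q * delta q p) = (if p \<in> I then f p else 0)"
    and "(\<Sum>q\<in>I. delta q p * f q) = (if p \<in> I then f p else 0)"
    and "(\<Sum>q\<in>I. f q * delta p q) = (if p \<in> I then f p else 0)"
  using assms by (simp_all add: delta_def if_distrib[where f="\<lambda>c. c * _"] if_distrib[where f="\<lambda>c. _ * c"] of_bool_def cong: if_cong)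

lemma sesq_cong:
  assumes "\<And>p q. p \<in> I \<Longrightarrow> q \<in> I \<Longrightarrow> Q p q = Q' p q" "\<And>p. p \<in> I \<Longrightarrow> u p = u' p" "\<And>p. p \<in> I \<Longrightarrow> v p = v' p"
  shows "sesq I Q u v = sesq I Q' u' v'"
  unfolding sesq_def using assms by (intro sum.cong refl arg_cong2[where f = "(*)"]) auto

lemma sesq_sum_right:
  "sesq I Q u (\<lambda>p. \<Sum>j\<in>J. v j p) = (\<Sum>j\<in>J. sesq I Q u (v j))"
proof -
  have "sesq I Q u (\<lambda>p. \<Sum>j\<in>J. v j p) = (\<Sum>p\<in>I. \<Sum>q\<in>I. \<Sum>j\<in>J. cnj (u p) * Q p q * v j q)"
    by (simp add: sesq_def sum_distrib_left)
  also have "\<dots> = (\<Sum>p\<in>I. \<Sum>j\<in>J. \<Sum>q\<in>I. cnj (u p) * Q p q * v j q)"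
    by (intro sum.cong refl sum.swap)
  also have "\<dots> = (\<Sum>j\<in>J. \<Sum>p\<in>I. \<Sum>q\<in>I. cnj (u p) * Q p q * v j q)"
    by (rule sum.swap)
  finally show ?thesis by (simp add: sesq_def)
qed

lemma sesq_sum_left:
  "sesq I Q (\<lambda>p. \<Sum>j\<in>J. u j p) v = (\<Sum>j\<in>J. sesq I Q (u j) v)"
proof -
  have "sesq I Q (\<lambda>p. \<Sum>j\<in>J. u j p) v = (\<Sum>p\<in>I. \<Sum>q\<in>I. \<Sum>j\<in>J. cnj (u j p) * Q p q * v q)"
    by (simp add: sesq_def sum_distrib_right cnj_sum)
  also have "\<dots> = (\<Sum>p\<in>I. \<Sum>j\<in>J. \<Sum>q\<in>I. cnj (u j p) * Q p q * v q)"
    by (intro sum.cong refl sum.swap)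
  also have "\<dots> = (\<Sum>j\<in>J. \<Sum>p\<in>I. \<Sum>q\<in>I. cnj (u j p) * Q p q * v q)"
    by (rule sum.swap)
  finally show ?thesis by (simp add: sesq_def)
qed

lemma sesq_scale_right: "sesq I Q u (\<lambda>p. c * v p) = c * sesq I Q u v"
  unfolding sesq_def sum_distrib_left by (intro sum.cong refl) (simp add: algebra_simps)

lemma sesq_scale_left: "sesq I Q (\<lambda>p. c * u p) v = cnj c * sesq I Q u v"
  unfolding sesq_def sum_distrib_left by (intro sum.cong refl) (simp add: algebra_simps)

lemma sesq_diff_left: "sesq I Q (\<lambda>p. u p - u' p) v = sesq I Q u v - sesq I Q u' v"
  by (simp add: sesq_def algebra_simps sum_subtractf)

lemma sesq_diff_right: "sesq I Q u (\<lambda>p. v p - v' p) = sesq I Q u v - sesq I Q u v'"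
  by (simp add: sesq_def algebra_simps sum_subtractf)

lemma sesq_swap:
  assumes "herm_on I Q"
  shows "sesq I Q v u = cnj (sesq I Q u v)"
proof -
  have "cnj (sesq I Q u v) = (\<Sum>p\<in>I. \<Sum>q\<in>I. cnj (v q) * Q q p * u p)"
    unfolding sesq_def cnj_sum
  proof (intro sum.cong refl)
    fix p q assume "p \<in> I" "q \<in> I"
    then have Qqp: "Q q p = cnj (Q p q)" using assms unfolding herm_on_def by blast
    show "cnj (cnj (u p) * Q p q * v q) = cnj (v q) * Q q p * u p"
      by (subst Qqp) simp
  qed
  also have "\<dots> = sesq I Q v u" unfolding sesq_def by (rule sum.swap)
  finally show ?thesis by simp
qed

lemma sesq_self_real: "herm_on I Q \<Longrightarrow> sesq I Q v v = of_real (Re (sesq I Q v v))"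
  using sesq_swap[of I Q v v] by (auto simp: complex_eq_iff)

lemma pd_imp_psd: "pd_on I Q \<Longrightarrow> psd_on I Q"
  unfolding pd_on_def psd_on_def
proof (intro conjI allI)
  fix v
  assume *: "herm_on I Q \<and> (\<forall>v. (\<exists>p\<in>I. v p \<noteq> 0) \<longrightarrow> 0 < Re (sesq I Q v v))"
  show "0 \<le> Re (sesq I Q v v)"
  proof (cases "\<exists>p\<in>I. v p \<noteq> 0")
    case True
    with * have "0 < Re (sesq I Q v v)" by blast
    then show ?thesis by simp
  next
    case False
    then have "sesq I Q v v = 0" by (simp add: sesq_def)
    then show ?thesis by simp
  qed
qed auto

lemma sesq_delta: "finite I \<Longrightarrow> sesq I delta u v = (\<Sum>p\<in>I. cnj (u p) * v p)"
  by (simp add: sesq_def mult.assoc sum_distrib_left[symmetric])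

lemma pd_delta: "finite I \<Longrightarrow> pd_on I delta"
  unfolding pd_on_def
proof (intro conjI allI impI)
  fix v :: "'a \<Rightarrow> complex" assume I: "finite I" and v: "\<exists>p\<in>I. v p \<noteq> 0"
  have "Re (sesq I delta v v) = (\<Sum>p\<in>I. (cmod (v p))\<^sup>2)"
    unfolding sesq_delta[OF I] by (simp add: cmod_power2) (simp add: power2_eq_square)
  then show "0 < Re (sesq I delta v v)" using I v by (auto intro!: sum_pos2)
qed (auto simp: herm_on_def delta_def)

definition independent_on :: "'a set \<Rightarrow> 'j set \<Rightarrow> ('j \<Rightarrow> 'a \<Rightarrow> complex) \<Rightarrow> bool" where
  "independent_on I J c \<longleftrightarrow> (\<forall>x. (\<forall>p\<in>I. (\<Sum>j\<in>J. x j * c j p) = 0) \<longrightarrow> (\<forall>j\<in>J. x j = 0))"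

text \<open>Gram-Schmidt and the intersection with the kernel of the functionals \<open>a e\<close>
  in a single induction. The next vector has to satisfy \<open>card E\<close> constraints and be
  orthogonal to the vectors found so far; as long as fewer than \<open>r\<close> have been found,
  these are fewer equations than the \<open>card J\<close> unknown coefficients.\<close>

lemma orthonormal_family_in_span:
  assumes "finite I" "finite J" "finite E"
    and c: "independent_on I J c" and Q: "pd_on I Q"
    and card: "card E + r \<le> card J"
  obtains x :: "nat \<Rightarrow> 'j \<Rightarrow> complex" where
    "\<And>s t. s < r \<Longrightarrow> t < r \<Longrightarrow>
       sesq I Q (\<lambda>p. \<Sum>j\<in>J. x s j * c j p) (\<lambda>p. \<Sum>j\<in>J. x t j * c j p) = delta s t"
    and "\<And>t e. t < r \<Longrightarrow> e \<in> E \<Longrightarrow> (\<Sum>p\<in>I. a e p * (\<Sum>j\<in>J. x t j * c j p)) = 0"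
proof -
  define V where "V y = (\<lambda>p. \<Sum>j\<in>J. y j * c j p)" for y
  have "\<exists>x. (\<forall>s<r. \<forall>t<r. sesq I Q (V (x s)) (V (x t)) = delta s t) \<and>
     (\<forall>t<r. \<forall>e\<in>E. (\<Sum>p\<in>I. a e p * V (x t) p) = 0)"
    using card
  proof (induction r)
    case 0
    then show ?case by simp
  next
    case (Suc r)
    then obtain x where x: "\<forall>s<r. \<forall>t<r. sesq I Q (V (x s)) (V (x t)) = delta s t"
      "\<forall>t<r. \<forall>e\<in>E. (\<Sum>p\<in>I. a e p * V (x t) p) = 0" by auto
    have "card (E <+> {..<r}) < card J" using Suc.prems \<open>finite E\<close> by (simp add: card_Plus)
    \<comment> \<open>One system for the coefficients of the new vector: \<open>Inl e\<close> asks
      for the constraint \<open>e\<close>, \<open>Inr s\<close> for orthogonality to the vector with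
      index \<open>s\<close>.\<close>
    define b where "b e j = (case e of Inl e \<Rightarrow> \<Sum>p\<in>I. a e p * c j p | Inr s \<Rightarrow> sesq I Q (V (x s)) (c j))"
      for e j
    obtain y where y: "\<exists>j\<in>J. y j \<noteq> 0" and
      eqs: "\<forall>e\<in>E <+> {..<r}. (\<Sum>j\<in>J. b e j * y j) = 0"
      by (rule homogeneous_system_nontrivial[OF _ \<open>finite J\<close> \<open>card (E <+> {..<r}) < card J\<close>, of b])
        (use \<open>finite E\<close> in auto)
    have ya: "(\<Sum>p\<in>I. a e p * V y p) = 0" if "e \<in> E" for e
    proof -
      have "(\<Sum>p\<in>I. a e p * V y p) = (\<Sum>j\<in>J. (\<Sum>p\<in>I. a e p * c j p) * y j)"
        unfolding V_def sum_distrib_left sum_distrib_right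
        by (subst sum.swap) (simp add: mult.assoc mult.commute mult.left_commute)
      also have "\<dots> = 0" using bspec[OF eqs InlI[OF that]] by (simp add: b_def)
      finally show ?thesis .
    qed
    have yx: "sesq I Q (V (x s)) (V y) = 0" if "s < r" for s
    proof -
      have "sesq I Q (V (x s)) (V y) = (\<Sum>j\<in>J. sesq I Q (V (x s)) (c j) * y j)"
        unfolding V_def[of y] sesq_sum_right sesq_scale_right by (simp add: mult.commute)
      also have "\<dots> = 0" using bspec[OF eqs InrI, of s] that by (simp add: b_def)
      finally show ?thesis .
    qed
    have H: "herm_on I Q" using Q by (simp add: pd_on_def)
    define N where "N = Re (sesq I Q (V y) (V y))"
    have "\<exists>p\<in>I. V y p \<noteq> 0" using c y unfolding independent_on_def V_def by blast
    then have N: "N > 0" using Q by (simp add: pd_on_def N_def)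
    define g where "g = complex_of_real (1 / sqrt N)"
    define z where "z = (\<lambda>j. g * y j)"
    have Vz: "V z = (\<lambda>p. g * V y p)"
      by (simp add: V_def z_def sum_distrib_left mult.assoc fun_eq_iff)
    have zz: "sesq I Q (V z) (V z) = 1"
    proof -
      have "sesq I Q (V z) (V z) = cnj g * g * of_real N"
        unfolding Vz sesq_scale_left sesq_scale_right N_def using sesq_self_real[OF H, of "V y"] by simp
      also have "\<dots> = of_real ((1 / sqrt N) * (1 / sqrt N) * N)"
        by (simp only: g_def of_real_mult complex_cnj_complex_of_real)
      also have "(1 / sqrt N) * (1 / sqrt N) * N = 1" using N by (simp add: real_sqrt_mult_self)
      finally show ?thesis by simp
    qed
    have xz: "sesq I Q (V (x s)) (V z) = 0" "sesq I Q (V z) (V (x s)) = 0" if "s < r" for s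
      unfolding Vz sesq_scale_right sesq_scale_left
      using yx[OF that] sesq_swap[OF H, of "V y" "V (x s)"] by simp_all
    have az: "(\<Sum>p\<in>I. a e p * V z p) = 0" if "e \<in> E" for e
    proof -
      have "(\<Sum>p\<in>I. a e p * V z p) = g * (\<Sum>p\<in>I. a e p * V y p)"
        by (simp add: Vz sum_distrib_left mult.left_commute)
      then show ?thesis using ya[OF that] by simp
    qed
    define x' where "x' = x(r := z)"
    have x': "x' r = z" "s < r \<Longrightarrow> x' s = x s" for s by (auto simp: x'_def)
    have "sesq I Q (V (x' s)) (V (x' t)) = delta s t" if st: "s < Suc r" "t < Suc r" for s t
    proof -
      consider "s < r" "t < r" | "s = r" "t < r" | "s < r" "t = r" | "s = r" "t = r"
        using st by (auto simp: less_Suc_eq)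
      then show ?thesis
      proof cases
        case 1 then show ?thesis using x(1) by (simp add: x'(2))
      next
        case 2 then show ?thesis using xz(2) by (simp add: x' delta_def)
      next
        case 3 then show ?thesis using xz(1) by (simp add: x' delta_def)
      next
        case 4 then show ?thesis using zz by (simp add: x' delta_def)
      qed
    qed
    moreover have "(\<Sum>p\<in>I. a e p * V (x' t) p) = 0" if t: "t < Suc r" and e: "e \<in> E" for t e
    proof (cases "t = r")
      case True then show ?thesis using az[OF e] by (simp only: x')
    next
      case False
      then have "t < r" using t by simp
      then show ?thesis using x(2) e by (simp only: x')
    qed
    ultimately show ?case by blast
  qed
  then obtain x where "\<forall>s<r. \<forall>t<r. sesq I Q (V (x s)) (V (x t)) = delta s t"
     "\<forall>t<r. \<forall>e\<in>E. (\<Sum>p\<in>I. a e p * V (x t) p) = 0" by blast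
  then show ?thesis unfolding V_def by (intro that[of x]) simp_all
qed

text \<open>The difference of the two sides is the trace of the compression of \<open>Y\<close> to
  the orthogonal complement of the \<open>w t\<close>, hence nonnegative.\<close>

lemma sum_orthonormal_le_trace:
  fixes r :: nat
  assumes I: "finite I" and Y: "psd_on I Y"
    and on: "\<And>s t. s < r \<Longrightarrow> t < r \<Longrightarrow> (\<Sum>p\<in>I. cnj (w s p) * w t p) = delta s t"
  shows "(\<Sum>t<r. Re (sesq I Y (w t) (w t))) \<le> (\<Sum>p\<in>I. Re (Y p p))"
proof -
  \<comment> \<open>\<open>u q = (1 - P) e\<^sub>q\<close> for the orthogonal projection \<open>P\<close> onto the span of the \<open>w t\<close>.\<close>
  define u where "u q = (\<lambda>p. delta q p - (\<Sum>t<r. cnj (w t q) * w t p))" for q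
  have H: "herm_on I Y" using Y by (simp add: psd_on_def)
  have ee: "sesq I Y (delta q) v = (\<Sum>p\<in>I. Y q p * v p)" if "q \<in> I" for q v
  proof -
    have "sesq I Y (delta q) v = (\<Sum>p\<in>I. delta q p * (\<Sum>p'\<in>I. Y p p' * v p'))"
      by (simp add: sesq_def sum_distrib_left mult.assoc)
    then show ?thesis using I that by simp
  qed
  have qsum: "(\<Sum>q\<in>I. cnj (w t q) * sesq I Y (delta q) v) = sesq I Y (w t) v" for t v
  proof -
    have "(\<Sum>q\<in>I. cnj (w t q) * sesq I Y (delta q) v) = (\<Sum>q\<in>I. cnj (w t q) * (\<Sum>p\<in>I. Y q p * v p))"
      by (intro sum.cong) (simp_all add: ee)
    then show ?thesis by (simp add: sesq_def sum_distrib_left mult.assoc)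
  qed
  have expand: "sesq I Y (u q) (u q) = sesq I Y (delta q) (delta q)
     - (\<Sum>t<r. cnj (w t q) * sesq I Y (delta q) (w t))
     - (\<Sum>t<r. w t q * cnj (sesq I Y (delta q) (w t)))
     + (\<Sum>s<r. \<Sum>t<r. w s q * cnj (w t q) * sesq I Y (w s) (w t))" for q
  proof -
    have "sesq I Y (w t) (delta q) = cnj (sesq I Y (delta q) (w t))" for t
      by (rule sesq_swap[OF H])
    then show ?thesis
    unfolding u_def sesq_diff_left sesq_diff_right sesq_sum_left sesq_sum_right
      sesq_scale_left sesq_scale_right
    by (simp add: sum_distrib_left algebra_simps sum_subtractf)
  qed
  have "(\<Sum>q\<in>I. sesq I Y (u q) (u q)) = (\<Sum>q\<in>I. sesq I Y (delta q) (delta q))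
     - (\<Sum>t<r. sesq I Y (w t) (w t)) - cnj (\<Sum>t<r. sesq I Y (w t) (w t))
     + (\<Sum>s<r. \<Sum>t<r. (\<Sum>q\<in>I. cnj (w t q) * w s q) * sesq I Y (w s) (w t))"
  proof -
    have 1: "(\<Sum>q\<in>I. \<Sum>t<r. cnj (w t q) * sesq I Y (delta q) (w t)) = (\<Sum>t<r. sesq I Y (w t) (w t))"
      by (subst sum.swap) (simp add: qsum)
    have 2: "(\<Sum>q\<in>I. \<Sum>t<r. w t q * cnj (sesq I Y (delta q) (w t))) = cnj (\<Sum>t<r. sesq I Y (w t) (w t))"
      unfolding 1[symmetric] by simp
    have 3: "(\<Sum>q\<in>I. \<Sum>s<r. \<Sum>t<r. w s q * cnj (w t q) * sesq I Y (w s) (w t))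
       = (\<Sum>s<r. \<Sum>t<r. (\<Sum>q\<in>I. cnj (w t q) * w s q) * sesq I Y (w s) (w t))"
      unfolding sum_distrib_right
      by (subst sum.swap, rule sum.cong[OF refl], subst sum.swap) (simp add: mult.commute)
    show ?thesis unfolding expand 1[symmetric] 3[symmetric]
      by (simp add: sum.distrib sum_subtractf)
  qed
  \<comment> \<open>Orthonormality collapses the double sum to one copy of the sum over the
    \<open>w t\<close>, which makes up for one of the two subtracted copies.\<close>
  also have "(\<Sum>s<r. \<Sum>t<r. (\<Sum>q\<in>I. cnj (w t q) * w s q) * sesq I Y (w s) (w t))
     = (\<Sum>s<r. \<Sum>t<r. delta t s * sesq I Y (w s) (w t))"
    using on by (intro sum.cong) auto
  also have "\<dots> = (\<Sum>s<r. sesq I Y (w s) (w s))" by (intro sum.cong) simp_all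
  also have "(\<Sum>q\<in>I. sesq I Y (delta q) (delta q)) = (\<Sum>q\<in>I. Y q q)"
    using I by (simp add: ee)
  finally have "Re (\<Sum>q\<in>I. sesq I Y (u q) (u q)) = (\<Sum>q\<in>I. Re (Y q q)) - (\<Sum>t<r. Re (sesq I Y (w t) (w t)))"
    by simp
  moreover have "Re (\<Sum>q\<in>I. sesq I Y (u q) (u q)) \<ge> 0"
    using Y by (simp add: psd_on_def sum_nonneg)
  ultimately show ?thesis by simp
qed


text \<open>The family is indexed by \<open>I\<close> itself, so the matrix of the
  \<open>b s\<close> is square. Orthonormality says that it has a left inverse, built from
  \<open>Q\<close>; the left inverse is also a right inverse, and that is the expansion.\<close>

lemma orthonormal_expansion:
  assumes I: "finite I"
    and on: "\<And>s t. s \<in> I \<Longrightarrow> t \<in> I \<Longrightarrow> sesq I Q (b s) (b t) = delta s t"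
    and p: "p \<in> I"
  shows "v p = (\<Sum>s\<in>I. sesq I Q (b s) v * b s p)"
proof -
  define A where "A s i = (\<Sum>p\<in>I. cnj (b s p) * Q p i)" for s i
  have A: "sesq I Q (b s) w = (\<Sum>i\<in>I. A s i * w i)" for s w
    unfolding sesq_def A_def sum_distrib_right by (rule sum.swap)
  have "(\<Sum>s\<in>I. sesq I Q (b s) v * b s p) = (\<Sum>i\<in>I. (\<Sum>s\<in>I. b s p * A s i) * v i)"
    unfolding A sum_distrib_right by (subst sum.swap) (simp add: mult.commute mult.left_commute)
  also have "\<dots> = (\<Sum>i\<in>I. delta p i * v i)"
  proof (intro sum.cong refl arg_cong2[where f = "(*)"])
    fix i assume "i \<in> I"
    then show "(\<Sum>s\<in>I. b s p * A s i) = delta p i" unfolding delta_def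
      using left_inverse_imp_right_inverse[OF I, of A "\<lambda>i s. b s i" p i] on p by (simp add: A delta_def)
  qed
  also have "\<dots> = v p" using I p by simp
  finally show ?thesis by simp
qed

lemma sesq_expansion:
  "sesq I Q (\<lambda>x. \<Sum>p\<in>P. u p * b p x) (\<lambda>x. \<Sum>q\<in>P. v q * b q x) = sesq P (\<lambda>p q. sesq I Q (b p) (b q)) u v"
  unfolding sesq_sum_left sesq_sum_right sesq_scale_left sesq_scale_right
  by (simp add: sesq_def[of P] sum_distrib_left mult_ac)

lemma psd_congruence:
  assumes "psd_on I Q"
  shows "psd_on P (\<lambda>p q. sesq I Q (b p) (b q))"
proof -
  have "herm_on I Q" using assms by (simp add: psd_on_def)
  then have "herm_on P (\<lambda>p q. sesq I Q (b p) (b q))"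
    unfolding herm_on_def[of P] by (blast intro: sesq_swap)
  then show ?thesis using assms by (simp add: psd_on_def sesq_expansion[symmetric])
qed

section \<open>A theorem of the alternative for positive semidefinite forms\<close>

lemma sesq_unit: "finite I \<Longrightarrow> p \<in> I \<Longrightarrow> q \<in> I \<Longrightarrow> sesq I Q (delta p) (delta q) = Q p q"
  by (simp add: sesq_def sum_distrib_left[symmetric] mult.assoc)

lemma psd_diag_nonneg: "psd_on I Q \<Longrightarrow> finite I \<Longrightarrow> p \<in> I \<Longrightarrow> 0 \<le> Re (Q p p)"
  unfolding psd_on_def by (metis sesq_unit)

lemma psd_entry_bound:
  assumes "finite I" and Q: "psd_on I Q" and "p \<in> I" "q \<in> I"
  shows "2 * cmod (Q p q) \<le> Re (Q p p) + Re (Q q q)"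
proof (cases "Q p q = 0")
  case True
  then show ?thesis using psd_diag_nonneg[OF Q \<open>finite I\<close>] assms by simp
next
  case False
  \<comment> \<open>The phase that rotates \<open>Q p q\<close> onto its modulus. Testing
    \<open>Q\<close> on the unit vector at \<open>p\<close> minus \<open>u\<close> times the one at
    \<open>q\<close> then yields the bound.\<close>
  define u where "u = cnj (Q p q) / cmod (Q p q)"
  have Qqp: "Q q p = cnj (Q p q)"
    using Q \<open>p \<in> I\<close> \<open>q \<in> I\<close> unfolding psd_on_def herm_on_def by blast
  have sq: "cmod (Q p q) * cmod (Q p q) = Re (Q p q) * Re (Q p q) + Im (Q p q) * Im (Q p q)"
    using cmod_power2[of "Q p q"] by (simp add: power2_eq_square)
  have u: "u * Q p q = cmod (Q p q)" "cnj u * cnj (Q p q) = cmod (Q p q)" "cnj u * u = 1"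
    using False by (simp_all add: u_def complex_norm_square[symmetric] mult.commute power2_eq_square field_simps)
  have "sesq I Q (\<lambda>x. delta p x - u * delta q x) (\<lambda>x. delta p x - u * delta q x)
     = Q p p - u * Q p q - cnj u * Q q p + cnj u * u * Q q q"
    unfolding sesq_diff_left sesq_diff_right sesq_scale_left sesq_scale_right
    using assms by (simp add: sesq_unit algebra_simps)
  also have "\<dots> = Q p p - 2 * cmod (Q p q) + Q q q"
    unfolding u(3) by (subst Qqp) (simp add: u)
  finally have "Re (Q p p - 2 * cmod (Q p q) + Q q q) \<ge> 0"
    using Q unfolding psd_on_def by metis
  then show ?thesis by simp
qed

lemma psd_rank_one: "finite I \<Longrightarrow> psd_on I (\<lambda>p q. z p * cnj (z q))"
  unfolding psd_on_def
proof (intro conjI allI)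
  fix v
  have "sesq I (\<lambda>p q. z p * cnj (z q)) v v = (\<Sum>p\<in>I. cnj (v p) * z p) * cnj (\<Sum>p\<in>I. cnj (v p) * z p)"
    unfolding sesq_def cnj_sum sum_product by (intro sum.cong refl) (simp add: algebra_simps)
  also have "\<dots> = of_real ((cmod (\<Sum>p\<in>I. cnj (v p) * z p))\<^sup>2)"
    by (rule complex_norm_square[symmetric])
  finally show "0 \<le> Re (sesq I (\<lambda>p q. z p * cnj (z q)) v v)"
    by (simp only: Re_complex_of_real zero_le_power2)
qed (auto simp: herm_on_def)

lemma sesq_lincomb_form:
  "sesq I (\<lambda>p q. a * Q p q + b * Q' p q) u v = a * sesq I Q u v + b * sesq I Q' u v"
  by (simp add: sesq_def sum_distrib_left sum.distrib algebra_simps)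

lemma psd_convex:
  assumes "psd_on I Q" "psd_on I Q'" "0 \<le> t" "t \<le> (1 :: real)"
  shows "psd_on I (\<lambda>p q. of_real (1 - t) * Q p q + of_real t * Q' p q)"
proof -
  have "herm_on I (\<lambda>p q. of_real (1 - t) * Q p q + of_real t * Q' p q)"
    unfolding herm_on_def
  proof (intro ballI)
    fix p q assume "p \<in> I" "q \<in> I"
    then have e: "Q q p = cnj (Q p q)" "Q' q p = cnj (Q' p q)"
      using assms(1,2) unfolding psd_on_def herm_on_def by blast+
    show "of_real (1 - t) * Q q p + of_real t * Q' q p = cnj (of_real (1 - t) * Q p q + of_real t * Q' p q)"
      by (subst e(1), subst e(2)) simp
  qed
  then show ?thesis using assms unfolding psd_on_def sesq_lincomb_form by simp
qed

text \<open>The separating functional is the point of the image closest to the origin. Convexity is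
  asked only of the image, through a preimage \<open>z\<close> of each convex combination, so
  \<open>K\<close> may be any compact space without linear structure.\<close>

lemma closest_point_alternative:
  fixes \<phi> :: "'a :: topological_space \<Rightarrow> 'i \<Rightarrow> complex"
  assumes K: "compact K" "K \<noteq> {}" and I: "finite I"
    and cont: "\<And>i. i \<in> I \<Longrightarrow> continuous_on K (\<lambda>x. \<phi> x i)"
    and convex: "\<And>x y t. x \<in> K \<Longrightarrow> y \<in> K \<Longrightarrow> 0 \<le> t \<Longrightarrow> t \<le> (1 :: real) \<Longrightarrow>
      \<exists>z\<in>K. \<forall>i\<in>I. \<phi> z i = of_real (1 - t) * \<phi> x i + of_real t * \<phi> y i"
    and nz: "\<And>x. x \<in> K \<Longrightarrow> \<exists>i\<in>I. \<phi> x i \<noteq> 0"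
  obtains x0 where "x0 \<in> K" "\<And>x. x \<in> K \<Longrightarrow> 0 < Re (\<Sum>i\<in>I. cnj (\<phi> x0 i) * \<phi> x i)"
proof -
  define f where "f x = (\<Sum>i\<in>I. (cmod (\<phi> x i))\<^sup>2)" for x
  have "continuous_on K f" unfolding f_def by (intro continuous_intros cont)
  from continuous_attains_inf[OF K this] obtain x0 where x0: "x0 \<in> K" "\<And>y. y \<in> K \<Longrightarrow> f x0 \<le> f y"
    by blast
  have pos: "f x0 > 0" unfolding f_def using nz[OF x0(1)] I by (auto intro!: sum_pos2)
  have "0 < Re (\<Sum>i\<in>I. cnj (\<phi> x0 i) * \<phi> x i)" if x: "x \<in> K" for x
  proof -
    define d where "d i = \<phi> x i - \<phi> x0 i" for i
    define D where "D = (\<Sum>i\<in>I. Re (cnj (\<phi> x0 i) * d i))"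
    define g where "g = (\<Sum>i\<in>I. (cmod (d i))\<^sup>2)"
    \<comment> \<open>Minimality of \<open>x0\<close> along the segment towards \<open>x\<close>:
      the squared norm grows by \<open>t * (2 * D + t * g)\<close>, and the factor \<open>t\<close>
      is divided out.\<close>
    have ineq: "0 \<le> 2 * D + t * g" if t: "0 < t" "t \<le> 1" for t :: real
    proof -
      obtain z where z: "z \<in> K" "\<forall>i\<in>I. \<phi> z i = of_real (1 - t) * \<phi> x0 i + of_real t * \<phi> x i"
        using convex[OF x0(1) x, of t] t by auto
      have "(cmod (\<phi> z i))\<^sup>2 = (cmod (\<phi> x0 i))\<^sup>2 + 2 * t * Re (cnj (\<phi> x0 i) * d i) + t\<^sup>2 * (cmod (d i))\<^sup>2"
        if "i \<in> I" for i
      proof -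
        have "\<phi> z i = \<phi> x0 i + of_real t * d i" using z(2) that by (simp add: d_def algebra_simps)
        then show ?thesis
          by (simp add: cmod_power2) (simp add: power2_eq_square algebra_simps)
      qed
      then have "f z = f x0 + 2 * t * D + t\<^sup>2 * g"
        unfolding f_def D_def g_def sum_distrib_left sum.distrib[symmetric] by (rule sum.cong[OF refl])
      then have "0 \<le> t * (2 * D + t * g)"
        using x0(2)[OF z(1)] by (simp add: power2_eq_square algebra_simps)
      then show ?thesis using t by (simp add: zero_le_mult_iff)
    qed
    have "0 \<le> D"
    proof (rule ccontr)
      assume "\<not> 0 \<le> D"
      then have D: "D < 0" by simp
      have g0: "0 \<le> g" unfolding g_def by (simp add: sum_nonneg)
      \<comment> \<open>So small that \<open>t * g\<close> is at most \<open>- D\<close>, which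
        would leave \<open>2 * D + t * g\<close> negative. The \<open>+ 1\<close> keeps the
        denominator positive when \<open>g\<close> vanishes.\<close>
      define t where "t = min 1 (- D / (g + 1))"
      have "0 < - D / (g + 1)" using D g0 by (intro divide_pos_pos) auto
      then have t: "0 < t" "t \<le> 1" by (auto simp: t_def)
      have "t * g \<le> (- D / (g + 1)) * g" using g0 by (intro mult_right_mono) (auto simp: t_def)
      also have "\<dots> \<le> - D" using D g0 by (simp add: field_simps)
      finally show False using ineq[OF t] D by simp
    qed
    \<comment> \<open>Strictness comes from the second summand: \<open>f x0\<close> is positive
      because the image avoids the origin.\<close>
    have "Re (\<Sum>i\<in>I. cnj (\<phi> x0 i) * \<phi> x i) = (\<Sum>i\<in>I. Re (cnj (\<phi> x0 i) * d i) + (cmod (\<phi> x0 i))\<^sup>2)"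
      unfolding Re_sum
      by (intro sum.cong refl, simp add: cmod_power2 d_def) (simp add: power2_eq_square algebra_simps)
    also have "\<dots> = D + f x0" by (simp only: D_def f_def sum.distrib)
    finally show ?thesis using \<open>0 \<le> D\<close> pos by simp
  qed
  with x0(1) that show ?thesis by blast
qed

section \<open>Compactness of a base of the cone of pairs of semidefinite forms\<close>

lemma continuous_on_matrix_entry:
  fixes \<tau> :: "'s :: topological_space \<Rightarrow> 'a \<Rightarrow> 'b \<Rightarrow> complex"
  assumes "continuous_on S \<tau>"
  shows "continuous_on S (\<lambda>x. \<tau> x p q)"
  by (rule continuous_on_product_then_coordinatewise[OF continuous_on_product_then_coordinatewise[OF assms]])

text \<open>Tychonoff's theorem. Forms are total functions on types that may be infinite, so
  compactness is that of a product over all indices.\<close>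

lemma compact_Pi_UNIV:
  fixes S :: "'i \<Rightarrow> 'b :: topological_space set"
  assumes "\<And>i. compact (S i)"
  shows "compact (Pi UNIV S)"
proof -
  have "compactin (product_topology (\<lambda>_. euclidean) UNIV) (PiE UNIV S)"
    unfolding compactin_PiE using assms by simp
  then show ?thesis by (simp add: euclidean_product_topology PiE_UNIV_domain)
qed

lemma compact_complex_square: "compact {z. \<bar>Re z\<bar> \<le> c \<and> \<bar>Im z\<bar> \<le> c}"
proof -
  have "compact ((\<lambda>p. of_real (fst p) + \<i> * of_real (snd p)) ` ({- c..c} \<times> {- c..c}) :: complex set)"
    by (intro compact_continuous_image compact_Times compact_Icc continuous_intros)
  also have "(\<lambda>p. of_real (fst p) + \<i> * of_real (snd p)) ` ({- c..c} \<times> {- c..c})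
    = {z. \<bar>Re z\<bar> \<le> c \<and> \<bar>Im z\<bar> \<le> c}"
  proof (intro subset_antisym subsetI)
    fix z assume "z \<in> {z. \<bar>Re z\<bar> \<le> c \<and> \<bar>Im z\<bar> \<le> c}"
    then show "z \<in> (\<lambda>p. of_real (fst p) + \<i> * of_real (snd p)) ` ({- c..c} \<times> {- c..c})"
      by (intro image_eqI[of _ _ "(Re z, Im z)"]) (auto simp: complex_eq_iff)
  qed auto
  finally show ?thesis .
qed

lemma compact_matrix_cube:
  "compact {\<tau> :: 'a \<Rightarrow> 'b \<Rightarrow> complex. \<forall>p q. \<bar>Re (\<tau> p q)\<bar> \<le> c \<and> \<bar>Im (\<tau> p q)\<bar> \<le> c}"
proof -
  have "{\<tau> :: 'a \<Rightarrow> 'b \<Rightarrow> complex. \<forall>p q. \<bar>Re (\<tau> p q)\<bar> \<le> c \<and> \<bar>Im (\<tau> p q)\<bar> \<le> c}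
    = Pi UNIV (\<lambda>p. Pi UNIV (\<lambda>q. {z. \<bar>Re z\<bar> \<le> c \<and> \<bar>Im z\<bar> \<le> c}))"
    by (auto simp: Pi_iff)
  then show ?thesis by (simp only:) (intro compact_Pi_UNIV compact_complex_square)
qed

lemma closed_psd:
  fixes \<tau> :: "'s :: topological_space \<Rightarrow> 'a \<Rightarrow> 'a \<Rightarrow> complex"
  assumes "continuous_on UNIV \<tau>"
  shows "closed {x. psd_on I (\<tau> x)}"
proof -
  have "closed {x. \<tau> x q p = cnj (\<tau> x p q)}" for p q
    by (intro closed_Collect_eq continuous_intros continuous_on_matrix_entry[OF assms])
  moreover have "closed {x. 0 \<le> Re (sesq I (\<tau> x) v v)}" for v
    unfolding sesq_def by (intro closed_Collect_le continuous_intros continuous_on_matrix_entry[OF assms])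
  moreover have "{x. psd_on I (\<tau> x)} = (\<Inter>p\<in>I. \<Inter>q\<in>I. {x. \<tau> x q p = cnj (\<tau> x p q)})
      \<inter> (\<Inter>v. {x. 0 \<le> Re (sesq I (\<tau> x) v v)})"
    by (auto simp: psd_on_def herm_on_def)
  ultimately show ?thesis by (simp only:) (intro closed_Int closed_INT ballI)
qed

text \<open>A base of the cone of pairs: the joint trace is normalised, so that either component may
  vanish. The entries outside the index sets are pinned to zero since they would otherwise be free
  coordinates and destroy compactness.\<close>

definition psd_pairs :: "'a set \<Rightarrow> 'b set \<Rightarrow> (('a \<Rightarrow> 'a \<Rightarrow> complex) \<times> ('b \<Rightarrow> 'b \<Rightarrow> complex)) set" where
  "psd_pairs A B = {(\<sigma>, Z). psd_on A \<sigma> \<and> psd_on B Z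
     \<and> (\<forall>p q. p \<notin> A \<or> q \<notin> A \<longrightarrow> \<sigma> p q = 0) \<and> (\<forall>p q. p \<notin> B \<or> q \<notin> B \<longrightarrow> Z p q = 0)
     \<and> (\<Sum>p\<in>A. Re (\<sigma> p p)) + (\<Sum>p\<in>B. Re (Z p p)) = 1}"

lemma psd_entry_le_trace:
  assumes "finite I" "psd_on I Q" "p \<in> I" "q \<in> I"
  shows "cmod (Q p q) \<le> (\<Sum>p\<in>I. Re (Q p p))"
proof -
  have "Re (Q p p) \<le> (\<Sum>p\<in>I. Re (Q p p))" if "p \<in> I" for p
    using that assms psd_diag_nonneg[OF assms(2,1)] by (intro member_le_sum) auto
  from this[of p] this[of q] psd_entry_bound[OF assms] assms(3,4) show ?thesis by simp
qed

text \<open>A closed set inside a cube: each entry of a semidefinite form is bounded by the trace,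
  and both traces lie between 0 and 1.\<close>

lemma compact_psd_pairs:
  assumes "finite A" "finite B"
  shows "compact (psd_pairs A B)"
proof -
  let ?C = "{\<tau>. \<forall>p q. \<bar>Re (\<tau> p q)\<bar> \<le> 1 \<and> \<bar>Im (\<tau> p q)\<bar> \<le> 1}"
  have fs: "continuous_on UNIV (fst :: ('a \<Rightarrow> 'a \<Rightarrow> complex) \<times> ('b \<Rightarrow> 'b \<Rightarrow> complex) \<Rightarrow> _)"
    "continuous_on UNIV (snd :: ('a \<Rightarrow> 'a \<Rightarrow> complex) \<times> ('b \<Rightarrow> 'b \<Rightarrow> complex) \<Rightarrow> _)"
    by (intro continuous_intros)+
  note ent = continuous_on_matrix_entry[OF fs(1)] continuous_on_matrix_entry[OF fs(2)]
  define T where "T = {x :: ('a \<Rightarrow> 'a \<Rightarrow> complex) \<times> ('b \<Rightarrow> 'b \<Rightarrow> complex). psd_on A (fst x)} \<inter> {x. psd_on B (snd x)}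
    \<inter> (\<Inter>(p, q)\<in>{(p, q). p \<notin> A \<or> q \<notin> A}. {x. fst x p q = 0})
    \<inter> (\<Inter>(p, q)\<in>{(p, q). p \<notin> B \<or> q \<notin> B}. {x. snd x p q = 0})
    \<inter> {x. (\<Sum>p\<in>A. Re (fst x p p)) + (\<Sum>p\<in>B. Re (snd x p p)) = 1}"
  have "closed T" unfolding T_def
    by (intro closed_Int closed_INT closed_psd fs ballI)
      (auto intro!: closed_Collect_eq continuous_intros ent)
  moreover have T: "psd_pairs A B = T"
    by (auto simp: psd_pairs_def T_def)
  moreover have "psd_pairs A B \<subseteq> ?C \<times> ?C"
  proof (rule subrelI)
    fix \<sigma> :: "'a \<Rightarrow> 'a \<Rightarrow> complex" and Z :: "'b \<Rightarrow> 'b \<Rightarrow> complex"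
    assume "(\<sigma>, Z) \<in> psd_pairs A B"
    then have *: "psd_on A \<sigma>" "psd_on B Z" "\<forall>p q. p \<notin> A \<or> q \<notin> A \<longrightarrow> \<sigma> p q = 0"
      "\<forall>p q. p \<notin> B \<or> q \<notin> B \<longrightarrow> Z p q = 0"
      "(\<Sum>p\<in>A. Re (\<sigma> p p)) + (\<Sum>p\<in>B. Re (Z p p)) = 1"
      by (simp_all add: psd_pairs_def)
    have nn: "0 \<le> (\<Sum>p\<in>A. Re (\<sigma> p p))" "0 \<le> (\<Sum>p\<in>B. Re (Z p p))"
      using psd_diag_nonneg *(1,2) assms by (auto intro!: sum_nonneg)
    have "cmod (\<sigma> p q) \<le> 1" for p q
      using psd_entry_le_trace[OF assms(1) *(1), of p q] *(3,5) nn
      by (cases "p \<in> A \<and> q \<in> A") auto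
    moreover have "cmod (Z p q) \<le> 1" for p q
      using psd_entry_le_trace[OF assms(2) *(2), of p q] *(4,5) nn
      by (cases "p \<in> B \<and> q \<in> B") auto
    ultimately show "(\<sigma>, Z) \<in> ?C \<times> ?C"
      using abs_Re_le_cmod abs_Im_le_cmod order_trans by (simp del: abs_le_iff) blast
  qed
  ultimately have eq: "psd_pairs A B = T \<inter> ?C \<times> ?C" and "closed T" by auto
  show ?thesis unfolding eq
    by (intro closed_Int_compact \<open>closed T\<close> compact_Times compact_matrix_cube)
qed

lemma psd_pairs_convex:
  assumes "(\<sigma>, Z) \<in> psd_pairs A B" "(\<sigma>', Z') \<in> psd_pairs A B" "0 \<le> t" "t \<le> (1 :: real)"
  shows "(\<lambda>p q. of_real (1 - t) * \<sigma> p q + of_real t * \<sigma>' p q,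
    \<lambda>p q. of_real (1 - t) * Z p q + of_real t * Z' p q) \<in> psd_pairs A B"
proof -
  have "(\<Sum>p\<in>A. (1 - t) * Re (\<sigma> p p) + t * Re (\<sigma>' p p)) + (\<Sum>p\<in>B. (1 - t) * Re (Z p p) + t * Re (Z' p p))
    = (1 - t) * ((\<Sum>p\<in>A. Re (\<sigma> p p)) + (\<Sum>p\<in>B. Re (Z p p)))
      + t * ((\<Sum>p\<in>A. Re (\<sigma>' p p)) + (\<Sum>p\<in>B. Re (Z' p p)))"
    by (simp only: sum.distrib sum_distrib_left[symmetric] distrib_left ac_simps)
  also have "\<dots> = 1" using assms by (simp add: psd_pairs_def)
  finally show ?thesis
    using assms psd_convex[of A \<sigma> \<sigma>' t] psd_convex[of B Z Z' t] by (simp add: psd_pairs_def)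
qed

lemma psd_scale:
  assumes Q: "psd_on I Q" and "0 \<le> (r :: real)"
  shows "psd_on I (\<lambda>p q. of_real r * Q p q)"
proof -
  have "herm_on I (\<lambda>p q. of_real r * Q p q)"
    unfolding herm_on_def
  proof (intro ballI)
    fix p q assume "p \<in> I" "q \<in> I"
    then have e: "Q q p = cnj (Q p q)" using Q unfolding psd_on_def herm_on_def by blast
    show "of_real r * Q q p = cnj (of_real r * Q p q)" by (subst e) simp
  qed
  then show ?thesis using assms sesq_lincomb_form[of I "of_real r" Q 0 Q] by (simp add: psd_on_def)
qed

lemma psd_zero: "psd_on I (\<lambda>_ _. 0)"
  by (simp add: psd_on_def herm_on_def sesq_def)

text \<open>If no semidefinite \<open>\<sigma>\<close> of positive trace has a semidefinite image,
  the differences \<open>\<Lambda> \<sigma> - Z\<close> with \<open>(\<sigma>, Z)\<close> in the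
  compact base form a compact convex set without the origin. Strict separation gives
  \<open>Y\<close>: pairs \<open>(0, Z)\<close> show that \<open>Y\<close> is positive definite,
  pairs \<open>(\<sigma>, 0)\<close> that it is negative on the images. Both inequalities are strict
  because the base is compact.\<close>

lemma psd_alternative:
  fixes \<Lambda> :: "('a \<Rightarrow> 'a \<Rightarrow> complex) \<Rightarrow> 'b \<Rightarrow> 'b \<Rightarrow> complex"
  assumes fin: "finite A" "finite B" and "A \<noteq> {}"
    and lin: "\<And>a b \<sigma> \<sigma>' p q. \<Lambda> (\<lambda>i j. a * \<sigma> i j + b * \<sigma>' i j) p q = a * \<Lambda> \<sigma> p q + b * \<Lambda> \<sigma>' p q"
    and cont: "\<And>p q. continuous_on UNIV (\<lambda>\<sigma>. \<Lambda> \<sigma> p q)"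
    and herm: "\<And>\<sigma>. psd_on A \<sigma> \<Longrightarrow> herm_on B (\<Lambda> \<sigma>)"
    and nonpsd: "\<And>\<sigma>. psd_on A \<sigma> \<Longrightarrow> psd_on B (\<Lambda> \<sigma>) \<Longrightarrow> (\<Sum>i\<in>A. Re (\<sigma> i i)) = 0"
    and trace0: "\<And>\<sigma>. psd_on A \<sigma> \<Longrightarrow> (\<Sum>i\<in>A. Re (\<sigma> i i)) = 0 \<Longrightarrow> (\<Sum>p\<in>B. Re (\<Lambda> \<sigma> p p)) = 0"
  obtains Y where "pd_on B Y"
    and "\<And>x. \<exists>i\<in>A. x i \<noteq> 0 \<Longrightarrow> \<forall>i. i \<notin> A \<longrightarrow> x i = 0 \<Longrightarrow>
      Re (\<Sum>p\<in>B. \<Sum>q\<in>B. cnj (Y p q) * \<Lambda> (\<lambda>i j. x i * cnj (x j)) p q) < 0"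
proof -
  define \<phi> where "\<phi> x i = \<Lambda> (fst x) (fst i) (snd i) - snd x (fst i) (snd i)"
    for x :: "('a \<Rightarrow> 'a \<Rightarrow> complex) \<times> ('b \<Rightarrow> 'b \<Rightarrow> complex)" and i :: "'b \<times> 'b"
  have contphi: "continuous_on (psd_pairs A B) (\<lambda>x. \<phi> x i)" for i
    unfolding \<phi>_def
    by (intro continuous_intros continuous_on_compose2[OF cont] continuous_on_matrix_entry) auto
  obtain p0 where p0: "p0 \<in> A" using \<open>A \<noteq> {}\<close> by blast
  have ne: "psd_pairs A B \<noteq> {}"
  proof -
    have "(\<Sum>p\<in>A. Re (delta p0 p * cnj (delta p0 p))) = (\<Sum>p\<in>A. if p = p0 then 1 else 0)"
      by (intro sum.cong) (auto simp: delta_def)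
    also have "\<dots> = 1" using p0 fin by simp
    finally have "(\<lambda>p q. delta p0 p * cnj (delta p0 q), \<lambda>_ _. 0) \<in> psd_pairs A B"
      using p0 psd_rank_one[OF fin(1), of "delta p0"] psd_zero[of B]
      by (auto simp: psd_pairs_def delta_def)
    then show ?thesis by blast
  qed
  have nz: "\<exists>i\<in>B \<times> B. \<phi> x i \<noteq> 0" if x: "x \<in> psd_pairs A B" for x
  proof (rule ccontr)
    assume "\<not> ?thesis"
    then have eq: "\<Lambda> (fst x) p q = snd x p q" if "p \<in> B" "q \<in> B" for p q
      using that by (force simp: \<phi>_def)
    have ps: "psd_on A (fst x)" "psd_on B (snd x)"
      and tr: "(\<Sum>i\<in>A. Re (fst x i i)) + (\<Sum>p\<in>B. Re (snd x p p)) = 1"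
      using x by (auto simp: psd_pairs_def)
    have "sesq B (\<Lambda> (fst x)) v v = sesq B (snd x) v v" for v by (intro sesq_cong eq refl)
    then have "psd_on B (\<Lambda> (fst x))" using ps(2) herm[OF ps(1)] by (simp add: psd_on_def)
    \<comment> \<open>If the image of the first component equals the second, the first has trace 0
      by \<open>nonpsd\<close>, hence the second has trace 0 by \<open>trace0\<close>; the joint
      normalisation forbids this.\<close>
    from nonpsd[OF ps(1) this] trace0[OF ps(1)] have "(\<Sum>i\<in>A. Re (fst x i i)) = 0" "(\<Sum>p\<in>B. Re (snd x p p)) = 0"
      by (simp_all add: eq)
    with tr show False by simp
  qed
  have convex: "\<exists>z\<in>psd_pairs A B. \<forall>i\<in>B \<times> B. \<phi> z i = of_real (1 - t) * \<phi> x i + of_real t * \<phi> y i"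
    if "x \<in> psd_pairs A B" "y \<in> psd_pairs A B" "0 \<le> t" "t \<le> (1 :: real)" for x y t
  proof (rule bexI)
    show "(\<lambda>p q. of_real (1 - t) * fst x p q + of_real t * fst y p q,
        \<lambda>p q. of_real (1 - t) * snd x p q + of_real t * snd y p q) \<in> psd_pairs A B" (is "?z \<in> _")
      using psd_pairs_convex[of "fst x" "snd x" A B "fst y" "snd y" t] that by simp
    show "\<forall>i\<in>B \<times> B. \<phi> ?z i = of_real (1 - t) * \<phi> x i + of_real t * \<phi> y i"
      unfolding \<phi>_def fst_conv snd_conv lin right_diff_distrib by simp
  qed
  obtain x0 where x0: "x0 \<in> psd_pairs A B"
    and sep: "\<And>x. x \<in> psd_pairs A B \<Longrightarrow> 0 < Re (\<Sum>i\<in>B \<times> B. cnj (\<phi> x0 i) * \<phi> x i)"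
    using closest_point_alternative[OF compact_psd_pairs[OF fin] ne finite_cartesian_product[OF fin(2) fin(2)]
      contphi convex nz] by blast
  \<comment> \<open>The sign is reversed because positivity of \<open>Y\<close> is to be read off
    from the \<open>- Z\<close> part of \<open>\<phi>\<close>.\<close>
  define Y where "Y p q = - \<phi> x0 (p, q)" for p q
  have cone: "Re (\<Sum>p\<in>B. \<Sum>q\<in>B. cnj (Y p q) * (\<Lambda> \<sigma> p q - Z p q)) < 0"
    if "psd_on A \<sigma>" "psd_on B Z" "\<forall>p q. p \<notin> A \<or> q \<notin> A \<longrightarrow> \<sigma> p q = 0" "\<forall>p q. p \<notin> B \<or> q \<notin> B \<longrightarrow> Z p q = 0"
      "(\<Sum>p\<in>A. Re (\<sigma> p p)) + (\<Sum>p\<in>B. Re (Z p p)) > 0" for \<sigma> Z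
  proof -
    define N where "N = (\<Sum>p\<in>A. Re (\<sigma> p p)) + (\<Sum>p\<in>B. Re (Z p p))"
    have N: "N > 0" using that(5) by (simp add: N_def)
    define c where "c = complex_of_real (1 / N)"
    have cr: "Re (c * z) = Re z / N" for z by (simp add: c_def)
    have ps: "psd_on A (\<lambda>p q. c * \<sigma> p q)" "psd_on B (\<lambda>p q. c * Z p q)"
      unfolding c_def using that N by (intro psd_scale; simp)+
    have "(\<Sum>p\<in>A. Re (c * \<sigma> p p)) + (\<Sum>p\<in>B. Re (c * Z p p)) = 1"
      unfolding cr sum_divide_distrib[symmetric] add_divide_distrib[symmetric] using N by (simp add: N_def)
    then have "(\<lambda>p q. c * \<sigma> p q, \<lambda>p q. c * Z p q) \<in> psd_pairs A B"
      using that ps by (simp add: psd_pairs_def)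
    from sep[OF this] have "0 < Re (\<Sum>i\<in>B \<times> B. c * (cnj (\<phi> x0 i) * \<phi> (\<sigma>, Z) i))"
      using lin[of c \<sigma> 0 \<sigma>] by (simp add: \<phi>_def algebra_simps)
    then have "0 < Re (\<Sum>i\<in>B \<times> B. cnj (\<phi> x0 i) * \<phi> (\<sigma>, Z) i)"
      unfolding sum_distrib_left[symmetric] cr using N by (simp add: zero_less_divide_iff)
    also have "(\<Sum>i\<in>B \<times> B. cnj (\<phi> x0 i) * \<phi> (\<sigma>, Z) i) = - (\<Sum>p\<in>B. \<Sum>q\<in>B. cnj (Y p q) * (\<Lambda> \<sigma> p q - Z p q))"
      unfolding sum.cartesian_product sum_negf[symmetric]
      by (intro sum.cong refl) (auto simp: Y_def \<phi>_def algebra_simps)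
    finally show ?thesis by simp
  qed
  have \<Lambda>0: "\<Lambda> (\<lambda>_ _. 0) p q = 0" for p q using lin[of 0 _ 0 _ p q] by simp
  \<comment> \<open>The closest point is itself of the form \<open>\<Lambda> \<sigma> - Z\<close>, a
    difference of Hermitian forms.\<close>
  have hY: "herm_on B Y"
  proof -
    have "herm_on B (\<Lambda> (fst x0))" "herm_on B (snd x0)"
      using x0 herm by (auto simp: psd_pairs_def psd_on_def)
    then have "\<phi> x0 (q, p) = cnj (\<phi> x0 (p, q))" if "p \<in> B" "q \<in> B" for p q
      using that unfolding herm_on_def \<phi>_def fst_conv snd_conv complex_cnj_diff by metis
    then show ?thesis unfolding herm_on_def Y_def complex_cnj_minus by metis
  qed
  have "pd_on B Y" unfolding pd_on_def
  proof (intro conjI hY allI impI)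
    fix v :: "'b \<Rightarrow> complex" assume v: "\<exists>p\<in>B. v p \<noteq> 0"
    define z where "z p = (if p \<in> B then v p else 0)" for p
    have pos: "0 < (\<Sum>p\<in>B. Re (z p * cnj (z p)))"
      unfolding complex_norm_square[symmetric] using v fin by (auto intro!: sum_pos2 simp: z_def)
    \<comment> \<open>The separating inequality at the pair of the zero form and the rank-one form
      of \<open>z\<close>; there it bounds the quadratic form of \<open>Y\<close> at
      \<open>v\<close>.\<close>
    have "Re (\<Sum>p\<in>B. \<Sum>q\<in>B. cnj (Y p q) * (0 - z p * cnj (z q))) < 0"
      using cone[OF psd_zero psd_rank_one[OF fin(2), of z]] pos by (simp add: \<Lambda>0 z_def)
    also have "(\<Sum>p\<in>B. \<Sum>q\<in>B. cnj (Y p q) * (0 - z p * cnj (z q))) = - cnj (sesq B Y v v)"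
      by (simp add: sesq_def cnj_sum sum_negf[symmetric] z_def mult_ac)
    finally show "0 < Re (sesq B Y v v)" by simp
  qed
  moreover have "Re (\<Sum>p\<in>B. \<Sum>q\<in>B. cnj (Y p q) * \<Lambda> (\<lambda>i j. x i * cnj (x j)) p q) < 0"
    if x: "\<exists>i\<in>A. x i \<noteq> 0" "\<forall>i. i \<notin> A \<longrightarrow> x i = 0" for x :: "'a \<Rightarrow> complex"
  proof -
    have pos: "0 < (\<Sum>p\<in>A. Re (x p * cnj (x p)))"
      unfolding complex_norm_square[symmetric] using x fin by (auto intro!: sum_pos2)
    have "\<forall>p q. p \<notin> A \<or> q \<notin> A \<longrightarrow> x p * cnj (x q) = 0" using x(2) by auto
    from cone[OF psd_rank_one[OF fin(1), of x] psd_zero this] pos show ?thesis by simp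
  qed
  ultimately show ?thesis using that by blast
qed

section \<open>The reduction map\<close>

lemma pd_pos: "pd_on I Q \<Longrightarrow> p \<in> I \<Longrightarrow> v p \<noteq> 0 \<Longrightarrow> 0 < Re (sesq I Q v v)"
  unfolding pd_on_def by blast

lemma sum_pairs: "(\<Sum>p\<in>X \<times> K. f p) = (\<Sum>i\<in>X. \<Sum>a\<in>K. f (i, a))"
  by (simp add: sum.cartesian_product)

definition ptrace :: "nat \<Rightarrow> ('x \<times> nat \<Rightarrow> 'x \<times> nat \<Rightarrow> complex) \<Rightarrow> 'x \<Rightarrow> 'x \<Rightarrow> complex" where
  "ptrace k Y i j = (\<Sum>a<k. Y (i, a) (j, a))"

definition tensor_id :: "('x \<Rightarrow> 'x \<Rightarrow> complex) \<Rightarrow> 'x \<times> nat \<Rightarrow> 'x \<times> nat \<Rightarrow> complex" where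
  "tensor_id G p q = delta (snd p) (snd q) * G (fst p) (fst q)"

text \<open>The product vector of \<open>u\<close> with the unit vector at \<open>a\<close>.\<close>

definition tensor_unit :: "('x \<Rightarrow> complex) \<Rightarrow> nat \<Rightarrow> 'x \<times> nat \<Rightarrow> complex" where
  "tensor_unit u a p = delta a (snd p) * u (fst p)"

text \<open>The map sending \<open>X\<close> to \<open>Tr(X) I - X\<close>, tensored with the
  identity on the first factor. On pair indices this is the partial trace tensored with the
  identity, minus \<open>\<tau>\<close>.\<close>

definition reduction :: "nat \<Rightarrow> ('x \<times> nat \<Rightarrow> 'x \<times> nat \<Rightarrow> complex) \<Rightarrow> 'x \<times> nat \<Rightarrow> 'x \<times> nat \<Rightarrow> complex" where
  "reduction k \<tau> p q = tensor_id (ptrace k \<tau>) p q - \<tau> p q"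

lemma sesq_pairs: "sesq (X \<times> K) Y u v =
    (\<Sum>i\<in>X. \<Sum>a\<in>K. \<Sum>j\<in>X. \<Sum>b\<in>K. cnj (u (i, a)) * Y (i, a) (j, b) * v (j, b))"
  by (simp only: sesq_def sum_pairs)

lemma sesq_tensor_unit:
  assumes "finite X" "a < k" "b < k"
  shows "sesq (X \<times> {..<k}) Y (tensor_unit u a) (tensor_unit v b)
    = (\<Sum>i\<in>X. \<Sum>j\<in>X. cnj (u i) * Y (i, a) (j, b) * v j)"
proof -
  have "sesq (X \<times> {..<k}) Y (tensor_unit u a) (tensor_unit v b)
    = (\<Sum>i\<in>X. \<Sum>a'<k. \<Sum>j\<in>X. \<Sum>b'<k. delta a a' * (delta b b' * (cnj (u i) * Y (i, a') (j, b') * v j)))"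
    unfolding sesq_pairs tensor_unit_def by (intro sum.cong refl) simp
  also have "\<dots> = (\<Sum>i\<in>X. \<Sum>j\<in>X. cnj (u i) * Y (i, a) (j, b) * v j)"
    using assms by (simp add: sum_distrib_left[symmetric])
  finally show ?thesis .
qed

lemma sum_sesq_tensor_unit:
  assumes "finite X"
  shows "(\<Sum>a<k. sesq (X \<times> {..<k}) Y (tensor_unit u a) (tensor_unit v a)) = sesq X (ptrace k Y) u v"
proof -
  have "(\<Sum>a<k. sesq (X \<times> {..<k}) Y (tensor_unit u a) (tensor_unit v a))
    = (\<Sum>a<k. \<Sum>i\<in>X. \<Sum>j\<in>X. cnj (u i) * Y (i, a) (j, a) * v j)"
    using assms by (intro sum.cong) (auto simp: sesq_tensor_unit)
  also have "\<dots> = (\<Sum>i\<in>X. \<Sum>a<k. \<Sum>j\<in>X. cnj (u i) * Y (i, a) (j, a) * v j)"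
    by (rule sum.swap)
  also have "\<dots> = (\<Sum>i\<in>X. \<Sum>j\<in>X. \<Sum>a<k. cnj (u i) * Y (i, a) (j, a) * v j)"
    by (intro sum.cong refl sum.swap)
  finally show ?thesis by (simp add: sesq_def ptrace_def sum_distrib_left sum_distrib_right)
qed

lemma sesq_tensor_id_unit:
  assumes "finite X" "a < k" "b < k"
  shows "sesq (X \<times> {..<k}) (tensor_id G) (tensor_unit u a) (tensor_unit v b) = delta a b * sesq X G u v"
  unfolding sesq_tensor_unit[OF assms]
  by (simp add: tensor_id_def sesq_def sum_distrib_left mult_ac)

lemma sesq_tensor_id:
  "sesq (X \<times> {..<k}) (tensor_id G) u v = (\<Sum>a<k. sesq X G (\<lambda>i. u (i, a)) (\<lambda>i. v (i, a)))"
proof -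
  have "sesq (X \<times> {..<k}) (tensor_id G) u v
    = (\<Sum>i\<in>X. \<Sum>a<k. \<Sum>j\<in>X. \<Sum>b<k. delta a b * (cnj (u (i, a)) * G i j * v (j, b)))"
    unfolding sesq_pairs tensor_id_def by (intro sum.cong refl) simp
  also have "\<dots> = (\<Sum>i\<in>X. \<Sum>a<k. \<Sum>j\<in>X. cnj (u (i, a)) * G i j * v (j, a))"
    by (intro sum.cong refl) simp
  also have "\<dots> = (\<Sum>a<k. \<Sum>i\<in>X. \<Sum>j\<in>X. cnj (u (i, a)) * G i j * v (j, a))"
    by (rule sum.swap)
  finally show ?thesis by (simp add: sesq_def)
qed

text \<open>Self-duality of the reduction map under the trace pairing. It turns negativity of the
  separating functional on the image of a rank-one form into the statement that \<open>Y\<close>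
  exceeds its partial trace tensored with the identity at \<open>v\<close>. The outer conjugate is
  harmless, as only real parts are compared.\<close>

lemma reduction_rank_one_dual:
  "(\<Sum>p\<in>X \<times> {..<k}. \<Sum>q\<in>X \<times> {..<k}. cnj (Y p q) * reduction k (\<lambda>p q. v p * cnj (v q)) p q)
    = cnj (sesq (X \<times> {..<k}) (tensor_id (ptrace k Y)) v v - sesq (X \<times> {..<k}) Y v v)"
proof -
  let ?P = "X \<times> {..<k}"
  have "(\<Sum>p\<in>?P. \<Sum>q\<in>?P. cnj (Y p q) * tensor_id (ptrace k (\<lambda>p q. v p * cnj (v q))) p q)
    = (\<Sum>i\<in>X. \<Sum>a<k. \<Sum>j\<in>X. \<Sum>b<k. delta a b * (cnj (Y (i, a) (j, b)) * ptrace k (\<lambda>p q. v p * cnj (v q)) i j))"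
    unfolding sum_pairs tensor_id_def by (intro sum.cong refl) simp
  also have "\<dots> = (\<Sum>i\<in>X. \<Sum>a<k. \<Sum>j\<in>X. cnj (Y (i, a) (j, a)) * ptrace k (\<lambda>p q. v p * cnj (v q)) i j)"
    by (intro sum.cong refl) simp
  also have "\<dots> = (\<Sum>i\<in>X. \<Sum>j\<in>X. \<Sum>a<k. cnj (Y (i, a) (j, a)) * ptrace k (\<lambda>p q. v p * cnj (v q)) i j)"
    by (intro sum.cong refl sum.swap)
  also have "\<dots> = (\<Sum>i\<in>X. \<Sum>j\<in>X. \<Sum>a<k. v (i, a) * cnj (ptrace k Y i j) * cnj (v (j, a)))"
    by (simp add: ptrace_def cnj_sum sum_distrib_left[symmetric] sum_distrib_right[symmetric] mult_ac)
      (simp add: sum_distrib_left sum_distrib_right mult_ac)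
  also have "\<dots> = (\<Sum>i\<in>X. \<Sum>a<k. \<Sum>j\<in>X. v (i, a) * cnj (ptrace k Y i j) * cnj (v (j, a)))"
    by (intro sum.cong refl sum.swap)
  also have "\<dots> = (\<Sum>a<k. \<Sum>i\<in>X. \<Sum>j\<in>X. v (i, a) * cnj (ptrace k Y i j) * cnj (v (j, a)))"
    by (rule sum.swap)
  also have "\<dots> = cnj (sesq ?P (tensor_id (ptrace k Y)) v v)"
    unfolding sesq_tensor_id by (simp add: sesq_def cnj_sum)
  finally have 1: "(\<Sum>p\<in>?P. \<Sum>q\<in>?P. cnj (Y p q) * tensor_id (ptrace k (\<lambda>p q. v p * cnj (v q))) p q)
    = cnj (sesq ?P (tensor_id (ptrace k Y)) v v)" .
  have 2: "(\<Sum>p\<in>?P. \<Sum>q\<in>?P. cnj (Y p q) * (v p * cnj (v q))) = cnj (sesq ?P Y v v)"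
    unfolding sesq_def cnj_sum by (intro sum.cong refl) simp
  show ?thesis
    unfolding reduction_def right_diff_distrib sum_subtractf 1 2 by simp
qed

lemma herm_ptrace:
  assumes "herm_on (X \<times> {..<k}) Y"
  shows "herm_on X (ptrace k Y)"
  unfolding herm_on_def
proof (intro ballI)
  fix i j assume "i \<in> X" "j \<in> X"
  then have "Y (j, a) (i, a) = cnj (Y (i, a) (j, a))" if "a < k" for a
    using assms that unfolding herm_on_def by blast
  then show "ptrace k Y j i = cnj (ptrace k Y i j)"
    unfolding ptrace_def cnj_sum by (intro sum.cong) auto
qed

lemma pd_ptrace:
  fixes Y :: "'x \<times> nat \<Rightarrow> 'x \<times> nat \<Rightarrow> complex"
  assumes X: "finite X" and Y: "pd_on (X \<times> {..<k}) Y" and k: "k > 0"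
  shows "pd_on X (ptrace k Y)"
  unfolding pd_on_def
proof (intro conjI allI impI)
  show "herm_on X (ptrace k Y)" using Y by (intro herm_ptrace) (simp add: pd_on_def)
  fix v :: "'x \<Rightarrow> complex" assume "\<exists>i\<in>X. v i \<noteq> 0"
  then obtain i where i: "i \<in> X" "v i \<noteq> 0" by blast
  have "0 < Re (sesq (X \<times> {..<k}) Y (tensor_unit v a) (tensor_unit v a))" if "a < k" for a
  proof -
    have "tensor_unit v a (i, a) \<noteq> 0" using i by (simp add: tensor_unit_def delta_def)
    then show ?thesis using i that by (intro pd_pos[OF Y, of "(i, a)"]) auto
  qed
  then have "0 < (\<Sum>a<k. Re (sesq (X \<times> {..<k}) Y (tensor_unit v a) (tensor_unit v a)))"
    using k by (intro sum_pos) auto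
  then show "0 < Re (sesq X (ptrace k Y) v v)"
    by (simp add: sum_sesq_tensor_unit[OF X, symmetric])
qed

lemma herm_tensor_id:
  assumes "herm_on X G"
  shows "herm_on (X \<times> {..<k}) (tensor_id G)"
  unfolding herm_on_def
proof (intro ballI)
  fix p q assume "p \<in> X \<times> {..<k}" "q \<in> X \<times> {..<k}"
  then have G: "G (fst q) (fst p) = cnj (G (fst p) (fst q))"
    using assms unfolding herm_on_def by auto
  have "delta (snd q) (snd p) = delta (snd p) (snd q)" by (auto simp: delta_def)
  then show "tensor_id G q p = cnj (tensor_id G p q)"
    unfolding tensor_id_def by (subst G) simp
qed

lemma pd_tensor_id:
  fixes G :: "'x \<Rightarrow> 'x \<Rightarrow> complex"
  assumes "pd_on X G"
  shows "pd_on (X \<times> {..<k}) (tensor_id G)"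
  unfolding pd_on_def
proof (intro conjI allI impI)
  show "herm_on (X \<times> {..<k}) (tensor_id G)" using assms by (intro herm_tensor_id) (simp add: pd_on_def)
  fix v :: "'x \<times> nat \<Rightarrow> complex" assume "\<exists>p\<in>X \<times> {..<k}. v p \<noteq> 0"
  then obtain i a where ia: "i \<in> X" "a < k" "v (i, a) \<noteq> 0" by auto
  have "0 \<le> Re (sesq X G (\<lambda>i. v (i, a)) (\<lambda>i. v (i, a)))" for a
    using pd_imp_psd[OF assms] by (simp add: psd_on_def)
  moreover have "0 < Re (sesq X G (\<lambda>i. v (i, a)) (\<lambda>i. v (i, a)))"
    using ia by (intro pd_pos[OF assms, of i]) auto
  ultimately show "0 < Re (sesq (X \<times> {..<k}) (tensor_id G) v v)"
    unfolding sesq_tensor_id Re_sum using ia by (intro sum_pos2[of _ a]) auto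
qed

text \<open>If \<open>Y\<close> exceeded \<open>Tr\<^sub>B Y \<otimes> I\<close> strictly on an \<open>m\<close>-dimensional space, then after the congruence
  that makes \<open>Tr\<^sub>B Y\<close> the identity of \<open>M\<^sub>m\<close> the trace of \<open>Y\<close> would exceed \<open>m\<close>.\<close>

lemma reduction_inertia:
  fixes m k :: nat
  assumes Y: "pd_on ({..<m} \<times> {..<k}) Y" and "m > 0" "k > 0"
    and C: "independent_on ({..<m} \<times> {..<k}) {..<m} C"
  obtains x where "\<exists>j<m. x j \<noteq> 0" "\<And>j. j \<ge> m \<Longrightarrow> x j = 0"
    and "Re (sesq ({..<m} \<times> {..<k}) Y (\<lambda>p. \<Sum>j<m. x j * C j p) (\<lambda>p. \<Sum>j<m. x j * C j p))
      \<le> Re (sesq ({..<m} \<times> {..<k}) (tensor_id (ptrace k Y)) (\<lambda>p. \<Sum>j<m. x j * C j p) (\<lambda>p. \<Sum>j<m. x j * C j p))"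
proof (rule ccontr)
  assume contra: "\<not> thesis"
  note claim = that
  let ?P = "{..<m} \<times> {..<k}"
  let ?G = "ptrace k Y"
  let ?Q = "tensor_id ?G"
  have G: "pd_on {..<m} ?G" using Y \<open>k > 0\<close> by (intro pd_ptrace) auto
  have Q: "pd_on ?P ?Q" using G by (rule pd_tensor_id)
  have "independent_on {..<m} {..<m} delta"
    by (auto simp: independent_on_def)
  from orthonormal_family_in_span[OF _ _ _ this G, of "{}" m]
  obtain y where y: "\<And>s t. s < m \<Longrightarrow> t < m \<Longrightarrow>
       sesq {..<m} ?G (\<lambda>p. \<Sum>j<m. y s j * delta j p) (\<lambda>p. \<Sum>j<m. y t j * delta j p) = delta s t"
    by (auto simp del: sum_delta)
  \<comment> \<open>A Gram-Schmidt basis for the form \<open>?G\<close>; up to a unitary these are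
    the columns of its inverse square root, so the congruence needs no functional calculus.\<close>
  define b where "b s = (\<lambda>p. \<Sum>j<m. y s j * delta j p)" for s
  have b: "sesq {..<m} ?G (b s) (b t) = delta s t" if "s < m" "t < m" for s t
    using y[OF that] by (simp only: b_def)
  \<comment> \<open>Products of the \<open>b s\<close> with unit vectors: orthonormal for
    \<open>?Q\<close> and indexed by all of \<open>?P\<close>, hence a basis in which
    \<open>?Q\<close> becomes the identity and \<open>Y\<close> becomes \<open>Y'\<close>.\<close>
  define B where "B p = tensor_unit (b (fst p)) (snd p)" for p
  have BQ: "sesq ?P ?Q (B p) (B q) = delta p q" if "p \<in> ?P" "q \<in> ?P" for p q
    unfolding B_def using that by (subst sesq_tensor_id_unit) (auto simp: b delta_def prod_eq_iff)
  from orthonormal_family_in_span[OF _ _ _ C Q, of "{}" m]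
  obtain x where x: "\<And>s t. s < m \<Longrightarrow> t < m \<Longrightarrow>
       sesq ?P ?Q (\<lambda>p. \<Sum>j<m. x s j * C j p) (\<lambda>p. \<Sum>j<m. x t j * C j p) = delta s t"
    by auto
  define V where "V t = (\<lambda>p. \<Sum>j<m. x t j * C j p)" for t
  have V: "sesq ?P ?Q (V s) (V t) = delta s t" if "s < m" "t < m" for s t
    using x[OF that] by (simp only: V_def)
  define W where "W t p = sesq ?P ?Q (B p) (V t)" for t p
  have VW: "V t p = (\<Sum>q\<in>?P. W t q * B q p)" if "p \<in> ?P" for t p
    unfolding W_def by (rule orthonormal_expansion[OF _ BQ that]) auto
  define Y' where "Y' p q = sesq ?P Y (B p) (B q)" for p q
  have sY: "sesq ?P Y (V s) (V t) = sesq ?P Y' (W s) (W t)" for s t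
    unfolding Y'_def by (subst sesq_expansion[symmetric]) (intro sesq_cong VW refl)
  have "sesq ?P ?Q (V s) (V t) = sesq ?P (\<lambda>p q. sesq ?P ?Q (B p) (B q)) (W s) (W t)" for s t
    by (subst sesq_expansion[symmetric]) (intro sesq_cong VW refl)
  also have "\<dots> s t = sesq ?P delta (W s) (W t)" for s t
    by (intro sesq_cong BQ refl)
  finally have W: "(\<Sum>p\<in>?P. cnj (W s p) * W t p) = delta s t" if "s < m" "t < m" for s t
    using V[OF that] by (simp add: sesq_delta)
  have "psd_on ?P Y'" unfolding Y'_def by (intro psd_congruence pd_imp_psd Y)
  from sum_orthonormal_le_trace[OF _ this W]
  have "(\<Sum>t<m. Re (sesq ?P Y' (W t) (W t))) \<le> (\<Sum>p\<in>?P. Re (Y' p p))" by simp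
  also have "\<dots> = Re (\<Sum>s<m. \<Sum>a<k. sesq ?P Y (tensor_unit (b s) a) (tensor_unit (b s) a))"
    by (simp add: sum_pairs Y'_def B_def)
  \<comment> \<open>For fixed \<open>s\<close> the diagonal entries of \<open>Y'\<close> add up to
    the value of the partial trace at \<open>b s\<close>, which is 1. So the total trace is
    \<open>m\<close>.\<close>
  also have "\<dots> = (\<Sum>s<m. 1)"
    by (subst Re_sum, intro sum.cong refl) (simp add: sum_sesq_tensor_unit b delta_def del: Re_sum)
  finally have le: "(\<Sum>t<m. Re (sesq ?P Y (V t) (V t))) \<le> real m" by (simp add: sY)
  have gt: "1 < Re (sesq ?P Y (V t) (V t))" if t: "t < m" for t
  proof -
    \<comment> \<open>The coefficients are cut off outside the range of \<open>m\<close>, since the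
      negated conclusion speaks only of coefficient functions vanishing there.\<close>
    define z where "z j = (if j < m then x t j else 0)" for j
    have Vz: "V t = (\<lambda>p. \<Sum>j<m. z j * C j p)" by (simp add: V_def z_def)
    have "\<exists>j<m. z j \<noteq> 0"
    proof (rule ccontr)
      assume "\<not> ?thesis"
      then have "V t = (\<lambda>p. 0)" unfolding Vz by simp
      then have "sesq ?P ?Q (V t) (V t) = 0" by (simp add: sesq_def)
      with V[OF t t] show False by (simp add: delta_def)
    qed
    moreover have "z j = 0" if "j \<ge> m" for j using that by (simp add: z_def)
    ultimately have "\<not> Re (sesq ?P Y (V t) (V t)) \<le> Re (sesq ?P ?Q (V t) (V t))"
      using contra claim[of z] unfolding Vz by blast
    then show ?thesis by (simp add: V[OF t t] delta_def)
  qed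
  have "(\<Sum>t<m. 1) < (\<Sum>t<m. Re (sesq ?P Y (V t) (V t)))"
    using gt \<open>m > 0\<close> by (intro sum_strict_mono) auto
  with le show False by simp
qed

text \<open>The operator with coefficient matrix \<open>\<sigma>\<close> in the family
  \<open>C\<close>, that is, the sum of \<open>\<sigma> i j\<close> times the outer product of
  \<open>C i\<close> with \<open>C j\<close>. Its range lies in the span of the family.\<close>

definition compress :: "nat \<Rightarrow> (nat \<Rightarrow> 'a \<Rightarrow> complex) \<Rightarrow> (nat \<Rightarrow> nat \<Rightarrow> complex) \<Rightarrow> 'a \<Rightarrow> 'a \<Rightarrow> complex" where
  "compress m C \<sigma> p q = sesq {..<m} \<sigma> (\<lambda>i. cnj (C i p)) (\<lambda>j. cnj (C j q))"

lemma psd_compress: "psd_on {..<m} \<sigma> \<Longrightarrow> psd_on P (compress m C \<sigma>)"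
  unfolding compress_def by (rule psd_congruence)

lemma sum_compress_diag:
  assumes on: "\<And>s t. s < m \<Longrightarrow> t < m \<Longrightarrow> (\<Sum>p\<in>P. cnj (C s p) * C t p) = delta s t"
  shows "(\<Sum>p\<in>P. compress m C \<sigma> p p) = (\<Sum>s<m. \<sigma> s s)"
proof -
  have "(\<Sum>p\<in>P. compress m C \<sigma> p p) = (\<Sum>i<m. \<Sum>p\<in>P. \<Sum>j<m. cnj (cnj (C i p)) * \<sigma> i j * cnj (C j p))"
    unfolding compress_def sesq_def by (rule sum.swap)
  also have "\<dots> = (\<Sum>i<m. \<Sum>j<m. \<Sum>p\<in>P. cnj (cnj (C i p)) * \<sigma> i j * cnj (C j p))"
    by (intro sum.cong refl sum.swap)
  also have "\<dots> = (\<Sum>i<m. \<Sum>j<m. (\<Sum>p\<in>P. cnj (C j p) * C i p) * \<sigma> i j)"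
    unfolding sum_distrib_right by (intro sum.cong refl) simp
  also have "\<dots> = (\<Sum>i<m. \<Sum>j<m. delta j i * \<sigma> i j)"
    using on by (intro sum.cong refl) simp
  also have "\<dots> = (\<Sum>i<m. \<sigma> i i)"
    by (intro sum.cong refl) simp
  finally show ?thesis .
qed

text \<open>The factor \<open>k - 1\<close> is the trace scaling of the reduction map; with
  \<open>sum_compress_diag\<close> it gives the condition \<open>trace0\<close> of
  \<open>psd_alternative\<close>.\<close>

lemma sum_reduction_diag:
  "(\<Sum>p\<in>X \<times> {..<k}. reduction k \<tau> p p) = (of_nat k - 1) * (\<Sum>p\<in>X \<times> {..<k}. \<tau> p p)"
proof -
  have "(\<Sum>p\<in>X \<times> {..<k}. reduction k \<tau> p p) = (\<Sum>i\<in>X. \<Sum>a<k. ptrace k \<tau> i i) - (\<Sum>i\<in>X. \<Sum>a<k. \<tau> (i, a) (i, a))"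
    by (simp add: sum_pairs reduction_def tensor_id_def delta_def sum_subtractf)
  also have "(\<Sum>i\<in>X. \<Sum>a<k. ptrace k \<tau> i i) = of_nat k * (\<Sum>i\<in>X. \<Sum>a<k. \<tau> (i, a) (i, a))"
    by (simp add: ptrace_def sum_distrib_left)
  finally show ?thesis by (simp add: sum_pairs left_diff_distrib)
qed

lemma orthonormal_imp_independent:
  fixes m :: nat
  assumes on: "\<And>s t. s < m \<Longrightarrow> t < m \<Longrightarrow> (\<Sum>p\<in>P. cnj (C s p) * C t p) = delta s t"
  shows "independent_on P {..<m} C"
  unfolding independent_on_def
proof (intro allI impI ballI)
  fix x s assume x: "\<forall>p\<in>P. (\<Sum>j<m. x j * C j p) = 0" and "s \<in> {..<m}"
  then have s: "s < m" by simp
  have "0 = (\<Sum>p\<in>P. cnj (C s p) * (\<Sum>j<m. x j * C j p))" using x by simp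
  also have "\<dots> = (\<Sum>j<m. (\<Sum>p\<in>P. cnj (C s p) * C j p) * x j)"
    unfolding sum_distrib_left sum_distrib_right by (subst sum.swap) (simp add: mult_ac)
  also have "\<dots> = (\<Sum>j<m. delta s j * x j)" using on s by (intro sum.cong refl) simp
  also have "\<dots> = x s" using s by simp
  finally show "x s = 0" by simp
qed

lemma herm_diff: "herm_on I Q \<Longrightarrow> herm_on I Q' \<Longrightarrow> herm_on I (\<lambda>p q. Q p q - Q' p q)"
  unfolding herm_on_def complex_cnj_diff by metis

text \<open>The number of vectors \<open>C t\<close> equals the dimension \<open>m\<close> of the
  first factor. This equality is what makes \<open>reduction_inertia\<close> contradict the form
  \<open>Y\<close> that \<open>psd_alternative\<close> would otherwise provide.\<close>

lemma reduction_state: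
  assumes m: "m > 0" and k: "k > 0"
    and on: "\<And>s t. s < m \<Longrightarrow> t < m \<Longrightarrow> (\<Sum>p\<in>{..<m} \<times> {..<k}. cnj (C s p) * C t p) = delta s t"
  obtains \<sigma> where "psd_on {..<m} \<sigma>" "0 < (\<Sum>s<m. Re (\<sigma> s s))"
    "psd_on ({..<m} \<times> {..<k}) (reduction k (compress m C \<sigma>))"
proof (rule ccontr)
  assume contra: "\<not> thesis"
  note claim = that
  let ?P = "{..<m} \<times> {..<k}"
  let ?L = "\<lambda>\<sigma>. reduction k (compress m C \<sigma>)"
  have lin: "?L (\<lambda>i j. a * \<sigma> i j + b * \<sigma>' i j) p q = a * ?L \<sigma> p q + b * ?L \<sigma>' p q" for a b \<sigma> \<sigma>' p q
    by (simp add: reduction_def tensor_id_def ptrace_def compress_def sesq_lincomb_form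
        sum.distrib sum_distrib_left algebra_simps)
  have cont: "continuous_on UNIV (\<lambda>\<sigma>. ?L \<sigma> p q)" for p q
    unfolding reduction_def tensor_id_def ptrace_def compress_def sesq_def
    by (intro continuous_intros continuous_on_matrix_entry)
  have herm: "herm_on ?P (?L \<sigma>)" if "psd_on {..<m} \<sigma>" for \<sigma>
  proof -
    have "herm_on ?P (compress m C \<sigma>)" using psd_compress[OF that, of ?P C] by (simp add: psd_on_def)
    then show ?thesis unfolding reduction_def by (intro herm_diff herm_tensor_id herm_ptrace)
  qed
  have nonpsd: "(\<Sum>s<m. Re (\<sigma> s s)) = 0" if "psd_on {..<m} \<sigma>" "psd_on ?P (?L \<sigma>)" for \<sigma>
  proof -
    have "\<not> 0 < (\<Sum>s<m. Re (\<sigma> s s))" using contra claim[OF that(1) _ that(2)] by blast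
    moreover have "0 \<le> (\<Sum>s<m. Re (\<sigma> s s))" using that(1) by (intro sum_nonneg psd_diag_nonneg) auto
    ultimately show ?thesis by simp
  qed
  have trace0: "(\<Sum>p\<in>?P. Re (?L \<sigma> p p)) = 0" if "(\<Sum>s<m. Re (\<sigma> s s)) = 0" for \<sigma>
  proof -
    have "(\<Sum>p\<in>?P. ?L \<sigma> p p) = of_real (real k - 1) * (\<Sum>s<m. \<sigma> s s)"
      unfolding sum_reduction_diag by (subst sum_compress_diag[OF on]) simp_all
    then have "Re (\<Sum>p\<in>?P. ?L \<sigma> p p) = (real k - 1) * Re (\<Sum>s<m. \<sigma> s s)"
      by (simp only: times_complex.sel Re_complex_of_real Im_complex_of_real)
    then show ?thesis using that by simp
  qed
  have "\<exists>Y. pd_on ?P Y \<and> (\<forall>x. (\<exists>i\<in>{..<m}. x i \<noteq> 0) \<longrightarrow> (\<forall>i. i \<notin> {..<m} \<longrightarrow> x i = 0) \<longrightarrow>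
      Re (\<Sum>p\<in>?P. \<Sum>q\<in>?P. cnj (Y p q) * ?L (\<lambda>i j. x i * cnj (x j)) p q) < 0)"
  proof (rule psd_alternative[of "{..<m}" ?P ?L])
    show "finite {..<m}" "finite ?P" "{..<m} \<noteq> {}" using m by auto
    show "?L (\<lambda>i j. a * \<sigma> i j + b * \<sigma>' i j) p q = a * ?L \<sigma> p q + b * ?L \<sigma>' p q" for a b \<sigma> \<sigma>' p q
      by (rule lin)
    show "continuous_on UNIV (\<lambda>\<sigma>. ?L \<sigma> p q)" for p q by (rule cont)
    show "herm_on ?P (?L \<sigma>)" if "psd_on {..<m} \<sigma>" for \<sigma> using that by (rule herm)
    show "(\<Sum>s<m. Re (\<sigma> s s)) = 0" if "psd_on {..<m} \<sigma>" "psd_on ?P (?L \<sigma>)" for \<sigma>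
      using that by (rule nonpsd)
    show "(\<Sum>p\<in>?P. Re (?L \<sigma> p p)) = 0" if "(\<Sum>s<m. Re (\<sigma> s s)) = 0" for \<sigma>
      using that by (rule trace0)
  qed blast
  then obtain Y where Y: "pd_on ?P Y"
    and neg: "\<And>x. \<exists>i\<in>{..<m}. x i \<noteq> 0 \<Longrightarrow> \<forall>i. i \<notin> {..<m} \<longrightarrow> x i = 0 \<Longrightarrow>
      Re (\<Sum>p\<in>?P. \<Sum>q\<in>?P. cnj (Y p q) * ?L (\<lambda>i j. x i * cnj (x j)) p q) < 0"
    by blast
  obtain x where x: "\<exists>j<m. x j \<noteq> 0" "\<And>j. j \<ge> m \<Longrightarrow> x j = 0"
    and le: "Re (sesq ?P Y (\<lambda>p. \<Sum>j<m. x j * C j p) (\<lambda>p. \<Sum>j<m. x j * C j p))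
      \<le> Re (sesq ?P (tensor_id (ptrace k Y)) (\<lambda>p. \<Sum>j<m. x j * C j p) (\<lambda>p. \<Sum>j<m. x j * C j p))"
    using reduction_inertia[OF Y m k orthonormal_imp_independent[OF on]] by blast
  define V where "V = (\<lambda>p. \<Sum>j<m. x j * C j p)"
  \<comment> \<open>A rank-one coefficient matrix becomes the rank-one form of a vector in the span
    of \<open>C\<close>, so the dual inequality can be evaluated by
    \<open>reduction_rank_one_dual\<close>.\<close>
  have "compress m C (\<lambda>i j. x i * cnj (x j)) = (\<lambda>p q. V p * cnj (V q))"
    unfolding compress_def sesq_def V_def cnj_sum sum_product
    by (intro ext sum.cong refl) simp
  then have "Re (\<Sum>p\<in>?P. \<Sum>q\<in>?P. cnj (Y p q) * reduction k (\<lambda>p q. V p * cnj (V q)) p q) < 0"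
    using neg[of x] x by auto
  then show False using le unfolding reduction_rank_one_dual V_def[symmetric] by simp
qed

text \<open>The map \<open>X \<mapsto> Tr(X) I - X\<^sup>T\<close> is completely positive: its form is a sum of squares.\<close>

lemma partial_transpose_reduction_nonneg:
  assumes X: "finite X" and \<tau>: "psd_on (X \<times> {..<k}) \<tau>"
  shows "0 \<le> Re (sesq (X \<times> {..<k}) (tensor_id (ptrace k \<tau>)) \<eta> \<eta>
    - sesq (X \<times> {..<k}) (\<lambda>p q. \<tau> (fst p, snd q) (fst q, snd p)) \<eta> \<eta>)"
proof -
  let ?P = "X \<times> {..<k}"
  \<comment> \<open>The slice of \<open>\<eta>\<close> at \<open>a\<close>, tensored with the unit
    vector at \<open>b\<close>. The values of \<open>\<tau>\<close> at the antisymmetrised vectors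
    \<open>u a b - u b a\<close> add up to twice the form in question: the diagonal terms give the
    trace part, the mixed terms the transposed part.\<close>
  define u where "u a b = tensor_unit (\<lambda>i. \<eta> (i, a)) b" for a b
  define S where "S a b = sesq ?P \<tau> (u a b) (u a b)" for a b
  define T where "T a b = sesq ?P \<tau> (u a b) (u b a)" for a b
  have "(\<Sum>a<k. \<Sum>b<k. sesq ?P \<tau> (\<lambda>p. u a b p - u b a p) (\<lambda>p. u a b p - u b a p))
    = (\<Sum>a<k. \<Sum>b<k. S a b) - (\<Sum>a<k. \<Sum>b<k. T a b) - (\<Sum>a<k. \<Sum>b<k. T b a) + (\<Sum>a<k. \<Sum>b<k. S b a)"
    unfolding sesq_diff_left sesq_diff_right S_def T_def sum.distrib[symmetric] sum_subtractf[symmetric]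
    by (intro sum.cong refl) simp
  also have "(\<Sum>a<k. \<Sum>b<k. T b a) = (\<Sum>a<k. \<Sum>b<k. T a b)" by (rule sum.swap)
  also have "(\<Sum>a<k. \<Sum>b<k. S b a) = (\<Sum>a<k. \<Sum>b<k. S a b)" by (rule sum.swap)
  also have "(\<Sum>a<k. \<Sum>b<k. S a b) = sesq ?P (tensor_id (ptrace k \<tau>)) \<eta> \<eta>"
    unfolding S_def u_def sesq_tensor_id by (simp add: sum_sesq_tensor_unit[OF X])
  also have "(\<Sum>a<k. \<Sum>b<k. T a b) = sesq ?P (\<lambda>p q. \<tau> (fst p, snd q) (fst q, snd p)) \<eta> \<eta>"
  proof -
    have "(\<Sum>a<k. \<Sum>b<k. T a b) = (\<Sum>a<k. \<Sum>b<k. \<Sum>i\<in>X. \<Sum>j\<in>X. cnj (\<eta> (i, a)) * \<tau> (i, b) (j, a) * \<eta> (j, b))"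
      unfolding T_def u_def by (intro sum.cong refl) (simp add: sesq_tensor_unit[OF X])
    also have "\<dots> = (\<Sum>a<k. \<Sum>i\<in>X. \<Sum>b<k. \<Sum>j\<in>X. cnj (\<eta> (i, a)) * \<tau> (i, b) (j, a) * \<eta> (j, b))"
      by (intro sum.cong refl sum.swap)
    also have "\<dots> = (\<Sum>i\<in>X. \<Sum>a<k. \<Sum>b<k. \<Sum>j\<in>X. cnj (\<eta> (i, a)) * \<tau> (i, b) (j, a) * \<eta> (j, b))"
      by (rule sum.swap)
    also have "\<dots> = (\<Sum>i\<in>X. \<Sum>a<k. \<Sum>j\<in>X. \<Sum>b<k. cnj (\<eta> (i, a)) * \<tau> (i, b) (j, a) * \<eta> (j, b))"
      by (intro sum.cong refl sum.swap)
    finally show ?thesis by (simp only: sesq_pairs fst_conv snd_conv)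
  qed
  finally have eq: "(\<Sum>a<k. \<Sum>b<k. sesq ?P \<tau> (\<lambda>p. u a b p - u b a p) (\<lambda>p. u a b p - u b a p))
    = 2 * (sesq ?P (tensor_id (ptrace k \<tau>)) \<eta> \<eta> - sesq ?P (\<lambda>p q. \<tau> (fst p, snd q) (fst q, snd p)) \<eta> \<eta>)"
    by simp
  have "0 \<le> Re (\<Sum>a<k. \<Sum>b<k. sesq ?P \<tau> (\<lambda>p. u a b p - u b a p) (\<lambda>p. u a b p - u b a p))"
    using \<tau> by (simp add: psd_on_def sum_nonneg)
  then show ?thesis unfolding eq by simp
qed

section \<open>Isotropic orthonormal systems for a skew-symmetric matrix\<close>

lemma unit_vector_in_kernel:
  fixes a :: "'e \<Rightarrow> nat \<Rightarrow> complex"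
  assumes "finite E" "card E < n"
  obtains z where "(\<Sum>x<n. cnj (z x) * z x) = 1" "\<And>e. e \<in> E \<Longrightarrow> (\<Sum>x<n. a e x * z x) = 0"
proof -
  have ind: "independent_on {..<n} {..<n} delta" by (auto simp: independent_on_def)
  have "finite {..<n}" by simp
  have card: "card E + 1 \<le> card {..<n}" using assms by simp
  obtain y :: "nat \<Rightarrow> nat \<Rightarrow> complex" where y: "\<And>s t. s < 1 \<Longrightarrow> t < 1 \<Longrightarrow>
       sesq {..<n} delta (\<lambda>p. \<Sum>j<n. y s j * delta j p) (\<lambda>p. \<Sum>j<n. y t j * delta j p) = delta s t"
    "\<And>t e. t < 1 \<Longrightarrow> e \<in> E \<Longrightarrow> (\<Sum>p<n. a e p * (\<Sum>j<n. y t j * delta j p)) = 0"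
    using orthonormal_family_in_span[where r = 1 and a = a, OF \<open>finite {..<n}\<close> \<open>finite {..<n}\<close> \<open>finite E\<close>
        ind pd_delta[OF \<open>finite {..<n}\<close>] card] by blast
  show ?thesis
    using y(1)[of 0 0] y(2)[of 0] by (intro that[of "\<lambda>p. \<Sum>j<n. y 0 j * delta j p"])
      (simp_all add: sesq_delta delta_def del: sum_delta)
qed

text \<open>The antilinear map \<open>f \<mapsto> U (cnj f)\<close>. It governs the transposed term
  of the Breuer--Hall map, which carries the projection onto a unit vector \<open>f\<close> to the
  projection onto its image when \<open>U\<close> is unitary.\<close>

definition skew_image :: "nat \<Rightarrow> (nat \<Rightarrow> nat \<Rightarrow> complex) \<Rightarrow> (nat \<Rightarrow> complex) \<Rightarrow> nat \<Rightarrow> complex" where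
  "skew_image n U f x = (\<Sum>y<n. U x y * cnj (f y))"

text \<open>The inner product of \<open>u\<close> with the image of \<open>v\<close> is bilinear in
  the conjugates of \<open>u\<close> and \<open>v\<close>, with matrix \<open>U\<close>, so skewness
  makes it antisymmetric. In particular each vector is orthogonal to its own image.\<close>

lemma skew_image_swap:
  assumes "\<And>x y. x < n \<Longrightarrow> y < n \<Longrightarrow> U y x = - U x y"
  shows "(\<Sum>x<n. cnj (u x) * skew_image n U v x) = - (\<Sum>x<n. cnj (v x) * skew_image n U u x)"
proof -
  have "(\<Sum>x<n. cnj (u x) * skew_image n U v x) = (\<Sum>y<n. \<Sum>x<n. cnj (u x) * (U x y * cnj (v y)))"
    unfolding skew_image_def sum_distrib_left by (rule sum.swap)
  also have "\<dots> = (\<Sum>y<n. \<Sum>x<n. - (cnj (v y) * (U y x * cnj (u x))))"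
  proof (intro sum.cong refl)
    fix y x assume "y \<in> {..<n}" "x \<in> {..<n}"
    then have "U y x = - U x y" by (intro assms) auto
    then show "cnj (u x) * (U x y * cnj (v y)) = - (cnj (v y) * (U y x * cnj (u x)))" by simp
  qed
  finally show ?thesis by (simp add: skew_image_def sum_distrib_left sum_negf)
qed

text \<open>Greedy choice: each new unit vector \<open>z\<close> is taken orthogonal to all earlier
  vectors and their images, fewer than \<open>n\<close> conditions in total. Antisymmetry then makes
  the earlier vectors orthogonal to the image of \<open>z\<close>, and \<open>z\<close> is
  orthogonal to its own image.\<close>

lemma lagrangian_basis:
  fixes U :: "nat \<Rightarrow> nat \<Rightarrow> complex"
  assumes skew: "\<And>x y. x < n \<Longrightarrow> y < n \<Longrightarrow> U y x = - U x y" and n: "2 * k \<le> n"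
  obtains f where "\<And>a b. a < k \<Longrightarrow> b < k \<Longrightarrow> (\<Sum>x<n. cnj (f a x) * f b x) = delta a b"
    "\<And>a b. a < k \<Longrightarrow> b < k \<Longrightarrow> (\<Sum>x<n. cnj (f a x) * skew_image n U (f b) x) = 0"
proof -
  let ?ip = "\<lambda>u v. \<Sum>x<n. cnj (u x) * v x"
  have "\<exists>f. (\<forall>a<k. \<forall>b<k. ?ip (f a) (f b) = delta a b) \<and>
      (\<forall>a<k. \<forall>b<k. ?ip (f a) (skew_image n U (f b)) = 0)"
    using n
  proof (induction k)
    case 0
    then show ?case by simp
  next
    case (Suc k)
    then obtain f where f: "\<And>a b. a < k \<Longrightarrow> b < k \<Longrightarrow> ?ip (f a) (f b) = delta a b"
      "\<And>a b. a < k \<Longrightarrow> b < k \<Longrightarrow> ?ip (f a) (skew_image n U (f b)) = 0" by fastforce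
    define c where "c e = (case e of Inl a \<Rightarrow> (\<lambda>x. cnj (f a x)) | Inr a \<Rightarrow> (\<lambda>x. cnj (skew_image n U (f a) x)))" for e
    have "card ({..<k} <+> {..<k}) < n" using Suc.prems by (simp add: card_Plus)
    then obtain z where z: "?ip z z = 1" "\<And>e. e \<in> {..<k} <+> {..<k} \<Longrightarrow> (\<Sum>x<n. c e x * z x) = 0"
      using unit_vector_in_kernel[of "{..<k} <+> {..<k}" n c] by auto
    have fz: "?ip (f a) z = 0" "?ip (skew_image n U (f a)) z = 0" if "a < k" for a
      using z(2)[OF InlI, of a] z(2)[OF InrI, of a] that by (simp_all add: c_def)
    have conj: "?ip v u = cnj (?ip u v)" for u v by (simp add: cnj_sum mult.commute)
    have zf: "?ip z (f a) = 0" "?ip z (skew_image n U (f a)) = 0" if "a < k" for a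
      by (subst conj, simp only: fz[OF that] complex_cnj_zero)+
    have fgz: "?ip (f a) (skew_image n U z) = 0" if "a < k" for a
      using skew_image_swap[where u = "f a" and v = z and U = U and n = n, OF skew] zf(2)[OF that] by simp
    have zgz: "?ip z (skew_image n U z) = 0"
      using skew_image_swap[where u = z and v = z and U = U and n = n, OF skew] by simp
    define f' where "f' = f(k := z)"
    have f': "f' k = z" "a < k \<Longrightarrow> f' a = f a" for a by (auto simp: f'_def)
    have "?ip (f' a) (f' b) = delta a b \<and> ?ip (f' a) (skew_image n U (f' b)) = 0"
      if ab: "a < Suc k" "b < Suc k" for a b
    proof -
      consider "a < k" "b < k" | "a = k" "b < k" | "a < k" "b = k" | "a = k" "b = k"
        using ab by (auto simp: less_Suc_eq)
      then show ?thesis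
      proof cases
        case 1 then show ?thesis using f by (simp add: f'(2))
      next
        case 2 then show ?thesis using zf by (simp add: f' delta_def)
      next
        case 3 then show ?thesis using fz fgz by (simp add: f' delta_def)
      next
        case 4 then show ?thesis using z(1) zgz by (simp add: f' delta_def)
      qed
    qed
    then show ?case by blast
  qed
  then show ?thesis using that by blast
qed

section \<open>The Breuer--Hall map on forms\<close>

lemma sesq_diff_form: "sesq I (\<lambda>p q. Q p q - Q' p q) u v = sesq I Q u v - sesq I Q' u v"
  by (simp add: sesq_def algebra_simps sum_subtractf)

lemma sum_lessThan_add: "(\<Sum>s<k + l. F s) = (\<Sum>s<k. F s) + (\<Sum>a<l. F (k + a))"
  for F :: "nat \<Rightarrow> 'b :: comm_monoid_add"
  by (induction l) (simp_all add: add.assoc)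

lemma orthonormal_completeness:
  fixes h :: "nat \<Rightarrow> nat \<Rightarrow> complex"
  assumes on: "\<And>s t. s < n \<Longrightarrow> t < n \<Longrightarrow> (\<Sum>x<n. cnj (h s x) * h t x) = delta s t" and "x < n"
  shows "v x = (\<Sum>s<n. (\<Sum>y<n. cnj (h s y) * v y) * h s x)"
  using orthonormal_expansion[of "{..<n}" delta h x v] on \<open>x < n\<close> by (simp add: sesq_delta)

text \<open>The form \<open>tensor_id G\<close> is invariant under a unitary change of basis in the
  second factor. This allows the trace term to be evaluated in the adapted basis.\<close>

lemma sum_sesq_unitary:
  fixes h :: "nat \<Rightarrow> nat \<Rightarrow> complex"
  assumes on: "\<And>s t. s < n \<Longrightarrow> t < n \<Longrightarrow> (\<Sum>x<n. cnj (h s x) * h t x) = delta s t"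
  shows "(\<Sum>x<n. sesq X G (\<lambda>i. z (i, x)) (\<lambda>i. z (i, x)))
    = (\<Sum>s<n. sesq X G (\<lambda>i. \<Sum>x<n. cnj (h s x) * z (i, x)) (\<lambda>i. \<Sum>x<n. cnj (h s x) * z (i, x)))"
proof -
  define Z where "Z s i = (\<Sum>x<n. cnj (h s x) * z (i, x))" for s i
  have "(\<Sum>x<n. sesq X G (\<lambda>i. z (i, x)) (\<lambda>i. z (i, x)))
    = (\<Sum>x<n. sesq X G (\<lambda>i. z (i, x)) (\<lambda>i. \<Sum>s<n. h s x * Z s i))"
  proof (intro sum.cong sesq_cong refl)
    fix x i assume "x \<in> {..<n}"
    then show "z (i, x) = (\<Sum>s<n. h s x * Z s i)"
      using orthonormal_completeness[OF on, of x "\<lambda>x. z (i, x)"] by (simp add: Z_def mult.commute)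
  qed
  also have "\<dots> = (\<Sum>s<n. \<Sum>x<n. h s x * sesq X G (\<lambda>i. z (i, x)) (Z s))"
    unfolding sesq_sum_right sesq_scale_right by (rule sum.swap)
  also have "\<dots> = (\<Sum>s<n. sesq X G (Z s) (Z s))"
    unfolding Z_def[abs_def] sesq_sum_left sesq_scale_left by simp
  finally show ?thesis by (simp only: Z_def[abs_def])
qed

text \<open>The hypothesis says that \<open>M\<close> is \<open>N\<close> conjugated by the identity
  tensored with the matrix whose columns are the \<open>F a\<close>. Its form at \<open>z\<close> is
  therefore that of \<open>N\<close> at the image of \<open>z\<close> under the adjoint.\<close>

lemma sesq_local_change:
  assumes M: "\<And>i j x y. i \<in> X \<Longrightarrow> j \<in> X \<Longrightarrow> x < n \<Longrightarrow> y < n \<Longrightarrow>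
    M (i, x) (j, y) = (\<Sum>a<k. \<Sum>b<k. F a x * N (i, a) (j, b) * cnj (F b y))"
  shows "sesq (X \<times> {..<n}) M z z = sesq (X \<times> {..<k}) N
    (\<lambda>p. \<Sum>x<n. cnj (F (snd p) x) * z (fst p, x)) (\<lambda>p. \<Sum>x<n. cnj (F (snd p) x) * z (fst p, x))"
proof -
  have "sesq (X \<times> {..<n}) M z z = (\<Sum>i\<in>X. \<Sum>x<n. \<Sum>j\<in>X. \<Sum>y<n. \<Sum>a<k. \<Sum>b<k.
      cnj (z (i, x)) * F a x * N (i, a) (j, b) * cnj (F b y) * z (j, y))"
    unfolding sesq_pairs
    by (intro sum.cong refl) (simp add: M sum_distrib_left sum_distrib_right mult.assoc)
  also have "\<dots> = (\<Sum>i\<in>X. \<Sum>j\<in>X. \<Sum>x<n. \<Sum>y<n. \<Sum>a<k. \<Sum>b<k.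
      cnj (z (i, x)) * F a x * N (i, a) (j, b) * cnj (F b y) * z (j, y))"
    by (intro sum.cong refl sum.swap)
  also have "\<dots> = (\<Sum>i\<in>X. \<Sum>j\<in>X. \<Sum>x<n. \<Sum>a<k. \<Sum>y<n. \<Sum>b<k.
      cnj (z (i, x)) * F a x * N (i, a) (j, b) * cnj (F b y) * z (j, y))"
    by (intro sum.cong refl sum.swap)
  also have "\<dots> = (\<Sum>i\<in>X. \<Sum>j\<in>X. \<Sum>a<k. \<Sum>x<n. \<Sum>y<n. \<Sum>b<k.
      cnj (z (i, x)) * F a x * N (i, a) (j, b) * cnj (F b y) * z (j, y))"
    by (intro sum.cong refl sum.swap)
  also have "\<dots> = (\<Sum>i\<in>X. \<Sum>j\<in>X. \<Sum>a<k. \<Sum>x<n. \<Sum>b<k. \<Sum>y<n.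
      cnj (z (i, x)) * F a x * N (i, a) (j, b) * cnj (F b y) * z (j, y))"
    by (intro sum.cong refl sum.swap)
  also have "\<dots> = (\<Sum>i\<in>X. \<Sum>j\<in>X. \<Sum>a<k. \<Sum>b<k. \<Sum>x<n. \<Sum>y<n.
      cnj (z (i, x)) * F a x * N (i, a) (j, b) * cnj (F b y) * z (j, y))"
    by (intro sum.cong refl sum.swap)
  also have "\<dots> = (\<Sum>i\<in>X. \<Sum>j\<in>X. \<Sum>a<k. \<Sum>b<k.
      cnj (\<Sum>x<n. cnj (F a x) * z (i, x)) * N (i, a) (j, b) * (\<Sum>y<n. cnj (F b y) * z (j, y)))"
  proof (intro sum.cong refl)
    fix i j a b
    have "(\<Sum>x<n. \<Sum>y<n. cnj (z (i, x)) * F a x * N (i, a) (j, b) * cnj (F b y) * z (j, y))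
      = N (i, a) (j, b) * (cnj (\<Sum>x<n. cnj (F a x) * z (i, x)) * (\<Sum>y<n. cnj (F b y) * z (j, y)))"
      unfolding cnj_sum sum_product unfolding sum_distrib_left by (intro sum.cong refl) simp
    then show "(\<Sum>x<n. \<Sum>y<n. cnj (z (i, x)) * F a x * N (i, a) (j, b) * cnj (F b y) * z (j, y))
      = cnj (\<Sum>x<n. cnj (F a x) * z (i, x)) * N (i, a) (j, b) * (\<Sum>y<n. cnj (F b y) * z (j, y))"
      by (simp only: mult_ac)
  qed
  also have "\<dots> = (\<Sum>i\<in>X. \<Sum>a<k. \<Sum>j\<in>X. \<Sum>b<k.
      cnj (\<Sum>x<n. cnj (F a x) * z (i, x)) * N (i, a) (j, b) * (\<Sum>y<n. cnj (F b y) * z (j, y)))"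
    by (intro sum.cong refl sum.swap)
  finally show ?thesis unfolding sesq_pairs fst_conv snd_conv .
qed

text \<open>The Breuer--Hall map on the second factor, in pair indices. The exchanged
  \<open>y\<close> and \<open>x\<close> inside \<open>\<rho>\<close> are the partial
  transpose.\<close>

definition breuer_hall_form :: "nat \<Rightarrow> (nat \<Rightarrow> nat \<Rightarrow> complex) \<Rightarrow> (nat \<times> nat \<Rightarrow> nat \<times> nat \<Rightarrow> complex)
    \<Rightarrow> nat \<times> nat \<Rightarrow> nat \<times> nat \<Rightarrow> complex" where
  "breuer_hall_form n U \<rho> p q = reduction n \<rho> p q
     - (\<Sum>x<n. \<Sum>y<n. U (snd p) x * \<rho> (fst p, y) (fst q, x) * cnj (U (snd q) y))"

lemma herm_breuer_hall_form:
  assumes "herm_on (X \<times> {..<n}) \<rho>"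
  shows "herm_on (X \<times> {..<n}) (breuer_hall_form n U \<rho>)"
  unfolding breuer_hall_form_def reduction_def
proof (intro herm_diff herm_tensor_id herm_ptrace assms)
  show "herm_on (X \<times> {..<n}) (\<lambda>p q. \<Sum>x<n. \<Sum>y<n. U (snd p) x * \<rho> (fst p, y) (fst q, x) * cnj (U (snd q) y))"
    unfolding herm_on_def
  proof (intro ballI)
    fix p q assume pq: "p \<in> X \<times> {..<n}" "q \<in> X \<times> {..<n}"
    have "(\<Sum>x<n. \<Sum>y<n. U (snd q) x * \<rho> (fst q, y) (fst p, x) * cnj (U (snd p) y))
      = (\<Sum>y<n. \<Sum>x<n. U (snd q) x * \<rho> (fst q, y) (fst p, x) * cnj (U (snd p) y))"
      by (rule sum.swap)
    also have "\<dots> = cnj (\<Sum>x<n. \<Sum>y<n. U (snd p) x * \<rho> (fst p, y) (fst q, x) * cnj (U (snd q) y))"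
      unfolding cnj_sum
    proof (intro sum.cong refl)
      fix x y assume "y \<in> {..<n}" "x \<in> {..<n}"
      then have e: "\<rho> (fst q, y) (fst p, x) = cnj (\<rho> (fst p, x) (fst q, y))"
        using assms pq unfolding herm_on_def by auto
      show "U (snd q) x * \<rho> (fst q, y) (fst p, x) * cnj (U (snd p) y)
        = cnj (U (snd p) y * \<rho> (fst p, x) (fst q, y) * cnj (U (snd q) x))"
        by (subst e) simp
    qed
    finally show "(\<Sum>x<n. \<Sum>y<n. U (snd q) x * \<rho> (fst q, y) (fst p, x) * cnj (U (snd p) y))
      = cnj (\<Sum>x<n. \<Sum>y<n. U (snd p) x * \<rho> (fst p, y) (fst q, x) * cnj (U (snd q) y))" .
  qed
qed

lemma skew_image_orthonormal:
  assumes unitary: "\<And>x y. x < n \<Longrightarrow> y < n \<Longrightarrow> (\<Sum>i<n. cnj (U i x) * U i y) = delta x y"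
  shows "(\<Sum>x<n. cnj (skew_image n U f x) * skew_image n U g x) = (\<Sum>x<n. cnj (g x) * f x)"
proof -
  have "(\<Sum>i<n. cnj (skew_image n U f i) * skew_image n U g i)
    = (\<Sum>i<n. \<Sum>x<n. \<Sum>y<n. cnj (U i x) * U i y * (f x * cnj (g y)))"
    unfolding skew_image_def cnj_sum sum_product by (intro sum.cong refl) simp
  also have "\<dots> = (\<Sum>x<n. \<Sum>i<n. \<Sum>y<n. cnj (U i x) * U i y * (f x * cnj (g y)))"
    by (rule sum.swap)
  also have "\<dots> = (\<Sum>x<n. \<Sum>y<n. \<Sum>i<n. cnj (U i x) * U i y * (f x * cnj (g y)))"
    by (intro sum.cong refl sum.swap)
  also have "\<dots> = (\<Sum>x<n. \<Sum>y<n. delta x y * (f x * cnj (g y)))"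
    unfolding sum_distrib_right[symmetric] by (intro sum.cong refl) (simp add: unitary)
  also have "\<dots> = (\<Sum>x<n. cnj (g x) * f x)"
    by (intro sum.cong refl) (simp add: mult.commute)
  finally show ?thesis .
qed

text \<open>Of the \<open>d\<close> dimensions at most \<open>m * k\<close> are spent on removing
  the components along the \<open>g a\<close>; the remaining \<open>m\<close> orthonormal vectors
  lie over the span of the \<open>f a\<close>. In coordinates along the \<open>f a\<close> they form
  the family \<open>C\<close> to which \<open>reduction_state\<close> applies.\<close>

lemma breuer_hall_state:
  fixes n m k d :: nat and U :: "nat \<Rightarrow> nat \<Rightarrow> complex" and c :: "nat \<Rightarrow> nat \<times> nat \<Rightarrow> complex"
  assumes n: "n = 2 * k" and k: "k > 0" and m: "m > 0"
    and unitary: "\<And>x y. x < n \<Longrightarrow> y < n \<Longrightarrow> (\<Sum>i<n. cnj (U i x) * U i y) = delta x y"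
    and skew: "\<And>x y. x < n \<Longrightarrow> y < n \<Longrightarrow> U y x = - U x y"
    and c: "independent_on ({..<m} \<times> {..<n}) {..<d} c" and d: "m * (k + 1) \<le> d"
  obtains \<sigma> x where
    "psd_on {..<m} \<sigma>"
    "0 < (\<Sum>p\<in>{..<m} \<times> {..<n}. Re (compress m (\<lambda>t p. \<Sum>j<d. x t j * c j p) \<sigma> p p))"
    "psd_on ({..<m} \<times> {..<n}) (breuer_hall_form n U (compress m (\<lambda>t p. \<Sum>j<d. x t j * c j p) \<sigma>))"
proof -
  let ?X = "{..<m}"
  let ?N = "{..<m} \<times> {..<n}"
  let ?K = "{..<m} \<times> {..<k}"
  have kn: "2 * k \<le> n" using n by simp
  obtain f where ff: "\<And>a b. a < k \<Longrightarrow> b < k \<Longrightarrow> (\<Sum>x<n. cnj (f a x) * f b x) = delta a b"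
    and fg: "\<And>a b. a < k \<Longrightarrow> b < k \<Longrightarrow> (\<Sum>x<n. cnj (f a x) * skew_image n U (f b) x) = 0"
    using lagrangian_basis[where U = U and n = n and k = k, OF skew kn] by blast
  define g where "g a = skew_image n U (f a)" for a
  have gg: "(\<Sum>x<n. cnj (g a x) * g b x) = delta a b" if "a < k" "b < k" for a b
  proof -
    have "(\<Sum>x<n. cnj (g a x) * g b x) = (\<Sum>x<n. cnj (f b x) * f a x)"
      unfolding g_def by (rule skew_image_orthonormal) (rule unitary)
    then show ?thesis using ff[OF that(2,1)] by (simp add: delta_def)
  qed
  have gf: "(\<Sum>x<n. cnj (g a x) * f b x) = 0" if "a < k" "b < k" for a b
  proof -
    have "(\<Sum>x<n. cnj (g a x) * f b x) = cnj (\<Sum>x<n. cnj (f b x) * g a x)"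
      by (simp add: cnj_sum mult.commute)
    then show ?thesis using fg[OF that(2,1)] by (simp add: g_def)
  qed
  define h where "h s = (if s < k then f s else g (s - k))" for s
  have h: "(\<Sum>x<n. cnj (h s x) * h t x) = delta s t" if "s < n" "t < n" for s t
    using that n ff gg gf fg by (auto simp: h_def g_def delta_def)
  have hsum: "(\<Sum>s<n. H (h s)) = (\<Sum>a<k. H (f a)) + (\<Sum>a<k. H (g a))"
    for H :: "(nat \<Rightarrow> complex) \<Rightarrow> complex"
    unfolding n mult_2 sum_lessThan_add by (simp add: h_def)
  \<comment> \<open>For \<open>ia = (i, a)\<close> this functional reads off the component along the
    \<open>i\<close>-th unit vector tensored with \<open>g a\<close>.\<close>
  define E where "E ia p = (if fst p = fst ia then cnj (g (snd ia) (snd p)) else 0)" for ia p :: "nat \<times> nat"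
  have fin: "finite ?N" "finite {..<d}" "finite ?K" by auto
  have card: "card ?K + m \<le> card {..<d}" using d by simp
  obtain x :: "nat \<Rightarrow> nat \<Rightarrow> complex" where
    on: "\<And>s t. s < m \<Longrightarrow> t < m \<Longrightarrow>
       sesq ?N delta (\<lambda>p. \<Sum>j<d. x s j * c j p) (\<lambda>p. \<Sum>j<d. x t j * c j p) = delta s t"
    and ker: "\<And>t e. t < m \<Longrightarrow> e \<in> ?K \<Longrightarrow> (\<Sum>p\<in>?N. E e p * (\<Sum>j<d. x t j * c j p)) = 0"
    using orthonormal_family_in_span[where a = E, OF fin c pd_delta[OF fin(1)] card] by blast
  define v where "v t p = (\<Sum>j<d. x t j * c j p)" for t p
  have vv: "(\<Sum>p\<in>?N. cnj (v s p) * v t p) = delta s t" if "s < m" "t < m" for s t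
    using on[OF that] unfolding v_def[symmetric] by (simp add: sesq_delta)
  have gv: "(\<Sum>y<n. cnj (g a y) * v t (i, y)) = 0" if "t < m" "i < m" "a < k" for t i a
  proof -
    have "(\<Sum>p\<in>?N. E (i, a) p * v t p) = (\<Sum>i'<m. \<Sum>y<n. (if i' = i then cnj (g a y) * v t (i', y) else 0))"
      unfolding sum_pairs by (intro sum.cong refl) (simp add: E_def)
    also have "\<dots> = (\<Sum>i'<m. if i' = i then \<Sum>y<n. cnj (g a y) * v t (i, y) else 0)"
      by (intro sum.cong refl) simp
    also have "\<dots> = (\<Sum>y<n. cnj (g a y) * v t (i, y))" using that by simp
    finally show ?thesis using ker[of t "(i, a)"] that by (simp add: v_def)
  qed
  \<comment> \<open>Coordinates of \<open>v t\<close> along the \<open>f a\<close>. Since the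
    components along the \<open>g a\<close> vanish, they determine \<open>v t\<close> and preserve
    inner products.\<close>
  define C where "C t p = (\<Sum>y<n. cnj (f (snd p) y) * v t (fst p, y))" for t and p :: "nat \<times> nat"
  have vC: "v t (i, y) = (\<Sum>a<k. C t (i, a) * f a y)" if "t < m" "i < m" "y < n" for t i y
  proof -
    have "v t (i, y) = (\<Sum>s<n. (\<Sum>z<n. cnj (h s z) * v t (i, z)) * h s y)"
      using orthonormal_completeness[OF h that(3), of "\<lambda>y. v t (i, y)"] by simp
    also have "\<dots> = (\<Sum>a<k. (\<Sum>z<n. cnj (f a z) * v t (i, z)) * f a y)
        + (\<Sum>a<k. (\<Sum>z<n. cnj (g a z) * v t (i, z)) * g a y)"
      by (rule hsum)
    finally show ?thesis using that by (simp add: gv C_def)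
  qed
  have CC: "(\<Sum>p\<in>?K. cnj (C s p) * C t p) = delta s t" if st: "s < m" "t < m" for s t
  proof -
    have "delta s t = (\<Sum>i<m. \<Sum>y<n. cnj (v s (i, y)) * v t (i, y))"
      using vv[OF st] by (simp only: sum_pairs)
    also have "\<dots> = (\<Sum>i<m. \<Sum>y<n. \<Sum>a<k. cnj (v s (i, y)) * (C t (i, a) * f a y))"
      by (intro sum.cong refl) (simp add: vC[OF st(2)] sum_distrib_left)
    also have "\<dots> = (\<Sum>i<m. \<Sum>a<k. \<Sum>y<n. cnj (v s (i, y)) * (C t (i, a) * f a y))"
      by (intro sum.cong refl sum.swap)
    also have "\<dots> = (\<Sum>i<m. \<Sum>a<k. cnj (C s (i, a)) * C t (i, a))"
    proof (intro sum.cong refl)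
      fix i a
      show "(\<Sum>y<n. cnj (v s (i, y)) * (C t (i, a) * f a y)) = cnj (C s (i, a)) * C t (i, a)"
        unfolding C_def[of s] cnj_sum sum_distrib_right by (intro sum.cong refl) simp
    qed
    finally show ?thesis by (simp only: sum_pairs)
  qed
  obtain \<sigma> where \<sigma>: "psd_on ?X \<sigma>" "0 < (\<Sum>s<m. Re (\<sigma> s s))"
    and red: "psd_on ?K (reduction k (compress m C \<sigma>))"
    using reduction_state[OF m k CC] by blast
  define \<tau> where "\<tau> = compress m C \<sigma>"
  define \<rho> where "\<rho> = compress m v \<sigma>"
  have \<tau>: "psd_on ?K \<tau>" and \<rho>: "psd_on ?N \<rho>" unfolding \<tau>_def \<rho>_def by (rule psd_compress[OF \<sigma>(1)])+
  have \<rho>\<tau>: "\<rho> (i, x) (j, y) = (\<Sum>a<k. \<Sum>b<k. f a x * \<tau> (i, a) (j, b) * cnj (f b y))"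
    if "i < m" "j < m" "x < n" "y < n" for i j x y
  proof -
    have "\<rho> (i, x) (j, y) = sesq ?X \<sigma> (\<lambda>s. \<Sum>a<k. cnj (f a x) * cnj (C s (i, a))) (\<lambda>t. \<Sum>b<k. cnj (f b y) * cnj (C t (j, b)))"
      unfolding \<rho>_def compress_def using that
      by (intro sesq_cong refl) (simp_all add: vC cnj_sum mult.commute)
    then show ?thesis
      unfolding sesq_sum_left sesq_sum_right sesq_scale_left sesq_scale_right
      by (simp add: \<tau>_def compress_def sum_distrib_left mult_ac)
  qed
  have tr\<rho>: "(\<Sum>p\<in>?N. \<rho> p p) = (\<Sum>s<m. \<sigma> s s)"
    unfolding \<rho>_def by (rule sum_compress_diag[OF vv])
  have pt: "ptrace n \<rho> i j = ptrace k \<tau> i j" if ij: "i < m" "j < m" for i j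
  proof -
    have "ptrace n \<rho> i j = (\<Sum>x<n. \<Sum>a<k. \<Sum>b<k. f a x * \<tau> (i, a) (j, b) * cnj (f b x))"
      unfolding ptrace_def using ij by (intro sum.cong refl) (simp add: \<rho>\<tau>)
    also have "\<dots> = (\<Sum>a<k. \<Sum>x<n. \<Sum>b<k. f a x * \<tau> (i, a) (j, b) * cnj (f b x))"
      by (rule sum.swap)
    also have "\<dots> = (\<Sum>a<k. \<Sum>b<k. \<Sum>x<n. f a x * \<tau> (i, a) (j, b) * cnj (f b x))"
      by (intro sum.cong refl sum.swap)
    also have "\<dots> = (\<Sum>a<k. \<Sum>b<k. (\<Sum>x<n. cnj (f b x) * f a x) * \<tau> (i, a) (j, b))"
      unfolding sum_distrib_right by (intro sum.cong refl) simp
    also have "\<dots> = (\<Sum>a<k. \<Sum>b<k. delta b a * \<tau> (i, a) (j, b))"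
      by (intro sum.cong refl) (simp add: ff)
    also have "\<dots> = ptrace k \<tau> i j" unfolding ptrace_def by (intro sum.cong refl) simp
    finally show ?thesis .
  qed
  define \<rho>' where "\<rho>' p q = (\<Sum>x<n. \<Sum>y<n. U (snd p) x * \<rho> (fst p, y) (fst q, x) * cnj (U (snd q) y))"
    for p q :: "nat \<times> nat"
  \<comment> \<open>The partial transpose of \<open>\<tau>\<close>. Since \<open>U\<close> and
    conjugation turn each \<open>f a\<close> into \<open>g a\<close>, the form
    \<open>\<rho>'\<close> has the coefficients of \<open>\<tau>'\<close> along the
    \<open>g a\<close>.\<close>
  define \<tau>' where "\<tau>' p q = \<tau> (fst p, snd q) (fst q, snd p)" for p q
  have \<rho>'\<tau>': "\<rho>' (i, x') (j, y') = (\<Sum>b<k. \<Sum>a<k. g b x' * \<tau>' (i, b) (j, a) * cnj (g a y'))"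
    if "i < m" "j < m" "x' < n" "y' < n" for i j x' y'
  proof -
    have "\<rho>' (i, x') (j, y') = (\<Sum>x<n. \<Sum>y<n. \<Sum>a<k. \<Sum>b<k.
        U x' x * cnj (f b x) * (\<tau> (i, a) (j, b) * (cnj (U y' y) * f a y)))"
      unfolding \<rho>'_def using that by (intro sum.cong refl) (simp add: \<rho>\<tau> sum_distrib_left sum_distrib_right mult_ac)
    also have "\<dots> = (\<Sum>x<n. \<Sum>a<k. \<Sum>y<n. \<Sum>b<k.
        U x' x * cnj (f b x) * (\<tau> (i, a) (j, b) * (cnj (U y' y) * f a y)))"
      by (intro sum.cong refl sum.swap)
    also have "\<dots> = (\<Sum>x<n. \<Sum>a<k. \<Sum>b<k. \<Sum>y<n.
        U x' x * cnj (f b x) * (\<tau> (i, a) (j, b) * (cnj (U y' y) * f a y)))"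
      by (intro sum.cong refl sum.swap)
    also have "\<dots> = (\<Sum>a<k. \<Sum>x<n. \<Sum>b<k. \<Sum>y<n.
        U x' x * cnj (f b x) * (\<tau> (i, a) (j, b) * (cnj (U y' y) * f a y)))"
      by (rule sum.swap)
    also have "\<dots> = (\<Sum>a<k. \<Sum>b<k. \<Sum>x<n. \<Sum>y<n.
        U x' x * cnj (f b x) * (\<tau> (i, a) (j, b) * (cnj (U y' y) * f a y)))"
      by (intro sum.cong refl sum.swap)
    also have "\<dots> = (\<Sum>a<k. \<Sum>b<k. g b x' * (\<tau> (i, a) (j, b) * cnj (g a y')))"
    proof (intro sum.cong refl)
      fix a b
      have "(\<Sum>x<n. \<Sum>y<n. U x' x * cnj (f b x) * (\<tau> (i, a) (j, b) * (cnj (U y' y) * f a y)))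
        = \<tau> (i, a) (j, b) * (g b x' * cnj (g a y'))"
        unfolding g_def skew_image_def cnj_sum sum_product unfolding sum_distrib_left
        by (intro sum.cong refl) simp
      then show "(\<Sum>x<n. \<Sum>y<n. U x' x * cnj (f b x) * (\<tau> (i, a) (j, b) * (cnj (U y' y) * f a y)))
        = g b x' * (\<tau> (i, a) (j, b) * cnj (g a y'))" by simp
    qed
    also have "\<dots> = (\<Sum>b<k. \<Sum>a<k. g b x' * (\<tau> (i, a) (j, b) * cnj (g a y')))"
      by (rule sum.swap)
    finally show ?thesis by (simp add: \<tau>'_def mult.assoc)
  qed
  have "psd_on ?N (breuer_hall_form n U \<rho>)"
    unfolding psd_on_def
  proof (intro conjI allI)
    show "herm_on ?N (breuer_hall_form n U \<rho>)"
      using \<rho> by (intro herm_breuer_hall_form) (simp add: psd_on_def)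
    fix z
    define \<zeta> where "\<zeta> p = (\<Sum>x<n. cnj (f (snd p) x) * z (fst p, x))" for p :: "nat \<times> nat"
    define \<eta> where "\<eta> p = (\<Sum>x<n. cnj (g (snd p) x) * z (fst p, x))" for p :: "nat \<times> nat"
    let ?T = "tensor_id (ptrace k \<tau>)"
    have "sesq ?N (tensor_id (ptrace n \<rho>)) z z = sesq ?N ?T z z"
      by (intro sesq_cong refl) (auto simp: tensor_id_def pt)
    also have "\<dots> = (\<Sum>s<n. sesq ?X (ptrace k \<tau>) (\<lambda>i. \<Sum>x<n. cnj (h s x) * z (i, x)) (\<lambda>i. \<Sum>x<n. cnj (h s x) * z (i, x)))"
      unfolding sesq_tensor_id by (rule sum_sesq_unitary[OF h])
    also have "\<dots> = sesq ?K ?T \<zeta> \<zeta> + sesq ?K ?T \<eta> \<eta>"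
      unfolding sesq_tensor_id \<zeta>_def \<eta>_def fst_conv snd_conv by (rule hsum)
    finally have 1: "sesq ?N (tensor_id (ptrace n \<rho>)) z z = sesq ?K ?T \<zeta> \<zeta> + sesq ?K ?T \<eta> \<eta>" .
    have 2: "sesq ?N \<rho> z z = sesq ?K \<tau> \<zeta> \<zeta>"
      unfolding \<zeta>_def by (rule sesq_local_change) (auto simp: \<rho>\<tau>)
    have 3: "sesq ?N \<rho>' z z = sesq ?K \<tau>' \<eta> \<eta>"
      unfolding \<eta>_def by (rule sesq_local_change) (auto simp: \<rho>'\<tau>')
    have "sesq ?N (breuer_hall_form n U \<rho>) z z
      = sesq ?N (tensor_id (ptrace n \<rho>)) z z - sesq ?N \<rho> z z - sesq ?N \<rho>' z z"
      unfolding breuer_hall_form_def reduction_def sesq_diff_form \<rho>'_def ..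
    \<comment> \<open>The term \<open>\<rho>\<close> sees only \<open>\<zeta>\<close> and
      \<open>\<rho>'\<close> only \<open>\<eta>\<close>. The first summand is nonnegative by the
      choice of \<open>\<sigma>\<close>, the second by
      \<open>partial_transpose_reduction_nonneg\<close>.\<close>
    also have "\<dots> = sesq ?K (reduction k \<tau>) \<zeta> \<zeta> + (sesq ?K ?T \<eta> \<eta> - sesq ?K \<tau>' \<eta> \<eta>)"
      unfolding 1 2 3 reduction_def sesq_diff_form by simp
    finally show "0 \<le> Re (sesq ?N (breuer_hall_form n U \<rho>) z z)"
      using partial_transpose_reduction_nonneg[OF _ \<tau>, of \<eta>] red
      by (simp add: psd_on_def \<tau>_def[symmetric] \<tau>'_def[abs_def])
  qed
  moreover have "0 < (\<Sum>p\<in>?N. Re (\<rho> p p))" using \<sigma>(2) tr\<rho> by (simp flip: Re_sum)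
  ultimately show ?thesis
    using that[OF \<sigma>(1), of x] by (simp add: \<rho>_def v_def[abs_def])
qed

section \<open>Matrices and subspaces\<close>

abbreviation vec_subspace :: "nat \<Rightarrow> complex vec set \<Rightarrow> bool" where
  "vec_subspace N S \<equiv> VectorSpace.subspace class_ring S (module_vec TYPE(complex) N)"

abbreviation vec_subspace_dim :: "nat \<Rightarrow> complex vec set \<Rightarrow> nat" where
  "vec_subspace_dim N S \<equiv> vectorspace.dim class_ring ((module_vec TYPE(complex) N)\<lparr>carrier := S\<rparr>)"

lemma vec_subspaceD:
  assumes "vec_subspace N S"
  shows "S \<subseteq> carrier_vec N" "0\<^sub>v N \<in> S" "u \<in> S \<Longrightarrow> v \<in> S \<Longrightarrow> u + v \<in> S" "v \<in> S \<Longrightarrow> c \<cdot>\<^sub>v v \<in> S"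
proof -
  have "submodule class_ring S (module_vec TYPE(complex) N)"
    using assms by (simp add: VectorSpace.subspace_def)
  then show "S \<subseteq> carrier_vec N" "0\<^sub>v N \<in> S" "u \<in> S \<Longrightarrow> v \<in> S \<Longrightarrow> u + v \<in> S" "v \<in> S \<Longrightarrow> c \<cdot>\<^sub>v v \<in> S"
    by (auto simp: submodule_def module_vec_simps)
qed

lemma vec_subspaceI:
  assumes "S \<subseteq> carrier_vec N" "0\<^sub>v N \<in> S" "\<And>u v. u \<in> S \<Longrightarrow> v \<in> S \<Longrightarrow> u + v \<in> S"
    "\<And>c v. v \<in> S \<Longrightarrow> c \<cdot>\<^sub>v v \<in> S"
  shows "vec_subspace N S"
  unfolding VectorSpace.subspace_def submodule_def
  using assms vec_vs vec_module by (auto simp: module_vec_simps)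

lemma vec_subspace_lincomb:
  fixes d :: nat
  assumes S: "vec_subspace N S" and w: "\<And>j. j < d \<Longrightarrow> w j \<in> S"
  shows "vec N (\<lambda>r. \<Sum>j<d. a j * w j $ r) \<in> S"
  using w
proof (induction d)
  case 0
  have "vec N (\<lambda>r. \<Sum>j<0::nat. a j * w j $ r) = 0\<^sub>v N" by (intro eq_vecI) auto
  then show ?case using vec_subspaceD(2)[OF S] by simp
next
  case (Suc d)
  have "w d \<in> carrier_vec N" using Suc.prems vec_subspaceD(1)[OF S] by auto
  then have "vec N (\<lambda>r. \<Sum>j<Suc d. a j * w j $ r) = vec N (\<lambda>r. \<Sum>j<d. a j * w j $ r) + a d \<cdot>\<^sub>v w d"
    by (intro eq_vecI) auto
  moreover have "vec N (\<lambda>r. \<Sum>j<d. a j * w j $ r) \<in> S" using Suc by simp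
  ultimately show ?case using vec_subspaceD(3,4)[OF S] Suc.prems by simp
qed

text \<open>The abstract dimension becomes the length of an independent family. Independent subsets
  of the ambient space have at most \<open>N\<close> elements, so a maximal one inside
  \<open>S\<close> exists and is a basis; this also yields finite dimension, which
  \<open>independent_imp_le_dim\<close> relies on.\<close>

lemma vec_subspace_basis:
  assumes S: "vec_subspace N S"
  obtains w where "\<And>j. j < vec_subspace_dim N S \<Longrightarrow> w j \<in> S"
    "independent_on {..<N} {..<vec_subspace_dim N S} (\<lambda>j r. w j $ r)"
    "vec_subspace_dim N S \<le> N"
    "vectorspace.fin_dim class_ring ((module_vec TYPE(complex) N)\<lparr>carrier := S\<rparr>)"
proof -
  interpret V: vec_space "TYPE(complex)" N .
  interpret W: vectorspace class_ring "V.vs S" by (rule V.subspace_is_vs[OF S])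
  have sub: "submodule class_ring S V.V" using S by (simp add: VectorSpace.subspace_def)
  have SV: "S \<subseteq> carrier_vec N" by (rule vec_subspaceD(1)[OF S])
  have dep: "W.lin_dep A \<longleftrightarrow> V.lin_dep A" if "A \<subseteq> S" for A
    by (rule V.span_li_not_depend(2)[OF that sub])
  have "\<exists>B. finite B \<and> maximal B (\<lambda>A. A \<subseteq> carrier (V.vs S) \<and> W.lin_indpt A)"
  proof (rule maximal_exists[where N = N and B = "{}"])
    fix A assume "A \<subseteq> carrier (V.vs S) \<and> W.lin_indpt A"
    then have A: "A \<subseteq> S" "V.lin_indpt A" using dep by auto
    then show "finite A \<and> card A \<le> N"
      using V.li_le_dim[OF V.fin_dim, of A] SV V.dim_is_n by auto
  next
    show "{} \<subseteq> carrier (V.vs S) \<and> W.lin_indpt {}" by (auto simp: W.lin_dep_def)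
  qed
  then obtain B where B: "finite B" "maximal B (\<lambda>A. A \<subseteq> carrier (V.vs S) \<and> W.lin_indpt A)" by blast
  have basis: "W.basis B" by (rule W.max_li_is_basis[OF B(2)])
  have dim: "W.dim = card B" by (rule W.dim_basis[OF B(1) basis])
  have BS: "B \<subseteq> S" and li: "V.lin_indpt B" using basis dep by (auto simp: W.basis_def)
  have fd: "W.fin_dim" using basis B(1) by (auto simp: W.fin_dim_def W.basis_def)
  have le: "card B \<le> N" using V.li_le_dim[OF V.fin_dim, of B] BS SV V.dim_is_n li by auto
  obtain w where w: "bij_betw w {..<card B} B"
    using ex_bij_betw_nat_finite[OF B(1)] by (auto simp: atLeast0LessThan)
  have ind: "independent_on {..<N} {..<card B} (\<lambda>j r. w j $ r)"
    unfolding independent_on_def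
  proof (intro allI impI ballI)
    fix x j assume x: "\<forall>r\<in>{..<N}. (\<Sum>j<card B. x j * w j $ r) = 0" and j: "j \<in> {..<card B}"
    \<comment> \<open>Coefficients indexed by numbers are moved to the basis vectors through the
      inverse of the enumeration \<open>w\<close>.\<close>
    define a where "a v = x (inv_into {..<card B} w v)" for v
    have aw: "a (w j) = x j" if "j < card B" for j
      using that w by (simp add: a_def bij_betw_def inv_into_f_f)
    have "V.lincomb a B = 0\<^sub>v N"
    proof (intro eq_vecI)
      fix r assume "r < dim_vec (0\<^sub>v N)"
      then have r: "r < N" by simp
      have "V.lincomb a B $ r = (\<Sum>v\<in>B. a v * v $ r)" using r BS SV by (intro V.lincomb_index) auto
      also have "\<dots> = (\<Sum>j<card B. a (w j) * w j $ r)"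
        by (rule sum.reindex_bij_betw[OF w, symmetric])
      also have "\<dots> = 0" using x r by (simp add: aw)
      finally show "V.lincomb a B $ r = 0\<^sub>v N $ r" using r by simp
    qed (use V.lincomb_dim[OF B(1)] BS SV in auto)
    show "x j = 0"
    proof (rule ccontr)
      assume "x j \<noteq> 0"
      then have "a (w j) \<noteq> 0" "w j \<in> B" using j aw w by (auto simp: bij_betw_def)
      then have "V.lin_dep B"
        using V.lin_dep_crit[where A = B and S = B and a = a and v = "w j"] B(1) \<open>V.lincomb a B = 0\<^sub>v N\<close>
        by auto
      with li show False by simp
    qed
  qed
  show ?thesis
    using that[of w] w BS ind le fd unfolding dim by (auto simp: bij_betw_def)
qed

lemma independent_imp_le_dim:
  assumes S: "vec_subspace N S" and w: "\<And>j. j < d \<Longrightarrow> w j \<in> S"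
    and ind: "independent_on {..<N} {..<d} (\<lambda>j r. w j $ r)"
  shows "d \<le> vec_subspace_dim N S"
proof -
  interpret V: vec_space "TYPE(complex)" N .
  interpret W: vectorspace class_ring "V.vs S" by (rule V.subspace_is_vs[OF S])
  have sub: "submodule class_ring S V.V" using S by (simp add: VectorSpace.subspace_def)
  have SV: "S \<subseteq> carrier_vec N" by (rule vec_subspaceD(1)[OF S])
  have fd: "W.fin_dim" using vec_subspace_basis[OF S] by blast
  have inj: "inj_on w {..<d}"
  proof (rule inj_onI, rule ccontr)
    fix i j assume ij: "i \<in> {..<d}" "j \<in> {..<d}" "w i = w j" "i \<noteq> j"
    \<comment> \<open>A repeated vector would give the relation with coefficients 1 at
      \<open>i\<close> and -1 at \<open>j\<close>. So the family is injective and its range really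
      has \<open>d\<close> elements.\<close>
    define x where "x l = delta i l - delta j l" for l
    have "(\<Sum>l<d. x l * w l $ r) = 0" for r
      using ij by (simp add: x_def left_diff_distrib sum_subtractf)
    then have "x i = 0" using ind ij unfolding independent_on_def by blast
    then show False using ij by (simp add: x_def delta_def)
  qed
  have wS: "w ` {..<d} \<subseteq> S" using w by auto
  have "V.lin_indpt (w ` {..<d})"
  proof (rule V.finite_lin_indpt2)
    fix a assume a: "V.lincomb a (w ` {..<d}) = 0\<^sub>v N"
    have "(\<Sum>j<d. a (w j) * w j $ r) = 0" if r: "r < N" for r
    proof -
      have "V.lincomb a (w ` {..<d}) $ r = (\<Sum>v\<in>w ` {..<d}. a v * v $ r)"
        using r wS SV by (intro V.lincomb_index) auto
      also have "\<dots> = (\<Sum>j<d. a (w j) * w j $ r)" by (simp add: sum.reindex[OF inj])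
      finally show ?thesis using a r by simp
    qed
    then have "\<forall>j\<in>{..<d}. a (w j) = 0"
      using ind unfolding independent_on_def by (auto dest!: spec[of _ "\<lambda>j. a (w j)"])
    then show "\<forall>v\<in>w ` {..<d}. a v = 0" by auto
  qed (use wS SV in auto)
  then have "W.lin_indpt (w ` {..<d})" using V.span_li_not_depend(2)[OF wS sub] by simp
  then have "card (w ` {..<d}) \<le> W.dim" using W.li_le_dim(2)[OF fd] wS by simp
  then show ?thesis by (simp add: card_image[OF inj])
qed

section \<open>Semidefinite matrices as forms on index sets\<close>

lemma psd_on_cong:
  assumes "\<And>p q. p \<in> I \<Longrightarrow> q \<in> I \<Longrightarrow> Q p q = Q' p q"
  shows "psd_on I Q \<longleftrightarrow> psd_on I Q'"
proof -
  have "sesq I Q v v = sesq I Q' v v" for v by (intro sesq_cong assms refl)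
  moreover have "herm_on I Q \<longleftrightarrow> herm_on I Q'" unfolding herm_on_def by (simp add: assms)
  ultimately show ?thesis by (simp add: psd_on_def)
qed

lemma mat_adjoint_index:
  assumes "A \<in> carrier_mat nr nc" "i < nc" "j < nr"
  shows "mat_adjoint A $$ (i, j) = cnj (A $$ (j, i))"
  using assms by (auto simp: mat_adjoint_def mat_of_rows_def conjugate_vec_def)

lemma mat_adjoint_carrier: "A \<in> carrier_mat nr nc \<Longrightarrow> mat_adjoint A \<in> carrier_mat nc nr"
  by (auto simp: mat_adjoint_def)

lemma hermitian_iff_herm_on:
  assumes A: "A \<in> carrier_mat N N"
  shows "hermitian N A \<longleftrightarrow> herm_on {..<N} (\<lambda>r s. A $$ (r, s))"
proof
  assume H: "hermitian N A"
  show "herm_on {..<N} (\<lambda>r s. A $$ (r, s))"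
    unfolding herm_on_def
  proof (intro ballI)
    fix r s assume "r \<in> {..<N}" "s \<in> {..<N}"
    then have "mat_adjoint A $$ (s, r) = cnj (A $$ (r, s))" by (intro mat_adjoint_index[OF A]) auto
    then show "A $$ (s, r) = cnj (A $$ (r, s))" using H by (simp add: hermitian_def)
  qed
next
  assume H: "herm_on {..<N} (\<lambda>r s. A $$ (r, s))"
  have "mat_adjoint A = A"
  proof (rule eq_matI)
    fix r s assume "r < dim_row A" "s < dim_col A"
    then have rs: "r < N" "s < N" using A by auto
    then have "A $$ (r, s) = cnj (A $$ (s, r))" using H unfolding herm_on_def by blast
    then show "mat_adjoint A $$ (r, s) = A $$ (r, s)" using mat_adjoint_index[OF A rs] by simp
  qed (use mat_adjoint_carrier[OF A] A in auto)
  then show "hermitian N A" using A by (simp add: hermitian_def)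
qed

lemma quadratic_form_eq_sesq:
  assumes A: "A \<in> carrier_mat N N" and v: "v \<in> carrier_vec N"
  shows "(A *\<^sub>v v) \<bullet>c v = sesq {..<N} (\<lambda>r s. A $$ (r, s)) (\<lambda>r. v $ r) (\<lambda>r. v $ r)"
proof -
  have "(A *\<^sub>v v) \<bullet>c v = (\<Sum>r<N. (\<Sum>s<N. A $$ (r, s) * v $ s) * cnj (v $ r))"
    using A v by (simp add: scalar_prod_def atLeast0LessThan)
  also have "\<dots> = (\<Sum>r<N. \<Sum>s<N. cnj (v $ r) * A $$ (r, s) * v $ s)"
    unfolding sum_distrib_right by (intro sum.cong refl) simp
  finally show ?thesis by (simp only: sesq_def)
qed

lemma psd_iff_psd_on:
  assumes A: "A \<in> carrier_mat N N"
  shows "psd N A \<longleftrightarrow> psd_on {..<N} (\<lambda>r s. A $$ (r, s))"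
proof -
  have "(\<forall>v\<in>carrier_vec N. 0 \<le> Re ((A *\<^sub>v v) \<bullet>c v))
    \<longleftrightarrow> (\<forall>v. 0 \<le> Re (sesq {..<N} (\<lambda>r s. A $$ (r, s)) v v))"
  proof (intro iffI allI ballI)
    fix v assume *: "\<forall>v\<in>carrier_vec N. 0 \<le> Re ((A *\<^sub>v v) \<bullet>c v)"
    have "sesq {..<N} (\<lambda>r s. A $$ (r, s)) v v = (A *\<^sub>v vec N v) \<bullet>c vec N v"
      unfolding quadratic_form_eq_sesq[OF A vec_carrier] by (intro sesq_cong) auto
    then show "0 \<le> Re (sesq {..<N} (\<lambda>r s. A $$ (r, s)) v v)" using * by simp
  next
    fix v :: "complex vec" assume "v \<in> carrier_vec N"
      "\<forall>v. 0 \<le> Re (sesq {..<N} (\<lambda>r s. A $$ (r, s)) v v)"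
    then show "0 \<le> Re ((A *\<^sub>v v) \<bullet>c v)" by (simp add: quadratic_form_eq_sesq[OF A])
  qed
  then show ?thesis by (simp add: psd_def psd_on_def hermitian_iff_herm_on[OF A])
qed

section \<open>Kronecker indices as pairs\<close>

lemma sum_flatten: "(\<Sum>r<m * n. f r) = (\<Sum>p\<in>{..<m} \<times> {..<n}. f (fst p * n + snd p))"
  for f :: "nat \<Rightarrow> 'b :: comm_monoid_add"
proof -
  have "(\<Sum>r<m * n. f r) = (\<Sum>i<m. \<Sum>a<n. f (i * n + a))"
  proof (induction m)
    case (Suc m)
    have "Suc m * n = m * n + n" by simp
    then show ?case using Suc by (simp only: sum_lessThan_add sum.lessThan_Suc)
  qed simp
  then show ?thesis by (simp add: sum_pairs)
qed

lemma flatten_less: "i < m \<Longrightarrow> a < n \<Longrightarrow> i * n + a < m * (n :: nat)"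
  by (metis add.commute add_less_cancel_left less_le_trans mult.commute mult_Suc mult_le_mono1 Suc_leI nat_mult_le_cancel_disj)

lemma flatten_cases:
  assumes "r < m * (n :: nat)"
  obtains i a where "r = i * n + a" "i < m" "a < n"
proof -
  have "n > 0" using assms by (cases n) auto
  then show ?thesis using that[of "r div n" "r mod n"] assms by (simp add: less_mult_imp_div_less)
qed

lemma psd_on_flatten:
  fixes Q :: "nat \<Rightarrow> nat \<Rightarrow> complex"
  assumes "psd_on ({..<m} \<times> {..<n}) (\<lambda>p q. Q (fst p * n + snd p) (fst q * n + snd q))"
  shows "psd_on {..<m * n} Q"
  unfolding psd_on_def
proof (intro conjI allI)
  show "herm_on {..<m * n} Q"
    unfolding herm_on_def
  proof (intro ballI)
    fix r s assume "r \<in> {..<m * n}" "s \<in> {..<m * n}"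
    then have "r < m * n" "s < m * n" by auto
    obtain i a where r: "r = i * n + a" "i < m" "a < n" using \<open>r < m * n\<close> by (rule flatten_cases)
    obtain j b where s: "s = j * n + b" "j < m" "b < n" using \<open>s < m * n\<close> by (rule flatten_cases)
    have H: "herm_on ({..<m} \<times> {..<n}) (\<lambda>p q. Q (fst p * n + snd p) (fst q * n + snd q))"
      using assms by (simp add: psd_on_def)
    have "(i, a) \<in> {..<m} \<times> {..<n}" "(j, b) \<in> {..<m} \<times> {..<n}" using r s by auto
    from H[unfolded herm_on_def, rule_format, OF this] show "Q s r = cnj (Q r s)"
      unfolding r(1) s(1) fst_conv snd_conv .
  qed
  fix v
  have "sesq {..<m * n} Q v v = sesq ({..<m} \<times> {..<n}) (\<lambda>p q. Q (fst p * n + snd p) (fst q * n + snd q))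
      (\<lambda>p. v (fst p * n + snd p)) (\<lambda>p. v (fst p * n + snd p))"
    by (simp only: sesq_def sum_flatten)
  then show "0 \<le> Re (sesq {..<m * n} Q v v)" using assms by (simp add: psd_on_def)
qed

lemma psd_smult:
  assumes "psd N A" "0 \<le> (r :: real)"
  shows "psd N (of_real r \<cdot>\<^sub>m A)"
proof -
  have A: "A \<in> carrier_mat N N" using assms by (simp add: psd_def hermitian_def)
  have "psd_on {..<N} (\<lambda>i j. of_real r * A $$ (i, j))"
    using assms psd_iff_psd_on[OF A] by (intro psd_scale) auto
  moreover have "psd_on {..<N} (\<lambda>i j. (of_real r \<cdot>\<^sub>m A) $$ (i, j)) \<longleftrightarrow> psd_on {..<N} (\<lambda>i j. of_real r * A $$ (i, j))"
    using A by (intro psd_on_cong) auto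
  ultimately show ?thesis using A by (subst psd_iff_psd_on) auto
qed

lemma mat_block_carrier [simp]: "mat_block n X i j \<in> carrier_mat n n"
  by (simp add: mat_block_def)

lemma mat_block_index:
  "a < n \<Longrightarrow> b < n \<Longrightarrow> mat_block n X i j $$ (a, b) = X $$ (i * n + a, j * n + b)"
  by (simp add: mat_block_def)

lemma id_tensor_carrier [simp]: "id_tensor m n \<Phi> X \<in> carrier_mat (m * n) (m * n)"
  by (simp add: id_tensor_def)

lemma id_tensor_index:
  assumes "i < m" "j < m" "a < n" "b < n"
  shows "id_tensor m n \<Phi> X $$ (i * n + a, j * n + b) = \<Phi> (mat_block n X i j) $$ (a, b)"
  using assms flatten_less[of i m a n] flatten_less[of j m b n] by (simp add: id_tensor_def)

lemma id_tensor_smult: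
  assumes X: "X \<in> carrier_mat (m * n) (m * n)"
    and maps: "\<And>Y. Y \<in> carrier_mat n n \<Longrightarrow> \<Phi> Y \<in> carrier_mat n n"
    and homog: "\<And>c Y. Y \<in> carrier_mat n n \<Longrightarrow> \<Phi> (c \<cdot>\<^sub>m Y) = c \<cdot>\<^sub>m \<Phi> Y"
  shows "id_tensor m n \<Phi> (c \<cdot>\<^sub>m X) = c \<cdot>\<^sub>m id_tensor m n \<Phi> X"
proof (rule eq_matI)
  fix r s assume "r < dim_row (c \<cdot>\<^sub>m id_tensor m n \<Phi> X)" "s < dim_col (c \<cdot>\<^sub>m id_tensor m n \<Phi> X)"
  then have rs: "r < m * n" "s < m * n" by (simp_all add: id_tensor_def)
  obtain i a where r: "r = i * n + a" "i < m" "a < n" using rs(1) by (rule flatten_cases)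
  obtain j b where s: "s = j * n + b" "j < m" "b < n" using rs(2) by (rule flatten_cases)
  have "mat_block n (c \<cdot>\<^sub>m X) i j = c \<cdot>\<^sub>m mat_block n X i j"
    using X r s by (intro eq_matI) (auto simp: mat_block_def flatten_less)
  moreover have "\<Phi> (mat_block n X i j) \<in> carrier_mat n n" by (intro maps) simp
  ultimately show "id_tensor m n \<Phi> (c \<cdot>\<^sub>m X) $$ (r, s) = (c \<cdot>\<^sub>m id_tensor m n \<Phi> X) $$ (r, s)"
    using r s rs by (simp add: id_tensor_index homog) (simp add: id_tensor_def)
qed (simp_all add: id_tensor_def)

text \<open>Admissibility speaks only of trace 1. A semidefinite matrix of positive trace could be
  divided by its trace, which is real because the diagonal of a Hermitian matrix is; support and
  positivity of the image survive by homogeneity. So the condition applies to unnormalised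
  states.\<close>

lemma admissible_trace_nonpos:
  assumes adm: "nu_admissible m n \<Phi> S"
    and maps: "\<And>Y. Y \<in> carrier_mat n n \<Longrightarrow> \<Phi> Y \<in> carrier_mat n n"
    and homog: "\<And>c Y. Y \<in> carrier_mat n n \<Longrightarrow> \<Phi> (c \<cdot>\<^sub>m Y) = c \<cdot>\<^sub>m \<Phi> Y"
    and \<rho>: "psd (m * n) \<rho>" and supp: "mat_support \<rho> \<subseteq> S" and pos: "psd (m * n) (id_tensor m n \<Phi> \<rho>)"
  shows "Re (mat_trace \<rho>) \<le> 0"
proof (rule ccontr)
  assume "\<not> Re (mat_trace \<rho>) \<le> 0"
  then have tr: "Re (mat_trace \<rho>) > 0" by simp
  have \<rho>c: "\<rho> \<in> carrier_mat (m * n) (m * n)" using \<rho> by (simp add: psd_def hermitian_def)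
  define r where "r = 1 / Re (mat_trace \<rho>)"
  have r: "r > 0" using tr by (simp add: r_def)
  have H: "herm_on {..<m * n} (\<lambda>i j. \<rho> $$ (i, j))"
    using \<rho> hermitian_iff_herm_on[OF \<rho>c] by (simp add: psd_def)
  have "Im (\<rho> $$ (i, i)) = 0" if "i < m * n" for i
  proof -
    have "\<rho> $$ (i, i) = cnj (\<rho> $$ (i, i))" using H that unfolding herm_on_def by blast
    then have "Im (\<rho> $$ (i, i)) = Im (cnj (\<rho> $$ (i, i)))" by (rule arg_cong)
    then show ?thesis by simp
  qed
  then have "Im (mat_trace \<rho>) = 0" using \<rho>c by (simp add: mat_trace_def)
  then have "mat_trace \<rho> = of_real (Re (mat_trace \<rho>))" by (simp add: complex_eq_iff)
  moreover have "mat_trace (of_real r \<cdot>\<^sub>m \<rho>) = of_real r * mat_trace \<rho>"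
    using \<rho>c by (simp add: mat_trace_def sum_distrib_left)
  ultimately have "mat_trace (of_real r \<cdot>\<^sub>m \<rho>) = of_real (r * Re (mat_trace \<rho>))" by simp
  also have "r * Re (mat_trace \<rho>) = 1" using tr by (simp add: r_def)
  finally have "density_matrix (m * n) (of_real r \<cdot>\<^sub>m \<rho>)"
    using psd_smult[OF \<rho>, of r] r by (simp add: density_matrix_def)
  moreover have "mat_support (of_real r \<cdot>\<^sub>m \<rho>) \<subseteq> S"
  proof -
    have "(of_real r \<cdot>\<^sub>m \<rho>) *\<^sub>v v = \<rho> *\<^sub>v (of_real r \<cdot>\<^sub>v v)" if "v \<in> carrier_vec (m * n)" for v
      using \<rho>c that by (intro eq_vecI) (auto simp: scalar_prod_def sum_distrib_left mult_ac)
    then show ?thesis using supp \<rho>c by (auto simp: mat_support_def)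
  qed
  moreover have "psd (m * n) (id_tensor m n \<Phi> (of_real r \<cdot>\<^sub>m \<rho>))"
    using psd_smult[OF pos, of r] r by (simp add: id_tensor_smult[OF \<rho>c maps homog])
  ultimately show False using adm by (simp add: nu_admissible_def)
qed

lemma breuer_hall_carrier:
  "X \<in> carrier_mat n n \<Longrightarrow> U \<in> carrier_mat n n \<Longrightarrow> breuer_hall n U X \<in> carrier_mat n n"
  unfolding breuer_hall_def
  by (intro minus_carrier_mat mult_carrier_mat[of _ n n _ n] mat_adjoint_carrier transpose_carrier_mat[THEN iffD2])

lemma breuer_hall_index:
  assumes X: "X \<in> carrier_mat n n" and U: "U \<in> carrier_mat n n" and ab: "a < n" "b < n"
  shows "breuer_hall n U X $$ (a, b) = delta a b * (\<Sum>w<n. X $$ (w, w)) - X $$ (a, b)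
    - (\<Sum>x<n. \<Sum>y<n. U $$ (a, x) * X $$ (y, x) * cnj (U $$ (b, y)))"
proof -
  have Ua: "mat_adjoint U \<in> carrier_mat n n" by (rule mat_adjoint_carrier[OF U])
  have UX: "(U * transpose_mat X) $$ (a, y) = (\<Sum>x<n. U $$ (a, x) * X $$ (y, x))" if "y < n" for y
    using U X ab that by (simp add: scalar_prod_def atLeast0LessThan)
  have "(U * transpose_mat X * mat_adjoint U) $$ (a, b)
    = (\<Sum>y<n. (U * transpose_mat X) $$ (a, y) * mat_adjoint U $$ (y, b))"
    using U X Ua ab by (subst index_mult_mat(1)) (auto simp: scalar_prod_def atLeast0LessThan)
  also have "\<dots> = (\<Sum>y<n. \<Sum>x<n. U $$ (a, x) * X $$ (y, x) * cnj (U $$ (b, y)))"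
    using ab U by (intro sum.cong refl) (simp add: UX mat_adjoint_index[OF U] sum_distrib_right)
  also have "\<dots> = (\<Sum>x<n. \<Sum>y<n. U $$ (a, x) * X $$ (y, x) * cnj (U $$ (b, y)))"
    by (rule sum.swap)
  finally have 1: "(U * transpose_mat X * mat_adjoint U) $$ (a, b)
    = (\<Sum>x<n. \<Sum>y<n. U $$ (a, x) * X $$ (y, x) * cnj (U $$ (b, y)))" .
  show ?thesis
    unfolding breuer_hall_def 1[symmetric]
    using U X Ua ab by (auto simp: mat_trace_def delta_def)
qed

lemma breuer_hall_smult:
  assumes X: "X \<in> carrier_mat n n" and U: "U \<in> carrier_mat n n"
  shows "breuer_hall n U (c \<cdot>\<^sub>m X) = c \<cdot>\<^sub>m breuer_hall n U X"
proof (rule eq_matI)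
  have cX: "c \<cdot>\<^sub>m X \<in> carrier_mat n n" using X by simp
  note car = breuer_hall_carrier[OF X U] breuer_hall_carrier[OF cX U]
  show "dim_row (breuer_hall n U (c \<cdot>\<^sub>m X)) = dim_row (c \<cdot>\<^sub>m breuer_hall n U X)"
    "dim_col (breuer_hall n U (c \<cdot>\<^sub>m X)) = dim_col (c \<cdot>\<^sub>m breuer_hall n U X)"
    using car by auto
  fix a b assume "a < dim_row (c \<cdot>\<^sub>m breuer_hall n U X)" "b < dim_col (c \<cdot>\<^sub>m breuer_hall n U X)"
  then have ab: "a < n" "b < n" using car by auto
  have "(\<Sum>x<n. \<Sum>y<n. U $$ (a, x) * (c * X $$ (y, x)) * cnj (U $$ (b, y)))
    = c * (\<Sum>x<n. \<Sum>y<n. U $$ (a, x) * X $$ (y, x) * cnj (U $$ (b, y)))"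
    unfolding sum_distrib_left by (intro sum.cong refl) simp
  then show "breuer_hall n U (c \<cdot>\<^sub>m X) $$ (a, b) = (c \<cdot>\<^sub>m breuer_hall n U X) $$ (a, b)"
    using ab car X by (simp add: breuer_hall_index[OF X U] breuer_hall_index[OF cX U] sum_distrib_left algebra_simps)
qed

text \<open>The compressed form maps every vector into the span of the \<open>c j\<close>; this is
  how the support condition is verified.\<close>

lemma compress_mult_vec:
  fixes x :: "nat \<Rightarrow> nat \<Rightarrow> complex"
  obtains y where "\<And>p. (\<Sum>q\<in>P. compress m (\<lambda>t p. \<Sum>j<d. x t j * c j p) \<sigma> p q * u q) = (\<Sum>j<d. y j * c j p)"
proof -
  define V where "V t p = (\<Sum>j<d. x t j * c j p)" for t p
  define \<gamma> where "\<gamma> i = (\<Sum>q\<in>P. \<Sum>t<m. \<sigma> i t * cnj (V t q) * u q)" for i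
  have "(\<Sum>q\<in>P. compress m V \<sigma> p q * u q) = (\<Sum>j<d. (\<Sum>i<m. x i j * \<gamma> i) * c j p)" for p
  proof -
    have "(\<Sum>q\<in>P. compress m V \<sigma> p q * u q) = (\<Sum>q\<in>P. \<Sum>i<m. \<Sum>t<m. V i p * (\<sigma> i t * cnj (V t q) * u q))"
      unfolding compress_def sesq_def sum_distrib_right by (intro sum.cong refl) simp
    also have "\<dots> = (\<Sum>i<m. \<Sum>q\<in>P. \<Sum>t<m. V i p * (\<sigma> i t * cnj (V t q) * u q))"
      by (rule sum.swap)
    also have "\<dots> = (\<Sum>i<m. V i p * \<gamma> i)" by (simp add: \<gamma>_def sum_distrib_left)
    also have "\<dots> = (\<Sum>i<m. \<Sum>j<d. x i j * \<gamma> i * c j p)"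
      unfolding V_def sum_distrib_right by (intro sum.cong refl) simp
    also have "\<dots> = (\<Sum>j<d. \<Sum>i<m. x i j * \<gamma> i * c j p)" by (rule sum.swap)
    finally show ?thesis by (simp add: sum_distrib_right)
  qed
  then show ?thesis unfolding V_def[abs_def] by (rule that)
qed

text \<open>A basis of a larger subspace, read in pair indices, would give through
  \<open>breuer_hall_state\<close> a state forbidden by admissibility. Here \<open>k + 1\<close> is
  half of \<open>n + 2\<close>.\<close>

lemma breuer_hall_admissible_dim_less:
  assumes n: "n = 2 * k" and k: "k > 0" and m: "m > 0"
    and U: "unitary_mat n U" and skew: "transpose_mat U = - U"
    and adm: "nu_admissible m n (breuer_hall n U) S"
  shows "vec_subspace_dim (m * n) S < m * (k + 1)"
proof (rule ccontr)
  let ?N = "{..<m} \<times> {..<n}"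
  let ?fl = "\<lambda>p. fst p * n + snd p"
  define d where "d = vec_subspace_dim (m * n) S"
  assume "\<not> vec_subspace_dim (m * n) S < m * (k + 1)"
  then have d: "m * (k + 1) \<le> d" by (simp add: d_def)
  have S: "vec_subspace (m * n) S" using adm by (simp add: nu_admissible_def)
  obtain w where wS: "\<And>j. j < d \<Longrightarrow> w j \<in> S" and ind: "independent_on {..<m * n} {..<d} (\<lambda>j r. w j $ r)"
    using vec_subspace_basis[OF S] unfolding d_def by blast
  define c where "c j p = w j $ ?fl p" for j p
  have c: "independent_on ?N {..<d} c"
    unfolding independent_on_def
  proof (intro allI impI)
    fix x assume x: "\<forall>p\<in>?N. (\<Sum>j<d. x j * c j p) = 0"
    have "(\<Sum>j<d. x j * w j $ r) = 0" if r: "r < m * n" for r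
    proof -
      obtain i a where "r = i * n + a" "i < m" "a < n" using r by (rule flatten_cases)
      then show ?thesis using bspec[OF x, of "(i, a)"] by (simp add: c_def)
    qed
    then show "\<forall>j\<in>{..<d}. x j = 0" using ind unfolding independent_on_def by blast
  qed
  have Uc: "U \<in> carrier_mat n n" using U by (simp add: unitary_mat_def)
  have un: "(\<Sum>i<n. cnj (U $$ (i, x)) * U $$ (i, y)) = delta x y" if xy: "x < n" "y < n" for x y
  proof -
    have "(mat_adjoint U * U) $$ (x, y) = (\<Sum>i<n. mat_adjoint U $$ (x, i) * U $$ (i, y))"
      using Uc mat_adjoint_carrier[OF Uc] xy by (subst index_mult_mat(1)) (auto simp: scalar_prod_def atLeast0LessThan)
    also have "\<dots> = (\<Sum>i<n. cnj (U $$ (i, x)) * U $$ (i, y))"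
      using xy by (intro sum.cong refl) (simp add: mat_adjoint_index[OF Uc])
    finally have eq: "(mat_adjoint U * U) $$ (x, y) = (\<Sum>i<n. cnj (U $$ (i, x)) * U $$ (i, y))" .
    show ?thesis unfolding eq[symmetric] using U xy by (simp add: unitary_mat_def delta_def)
  qed
  have sk: "U $$ (y, x) = - U $$ (x, y)" if "x < n" "y < n" for x y
  proof -
    have "transpose_mat U $$ (x, y) = (- U) $$ (x, y)" by (simp only: skew)
    then show ?thesis using that Uc by simp
  qed
  obtain \<sigma> x where \<sigma>: "psd_on {..<m} \<sigma>"
    and tr: "0 < (\<Sum>p\<in>?N. Re (compress m (\<lambda>t p. \<Sum>j<d. x t j * c j p) \<sigma> p p))"
    and pos: "psd_on ?N (breuer_hall_form n (\<lambda>x y. U $$ (x, y)) (compress m (\<lambda>t p. \<Sum>j<d. x t j * c j p) \<sigma>))"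
    using breuer_hall_state[where U = "\<lambda>x y. U $$ (x, y)", OF n k m un sk c d] by blast
  define \<rho>f where "\<rho>f = compress m (\<lambda>t p. \<Sum>j<d. x t j * c j p) \<sigma>"
  define \<rho> where "\<rho> = mat (m * n) (m * n) (\<lambda>(r, s). \<rho>f (r div n, r mod n) (s div n, s mod n))"
  have \<rho>c: "\<rho> \<in> carrier_mat (m * n) (m * n)" by (simp add: \<rho>_def)
  have \<rho>i: "\<rho> $$ (?fl p, ?fl q) = \<rho>f p q" if "p \<in> ?N" "q \<in> ?N" for p q
    using that flatten_less[of "fst p" m "snd p" n] flatten_less[of "fst q" m "snd q" n] by (auto simp: \<rho>_def)
  have \<rho>: "psd (m * n) \<rho>"
    unfolding psd_iff_psd_on[OF \<rho>c]
  proof (rule psd_on_flatten)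
    show "psd_on ?N (\<lambda>p q. \<rho> $$ (?fl p, ?fl q))"
      using psd_compress[OF \<sigma>, of ?N] psd_on_cong[of ?N "\<lambda>p q. \<rho> $$ (?fl p, ?fl q)" \<rho>f, OF \<rho>i]
      by (simp add: \<rho>f_def)
  qed
  have supp: "mat_support \<rho> \<subseteq> S"
  proof (clarsimp simp: mat_support_def)
    fix u :: "complex vec" assume "u \<in> carrier_vec (dim_col \<rho>)"
    then have u: "u \<in> carrier_vec (m * n)" using \<rho>c by simp
    obtain y where y: "\<And>p. (\<Sum>q\<in>?N. \<rho>f p q * u $ ?fl q) = (\<Sum>j<d. y j * c j p)"
      unfolding \<rho>f_def using compress_mult_vec[where u = "\<lambda>q. u $ (fst q * n + snd q)"] by blast
    have "\<rho> *\<^sub>v u = vec (m * n) (\<lambda>r. \<Sum>j<d. y j * w j $ r)"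
    proof (rule eq_vecI)
      fix r assume "r < dim_vec (vec (m * n) (\<lambda>r. \<Sum>j<d. y j * w j $ r))"
      then have r: "r < m * n" by simp
      obtain i a where ia: "r = i * n + a" "i < m" "a < n" using r by (rule flatten_cases)
      have "(\<rho> *\<^sub>v u) $ r = (\<Sum>s<m * n. \<rho> $$ (r, s) * u $ s)"
        using \<rho>c u r by (simp add: scalar_prod_def atLeast0LessThan)
      also have "\<dots> = (\<Sum>q\<in>?N. \<rho>f (i, a) q * u $ ?fl q)"
        unfolding sum_flatten using ia \<rho>i[of "(i, a)"] by (intro sum.cong refl) simp
      also have "\<dots> = (\<Sum>j<d. y j * w j $ r)" unfolding y by (simp add: c_def ia)
      finally show "(\<rho> *\<^sub>v u) $ r = vec (m * n) (\<lambda>r. \<Sum>j<d. y j * w j $ r) $ r" using r by simp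
    qed (use \<rho>c in simp)
    then show "\<rho> *\<^sub>v u \<in> S" using vec_subspace_lincomb[OF S wS] by simp
  qed
  have "psd (m * n) (id_tensor m n (breuer_hall n U) \<rho>)"
    unfolding psd_iff_psd_on[OF id_tensor_carrier]
  proof (rule psd_on_flatten)
    have "id_tensor m n (breuer_hall n U) \<rho> $$ (?fl p, ?fl q) = breuer_hall_form n (\<lambda>x y. U $$ (x, y)) \<rho>f p q"
      if pq: "p \<in> ?N" "q \<in> ?N" for p q
    proof -
      obtain i a j b where ij: "p = (i, a)" "q = (j, b)" "i < m" "j < m" "a < n" "b < n"
        using pq by (cases p, cases q) auto
      have bl: "mat_block n \<rho> i j $$ (x, y) = \<rho>f (i, x) (j, y)" if "x < n" "y < n" for x y
        using \<rho>i[of "(i, x)" "(j, y)"] that ij by (simp add: mat_block_index)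
      show ?thesis
        using ij by (simp add: id_tensor_index breuer_hall_index[OF mat_block_carrier Uc] bl
            breuer_hall_form_def reduction_def tensor_id_def ptrace_def)
    qed
    then show "psd_on ?N (\<lambda>p q. id_tensor m n (breuer_hall n U) \<rho> $$ (?fl p, ?fl q))"
      using pos unfolding \<rho>f_def[symmetric] by (subst psd_on_cong) auto
  qed
  from admissible_trace_nonpos[OF adm breuer_hall_carrier[OF _ Uc] breuer_hall_smult[OF _ Uc] \<rho> supp this]
  have "Re (mat_trace \<rho>) \<le> 0" by simp
  moreover have "mat_trace \<rho> = (\<Sum>p\<in>?N. \<rho>f p p)"
    using \<rho>c by (simp add: mat_trace_def sum_flatten \<rho>i)
  ultimately show False using tr by (simp add: \<rho>f_def)
qed

section \<open>Superadditivity\<close>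

lemma vec_subspace_dim_le: "vec_subspace N S \<Longrightarrow> vec_subspace_dim N S \<le> N"
  by (rule vec_subspace_basis)

lemma zero_subspace_admissible: "nu_admissible m n \<Phi> {0\<^sub>v (m * n)}"
  unfolding nu_admissible_def
proof (intro conjI allI impI)
  show "vec_subspace (m * n) {0\<^sub>v (m * n)}" by (rule vec_subspaceI) auto
  fix \<rho> assume *: "density_matrix (m * n) \<rho> \<and> mat_support \<rho> \<subseteq> {0\<^sub>v (m * n)}"
  then have \<rho>: "\<rho> \<in> carrier_mat (m * n) (m * n)" by (simp add: density_matrix_def psd_def hermitian_def)
  have "\<rho> $$ (i, i) = 0" if i: "i < m * n" for i
  proof -
    have "\<rho> *\<^sub>v unit_vec (m * n) i \<in> mat_support \<rho>"
      unfolding mat_support_def using \<rho> by (intro imageI) simp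
    then have "\<rho> *\<^sub>v unit_vec (m * n) i = 0\<^sub>v (m * n)" using * by auto
    then have "(\<rho> *\<^sub>v unit_vec (m * n) i) $ i = 0" using i by simp
    then show ?thesis using \<rho> i by (simp add: scalar_prod_right_unit)
  qed
  then have "mat_trace \<rho> = 0" using \<rho> by (simp add: mat_trace_def)
  then show "\<not> psd (m * n) (id_tensor m n \<Phi> \<rho>)" using * by (simp add: density_matrix_def)
qed

lemma nu_m_maximum:
  shows nu_m_attained: "\<exists>S. nu_admissible m n \<Phi> S \<and> vec_subspace_dim (m * n) S = nu_m m n \<Phi>"
    and dim_le_nu_m: "nu_admissible m n \<Phi> S \<Longrightarrow> vec_subspace_dim (m * n) S \<le> nu_m m n \<Phi>"
proof -
  define D where "D = {vec_subspace_dim (m * n) S | S. nu_admissible m n \<Phi> S}"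
  have nu: "nu_m m n \<Phi> = Max D" by (simp add: nu_m_def D_def)
  have "D \<subseteq> {..m * n}"
  proof
    fix d assume "d \<in> D"
    then obtain S where d: "d = vec_subspace_dim (m * n) S" and S: "vec_subspace (m * n) S"
      by (auto simp: D_def nu_admissible_def)
    show "d \<in> {..m * n}" using vec_subspace_dim_le[OF S] by (simp add: d)
  qed
  then have fin: "finite D" by (rule finite_subset) simp
  have "D \<noteq> {}" using zero_subspace_admissible by (auto simp: D_def)
  then have "Max D \<in> D" using fin by simp
  then show "\<exists>S. nu_admissible m n \<Phi> S \<and> vec_subspace_dim (m * n) S = nu_m m n \<Phi>"
    unfolding nu by (auto simp: D_def)
  show "vec_subspace_dim (m * n) S \<le> nu_m m n \<Phi>" if "nu_admissible m n \<Phi> S"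
    unfolding nu using fin that by (intro Max_ge) (auto simp: D_def)
qed

definition vec_slice :: "nat \<Rightarrow> nat \<Rightarrow> complex vec \<Rightarrow> complex vec" where
  "vec_slice l M v = vec M (\<lambda>r. v $ (l + r))"

definition diag_slice :: "nat \<Rightarrow> nat \<Rightarrow> complex mat \<Rightarrow> complex mat" where
  "diag_slice l M A = mat M M (\<lambda>(r, s). A $$ (l + r, l + s))"

lemma psd_diag_slice:
  assumes A: "psd N A" and le: "l + M \<le> N"
  shows "psd M (diag_slice l M A)"
proof -
  have Ac: "A \<in> carrier_mat N N" using A by (simp add: psd_def hermitian_def)
  have Bc: "diag_slice l M A \<in> carrier_mat M M" by (simp add: diag_slice_def)
  have "psd_on {..<M} (\<lambda>r s. sesq {..<N} (\<lambda>r s. A $$ (r, s)) (delta (l + r)) (delta (l + s)))"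
    using A psd_iff_psd_on[OF Ac] by (intro psd_congruence) simp
  then have "psd_on {..<M} (\<lambda>r s. diag_slice l M A $$ (r, s))"
    using le by (subst psd_on_cong) (auto simp: sesq_unit diag_slice_def)
  then show ?thesis by (simp add: psd_iff_psd_on[OF Bc])
qed

text \<open>The cut begins and ends at multiples of \<open>n\<close>, so it consists of whole
  blocks, and the map acts on each block separately.\<close>

lemma id_tensor_diag_slice:
  assumes le: "i0 + m' \<le> m"
  shows "id_tensor m' n \<Phi> (diag_slice (i0 * n) (m' * n) \<rho>) = diag_slice (i0 * n) (m' * n) (id_tensor m n \<Phi> \<rho>)"
proof (rule eq_matI)
  fix r s assume "r < dim_row (diag_slice (i0 * n) (m' * n) (id_tensor m n \<Phi> \<rho>))"
    "s < dim_col (diag_slice (i0 * n) (m' * n) (id_tensor m n \<Phi> \<rho>))"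
  then have rs: "r < m' * n" "s < m' * n" by (simp_all add: diag_slice_def)
  obtain i a where r: "r = i * n + a" "i < m'" "a < n" using rs(1) by (rule flatten_cases)
  obtain j b where s: "s = j * n + b" "j < m'" "b < n" using rs(2) by (rule flatten_cases)
  have shift: "i0 * n + (i * n + a) = (i0 + i) * n + a" for i a by (simp add: algebra_simps)
  have "mat_block n (diag_slice (i0 * n) (m' * n) \<rho>) i j = mat_block n \<rho> (i0 + i) (i0 + j)"
    using r s by (intro eq_matI) (simp_all add: mat_block_def diag_slice_def flatten_less shift)
  then show "id_tensor m' n \<Phi> (diag_slice (i0 * n) (m' * n) \<rho>) $$ (r, s)
    = diag_slice (i0 * n) (m' * n) (id_tensor m n \<Phi> \<rho>) $$ (r, s)"
    using r s le by (simp add: id_tensor_index diag_slice_def flatten_less shift)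
qed (simp_all add: id_tensor_def diag_slice_def)

text \<open>Padding \<open>u\<close> with zeros supplies \<open>u'\<close>. Hence the support of a
  diagonal slice is contained in the slice of the support.\<close>

lemma diag_slice_mult_vec:
  assumes A: "A \<in> carrier_mat N N" and le: "l + M \<le> N" and u: "u \<in> carrier_vec M"
  obtains u' where "u' \<in> carrier_vec N" "diag_slice l M A *\<^sub>v u = vec_slice l M (A *\<^sub>v u')"
proof
  define u' where "u' = vec N (\<lambda>s. if l \<le> s \<and> s < l + M then u $ (s - l) else 0)"
  show "u' \<in> carrier_vec N" by (simp add: u'_def)
  show "diag_slice l M A *\<^sub>v u = vec_slice l M (A *\<^sub>v u')"
  proof (rule eq_vecI)
    fix r assume "r < dim_vec (vec_slice l M (A *\<^sub>v u'))"
    then have r: "r < M" by (simp add: vec_slice_def)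
    obtain N' where N': "N = l + M + N'" using le by (metis le_Suc_ex)
    have "(A *\<^sub>v u') $ (l + r) = (\<Sum>s<N. A $$ (l + r, s) * u' $ s)"
      using A r le by (simp add: scalar_prod_def atLeast0LessThan u'_def)
    also have "\<dots> = (\<Sum>s<l. A $$ (l + r, s) * u' $ s) + (\<Sum>s<M. A $$ (l + r, l + s) * u' $ (l + s))
        + (\<Sum>s<N'. A $$ (l + r, l + M + s) * u' $ (l + M + s))"
      unfolding N' sum_lessThan_add ..
    also have "(\<Sum>s<l. A $$ (l + r, s) * u' $ s) = 0" using le by (simp add: u'_def)
    also have "(\<Sum>s<N'. A $$ (l + r, l + M + s) * u' $ (l + M + s)) = 0" using N' by (simp add: u'_def)
    also have "(\<Sum>s<M. A $$ (l + r, l + s) * u' $ (l + s)) = (\<Sum>s<M. A $$ (l + r, l + s) * u $ s)"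
      using le by (intro sum.cong refl) (simp add: u'_def)
    also have "\<dots> = (diag_slice l M A *\<^sub>v u) $ r"
      using r u by (simp add: diag_slice_def scalar_prod_def atLeast0LessThan)
    finally show "(diag_slice l M A *\<^sub>v u) $ r = vec_slice l M (A *\<^sub>v u') $ r"
      using r by (simp add: vec_slice_def)
  qed (simp add: diag_slice_def vec_slice_def)
qed

text \<open>On a direct sum of admissible subspaces, a state and its image can be compressed to the two
  diagonal blocks.\<close>

lemma nu_m_superadditive:
  assumes maps: "\<And>Y. Y \<in> carrier_mat n n \<Longrightarrow> \<Phi> Y \<in> carrier_mat n n"
    and homog: "\<And>c Y. Y \<in> carrier_mat n n \<Longrightarrow> \<Phi> (c \<cdot>\<^sub>m Y) = c \<cdot>\<^sub>m \<Phi> Y"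
  shows "nu_m m1 n \<Phi> + nu_m m2 n \<Phi> \<le> nu_m (m1 + m2) n \<Phi>"
proof -
  define N1 where "N1 = m1 * n"
  define N2 where "N2 = m2 * n"
  have N: "(m1 + m2) * n = N1 + N2" by (simp add: N1_def N2_def algebra_simps)
  obtain S1 where adm1: "nu_admissible m1 n \<Phi> S1" and dim1: "vec_subspace_dim N1 S1 = nu_m m1 n \<Phi>"
    using nu_m_attained unfolding N1_def by blast
  obtain S2 where adm2: "nu_admissible m2 n \<Phi> S2" and dim2: "vec_subspace_dim N2 S2 = nu_m m2 n \<Phi>"
    using nu_m_attained unfolding N2_def by blast
  have S1: "vec_subspace N1 S1" and S2: "vec_subspace N2 S2"
    using adm1 adm2 by (simp_all add: nu_admissible_def N1_def N2_def)
  define S where "S = {v \<in> carrier_vec (N1 + N2). vec_slice 0 N1 v \<in> S1 \<and> vec_slice N1 N2 v \<in> S2}"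
  have S: "vec_subspace (N1 + N2) S"
  proof (rule vec_subspaceI)
    show "S \<subseteq> carrier_vec (N1 + N2)" by (auto simp: S_def)
    have "vec_slice 0 N1 (0\<^sub>v (N1 + N2)) = 0\<^sub>v N1" "vec_slice N1 N2 (0\<^sub>v (N1 + N2)) = 0\<^sub>v N2"
      by (auto simp: vec_slice_def)
    then show "0\<^sub>v (N1 + N2) \<in> S" using vec_subspaceD(2)[OF S1] vec_subspaceD(2)[OF S2] by (simp add: S_def)
  next
    fix u v assume uv: "u \<in> S" "v \<in> S"
    then have "vec_slice 0 N1 (u + v) = vec_slice 0 N1 u + vec_slice 0 N1 v"
      "vec_slice N1 N2 (u + v) = vec_slice N1 N2 u + vec_slice N1 N2 v"
      by (auto simp: vec_slice_def S_def)
    then show "u + v \<in> S" using uv vec_subspaceD(3)[OF S1] vec_subspaceD(3)[OF S2] by (simp add: S_def)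
  next
    fix c v assume v: "v \<in> S"
    then have "vec_slice 0 N1 (c \<cdot>\<^sub>v v) = c \<cdot>\<^sub>v vec_slice 0 N1 v"
      "vec_slice N1 N2 (c \<cdot>\<^sub>v v) = c \<cdot>\<^sub>v vec_slice N1 N2 v"
      by (auto simp: vec_slice_def S_def)
    then show "c \<cdot>\<^sub>v v \<in> S" using v vec_subspaceD(4)[OF S1] vec_subspaceD(4)[OF S2] by (simp add: S_def)
  qed
  define d1 where "d1 = nu_m m1 n \<Phi>"
  define d2 where "d2 = nu_m m2 n \<Phi>"
  obtain w1 where w1: "\<And>j. j < d1 \<Longrightarrow> w1 j \<in> S1" and ind1: "independent_on {..<N1} {..<d1} (\<lambda>j r. w1 j $ r)"
    using vec_subspace_basis[OF S1] unfolding dim1 d1_def by blast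
  obtain w2 where w2: "\<And>j. j < d2 \<Longrightarrow> w2 j \<in> S2" and ind2: "independent_on {..<N2} {..<d2} (\<lambda>j r. w2 j $ r)"
    using vec_subspace_basis[OF S2] unfolding dim2 d2_def by blast
  define w where "w j = (if j < d1 then vec (N1 + N2) (\<lambda>r. if r < N1 then w1 j $ r else 0)
    else vec (N1 + N2) (\<lambda>r. if r < N1 then 0 else w2 (j - d1) $ (r - N1)))" for j
  have wS: "w j \<in> S" if j: "j < d1 + d2" for j
  proof (cases "j < d1")
    case True
    have "w1 j \<in> carrier_vec N1" using w1[OF True] vec_subspaceD(1)[OF S1] by auto
    then have "vec_slice 0 N1 (w j) = w1 j" "vec_slice N1 N2 (w j) = 0\<^sub>v N2"
      using True by (auto simp: vec_slice_def w_def)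
    then show ?thesis using True w1 vec_subspaceD(2)[OF S2] by (simp add: S_def) (simp add: w_def)
  next
    case False
    then have j2: "j - d1 < d2" using j by simp
    then have "w2 (j - d1) \<in> carrier_vec N2" using w2[OF j2] vec_subspaceD(1)[OF S2] by auto
    then have "vec_slice 0 N1 (w j) = 0\<^sub>v N1" "vec_slice N1 N2 (w j) = w2 (j - d1)"
      using False by (auto simp: vec_slice_def w_def)
    then show ?thesis using False w2[OF j2] vec_subspaceD(2)[OF S1] by (simp add: S_def) (simp add: w_def)
  qed
  have ind: "independent_on {..<N1 + N2} {..<d1 + d2} (\<lambda>j r. w j $ r)"
    unfolding independent_on_def
  proof (intro allI impI ballI)
    fix x j assume x: "\<forall>r\<in>{..<N1 + N2}. (\<Sum>j<d1 + d2. x j * w j $ r) = 0" and j: "j \<in> {..<d1 + d2}"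
    have 1: "(\<Sum>j<d1. x j * w1 j $ r) = 0" if "r < N1" for r
    proof -
      have "(\<Sum>j<d1 + d2. x j * w j $ r) = (\<Sum>j<d1. x j * w1 j $ r)"
        unfolding sum_lessThan_add using that by (simp add: w_def)
      then show ?thesis using x that by simp
    qed
    have 2: "(\<Sum>j<d2. x (d1 + j) * w2 j $ r) = 0" if "r < N2" for r
    proof -
      have "(\<Sum>j<d1 + d2. x j * w j $ (N1 + r)) = (\<Sum>j<d2. x (d1 + j) * w2 j $ r)"
        unfolding sum_lessThan_add using that by (simp add: w_def)
      then show ?thesis using x that by simp
    qed
    have "\<forall>j\<in>{..<d1}. x j = 0"
      using ind1[unfolded independent_on_def, rule_format, of x] 1 by auto
    moreover have "\<forall>j\<in>{..<d2}. x (d1 + j) = 0"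
      using ind2[unfolded independent_on_def, rule_format, of "\<lambda>j. x (d1 + j)"] 2 by auto
    moreover have "j < d1 \<or> (\<exists>i<d2. j = d1 + i)" using j by (auto intro!: exI[of _ "j - d1"])
    ultimately show "x j = 0" by auto
  qed
  have "nu_admissible (m1 + m2) n \<Phi> S"
    unfolding nu_admissible_def N
  proof (intro conjI allI impI S notI)
    fix \<rho> assume *: "density_matrix (N1 + N2) \<rho> \<and> mat_support \<rho> \<subseteq> S"
      and pos: "psd (N1 + N2) (id_tensor (m1 + m2) n \<Phi> \<rho>)"
    have \<rho>: "psd (N1 + N2) \<rho>" and tr: "mat_trace \<rho> = 1" and supp: "mat_support \<rho> \<subseteq> S"
      using * by (auto simp: density_matrix_def)
    have \<rho>c: "\<rho> \<in> carrier_mat (N1 + N2) (N1 + N2)" using \<rho> by (simp add: psd_def hermitian_def)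
    have mem: "\<rho> *\<^sub>v u \<in> S" if "u \<in> carrier_vec (N1 + N2)" for u
      using supp that \<rho>c by (auto simp: mat_support_def)
    have supp1: "mat_support (diag_slice 0 N1 \<rho>) \<subseteq> S1"
    proof (clarsimp simp: mat_support_def)
      fix u :: "complex vec" assume "u \<in> carrier_vec (dim_col (diag_slice 0 N1 \<rho>))"
      then have "u \<in> carrier_vec N1" by (simp add: diag_slice_def)
      then obtain u' where "u' \<in> carrier_vec (N1 + N2)" "diag_slice 0 N1 \<rho> *\<^sub>v u = vec_slice 0 N1 (\<rho> *\<^sub>v u')"
        using diag_slice_mult_vec[OF \<rho>c, of 0 N1 u] by auto
      then show "diag_slice 0 N1 \<rho> *\<^sub>v u \<in> S1" using mem by (simp add: S_def)
    qed
    have supp2: "mat_support (diag_slice N1 N2 \<rho>) \<subseteq> S2"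
    proof (clarsimp simp: mat_support_def)
      fix u :: "complex vec" assume "u \<in> carrier_vec (dim_col (diag_slice N1 N2 \<rho>))"
      then have "u \<in> carrier_vec N2" by (simp add: diag_slice_def)
      then obtain u' where "u' \<in> carrier_vec (N1 + N2)" "diag_slice N1 N2 \<rho> *\<^sub>v u = vec_slice N1 N2 (\<rho> *\<^sub>v u')"
        using diag_slice_mult_vec[OF \<rho>c, of N1 N2 u] by auto
      then show "diag_slice N1 N2 \<rho> *\<^sub>v u \<in> S2" using mem by (simp add: S_def)
    qed
    have "psd N1 (id_tensor m1 n \<Phi> (diag_slice 0 N1 \<rho>))"
      using id_tensor_diag_slice[of 0 m1 "m1 + m2" n \<Phi> \<rho>] psd_diag_slice[OF pos, of 0 N1]
      by (simp add: N1_def)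
    then have le1: "Re (mat_trace (diag_slice 0 N1 \<rho>)) \<le> 0"
      using admissible_trace_nonpos[OF adm1 maps homog] psd_diag_slice[OF \<rho>, of 0 N1] supp1
      by (simp add: N1_def)
    have "psd N2 (id_tensor m2 n \<Phi> (diag_slice N1 N2 \<rho>))"
      using id_tensor_diag_slice[of m1 m2 "m1 + m2" n \<Phi> \<rho>] psd_diag_slice[OF pos, of N1 N2]
      by (simp add: N1_def N2_def)
    then have le2: "Re (mat_trace (diag_slice N1 N2 \<rho>)) \<le> 0"
      using admissible_trace_nonpos[OF adm2 maps homog] psd_diag_slice[OF \<rho>, of N1 N2] supp2
      by (simp add: N2_def)
    \<comment> \<open>The off-diagonal blocks do not enter the trace, so the two slices share the
      total trace 1, although admissibility makes both traces nonpositive.\<close>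
    have "mat_trace \<rho> = mat_trace (diag_slice 0 N1 \<rho>) + mat_trace (diag_slice N1 N2 \<rho>)"
      using \<rho>c by (simp add: mat_trace_def diag_slice_def sum_lessThan_add)
    then have "Re (mat_trace \<rho>) \<le> 0" using le1 le2 by simp
    then show False by (simp add: tr)
  qed
  from dim_le_nu_m[OF this] independent_imp_le_dim[OF S wS ind]
  show ?thesis unfolding N d1_def d2_def by linarith
qed

text \<open>Fekete's lemma. The limit is the supremum of the ratios over positive indices, which is
  finite by the linear bound.\<close>

lemma superadditive_ratio_convergent:
  fixes a :: "nat \<Rightarrow> nat"
  assumes super: "\<And>i j. a i + a j \<le> a (i + j)" and bound: "\<And>m. real (a m) \<le> C * real m"
  shows "convergent (\<lambda>m. real (a m) / real m)"
proof -
  define f where "f m = real (a m) / real m" for m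
  define L where "L = (SUP m\<in>{1..}. f m)"
  have "f m \<le> C" if "m \<ge> 1" for m using bound[of m] that by (simp add: f_def field_simps)
  then have bdd: "bdd_above (f ` {1..})" by (intro bdd_aboveI2[of _ _ C]) auto
  have le: "f m \<le> L" if "m \<ge> 1" for m unfolding L_def using that by (intro cSUP_upper bdd) auto
  have mult: "q * a p \<le> a (q * p)" for q p
  proof (induction q)
    case (Suc q)
    have "Suc q * a p \<le> a p + a (q * p)" using Suc by simp
    also have "\<dots> \<le> a (Suc q * p)" using super[of p "q * p"] by simp
    finally show ?case .
  qed simp
  have "f \<longlonglongrightarrow> L"
  proof (rule order_tendstoI)
    fix y assume "L < y"
    then have "f m < y" if "m \<ge> 1" for m using le[OF that] by simp
    then show "eventually (\<lambda>m. f m < y) sequentially" using eventually_ge_at_top[of 1] by (rule eventually_mono[rotated])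
  next
    fix y assume "y < L"
    then obtain p where p: "p \<ge> 1" "y < f p" unfolding L_def using less_cSUP_iff[OF _ bdd] by auto
    have lower: "(1 - real p / real m) * f p \<le> f m" if m: "m \<ge> 1" for m
    proof -
      define q where "q = m div p"
      \<comment> \<open>Division with remainder: the contribution of the remainder is nonnegative
        and is dropped, while \<open>q * p\<close> is still at least \<open>m - p\<close>. Hence the
        factor \<open>1 - p / m\<close>, which tends to 1.\<close>
      have "m = q * p + m mod p" by (simp add: q_def)
      then have "a (q * p) \<le> a m" using super[of "q * p" "m mod p"] by simp
      then have "q * a p \<le> a m" using mult[of q p] by linarith
      have "m mod p < p" using p by simp
      then have "m \<le> q * p + p" using \<open>m = q * p + m mod p\<close> by linarith
      then have "real m - real p \<le> real q * real p" by (simp flip: of_nat_mult of_nat_add add: le_diff_eq)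
      then have "(real m - real p) * f p \<le> real q * real p * f p"
        by (intro mult_right_mono) (auto simp: f_def)
      also have "\<dots> = real (q * a p)" using p by (simp add: f_def)
      also have "\<dots> \<le> real (a m)" using \<open>q * a p \<le> a m\<close> by (simp only: of_nat_le_iff)
      finally have "(real m - real p) * f p / real m \<le> f m"
        unfolding f_def[of m] by (intro divide_right_mono) auto
      then show ?thesis using m by (simp add: diff_divide_distrib left_diff_distrib)
    qed
    have "(\<lambda>m. (1 - real p / real m) * f p) \<longlonglongrightarrow> (1 - 0) * f p"
      by (intro tendsto_intros tendsto_divide_0[OF tendsto_const] filterlim_real_sequentially filterlim_at_infinity_imp_filterlim_at_top filterlim_at_top_imp_at_infinity)
    then have "eventually (\<lambda>m. y < (1 - real p / real m) * f p) sequentially"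
      using p by (intro order_tendstoD) auto
    then show "eventually (\<lambda>m. y < f m) sequentially"
      using eventually_ge_at_top[of 1] by eventually_elim (use lower in fastforce)
  qed
  then show ?thesis unfolding f_def[abs_def] by (rule convergentI)
qed

theorem theorem4:
  fixes n m :: nat and U :: "complex mat"
  assumes "n \<ge> 4" and "even n" and "m \<ge> 1"
    and "unitary_mat n U" and "transpose_mat U = - U"
  shows "real (nu_m m n (breuer_hall n U)) \<le> real m / 2 * (real n + 2) - 1
    \<and> nu n (breuer_hall n U) \<le> real n / 2 + 1"
proof -
  let ?a = "\<lambda>m. nu_m m n (breuer_hall n U)"
  obtain k where n: "n = 2 * k" using \<open>even n\<close> by (rule evenE)
  then have k: "k > 0" using \<open>n \<ge> 4\<close> by simp
  have Uc: "U \<in> carrier_mat n n" using assms by (simp add: unitary_mat_def)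
  have bound: "real (?a m) \<le> real m * (real k + 1) - 1" if m: "m \<ge> 1" for m
  proof -
    obtain S where S: "nu_admissible m n (breuer_hall n U) S" "vec_subspace_dim (m * n) S = ?a m"
      using nu_m_attained by blast
    have "?a m < m * (k + 1)"
      using breuer_hall_admissible_dim_less[OF n k _ assms(4,5) S(1)] m S(2) by simp
    \<comment> \<open>The strict inequality between natural numbers is where the \<open>- 1\<close>
      of the bound arises.\<close>
    then have "real (?a m + 1) \<le> real (m * (k + 1))" by (simp only: of_nat_le_iff)
    then show ?thesis by (simp add: algebra_simps)
  qed
  have "?a 0 = 0"
  proof -
    obtain S where S: "nu_admissible 0 n (breuer_hall n U) S" "vec_subspace_dim (0 * n) S = ?a 0"
      using nu_m_attained by blast
    have "vec_subspace (0 * n) S" using S(1) by (simp only: nu_admissible_def)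
    from vec_subspace_dim_le[OF this] show ?thesis unfolding S(2) by simp
  qed
  then have "real (?a m) \<le> (real k + 1) * real m" for m
    using bound[of m] by (cases "m = 0") (auto simp: mult.commute)
  then have "convergent (\<lambda>m. real (?a m) / real m)"
    using nu_m_superadditive[OF breuer_hall_carrier[OF _ Uc] breuer_hall_smult[OF _ Uc]]
    by (intro superadditive_ratio_convergent)
  \<comment> \<open>Convergence is established before any estimate, because \<open>lim\<close> in
    the definition of \<open>nu\<close> carries information only for a convergent sequence.\<close>
  then have "(\<lambda>m. real (?a m) / real m) \<longlonglongrightarrow> nu n (breuer_hall n U)"
    by (simp add: nu_def convergent_LIMSEQ_iff)
  moreover have "real (?a m) / real m \<le> real k + 1" if "m \<ge> 1" for m
    using bound[OF that] that by (simp add: divide_le_eq mult.commute)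
  ultimately have "nu n (breuer_hall n U) \<le> real k + 1"
    by (intro LIMSEQ_le_const2) auto
  then show ?thesis using bound[OF \<open>m \<ge> 1\<close>] by (simp add: n algebra_simps)
qed

end
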